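(* Let $H$ be a graph. If Maximum Matching Cut is polynomial-time solvable for $H$-free graphs, then it is polynomial-time solvable for $(H+P_2)$-free graphs.
   Context: All graphs are finite, undirected, without multiple edges and self-loops. A matching $M$ (a set of pairwise disjoint edges) of a connected graph $G=(V,E)$ is a matching cut if $V$ can be partitioned into two non-empty sets $B$ and $R$ such that $M$ consists of exactly all edges of $G$ with one end-vertex in $B$ and the other one in $R$. Maximum Matching Cut is the problem that takes as input a connected graph $G$ and asks to determine a largest matching cut of $G$ (one with maximum number of edges), if a matching cut exists. A graph is $H$-free if it does not contain $H$ as an induced subgraph. $P_2$ is the path on two vertices (a single edge), and $H+P_2$ is the disjoint union of $H$ and $P_2$. The graph $H$ is fixed, i.e. not part of the input. *)

theory Defs
  imports Main "HOL-Computational_Algebra.Polynomial"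
begin

section \<open>Graphs\<close>

record 'a ugraph =
  verts :: "'a set"
  edges :: "'a set set"

definition simple_graph :: "'a ugraph \<Rightarrow> bool" where
  "simple_graph G \<longleftrightarrow> finite (verts G) \<and> (\<forall>e\<in>edges G. e \<subseteq> verts G \<and> card e = 2)"

definition connected_graph :: "'a ugraph \<Rightarrow> bool" where
  "connected_graph G \<longleftrightarrow> verts G \<noteq> {} \<and>
     (\<forall>u\<in>verts G. \<forall>v\<in>verts G. (u, v) \<in> {(x, y). {x, y} \<in> edges G}\<^sup>*)"

definition graph_iso :: "'a ugraph \<Rightarrow> 'b ugraph \<Rightarrow> bool" where
  "graph_iso G H \<longleftrightarrow> (\<exists>f. bij_betw f (verts G) (verts H) \<and> (\<lambda>e. f ` e) ` edges G = edges H)"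

definition induced_subgraph :: "'a ugraph \<Rightarrow> 'a set \<Rightarrow> 'a ugraph" where
  "induced_subgraph G U = \<lparr>verts = U, edges = {e \<in> edges G. e \<subseteq> U}\<rparr>"

definition graph_free :: "'h ugraph \<Rightarrow> 'a ugraph \<Rightarrow> bool" where
  "graph_free H G \<longleftrightarrow> \<not> (\<exists>U \<subseteq> verts G. graph_iso H (induced_subgraph G U))"

definition graph_sum :: "'a ugraph \<Rightarrow> 'b ugraph \<Rightarrow> ('a + 'b) ugraph" where
  "graph_sum G H = \<lparr>verts = Inl ` verts G \<union> Inr ` verts H,
     edges = (\<lambda>e. Inl ` e) ` edges G \<union> (\<lambda>e. Inr ` e) ` edges H\<rparr>"

definition path_graph :: "nat \<Rightarrow> nat ugraph" where
  "path_graph n = \<lparr>verts = {..<n}, edges = {{i, Suc i} | i. Suc i < n}\<rparr>"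

section \<open>Matching cuts\<close>

definition is_matching :: "'a ugraph \<Rightarrow> 'a set set \<Rightarrow> bool" where
  "is_matching G M \<longleftrightarrow> M \<subseteq> edges G \<and> pairwise disjnt M"

definition matching_cut :: "'a ugraph \<Rightarrow> 'a set set \<Rightarrow> bool" where
  "matching_cut G M \<longleftrightarrow> is_matching G M \<and>
     (\<exists>B R. B \<noteq> {} \<and> R \<noteq> {} \<and> B \<inter> R = {} \<and> B \<union> R = verts G \<and>
        M = {{b, r} | b r. b \<in> B \<and> r \<in> R \<and> {b, r} \<in> edges G})"

definition maximum_matching_cut :: "'a ugraph \<Rightarrow> 'a set set \<Rightarrow> bool" where
  "maximum_matching_cut G M \<longleftrightarrow> matching_cut G M \<and>
     (\<forall>M'. matching_cut G M' \<longrightarrow> card M' \<le> card M)"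

section \<open>Polynomial time\<close>

text \<open>
  The model of computation is the language WHILE over binary trees of N. D. Jones
  (Computability and Complexity: From a Programming Perspective, MIT Press, 1997).
  It is polynomially equivalent to Turing machines: a store with finitely many
  variables is kept as a shared (acyclic) heap of pairs, to which one elementary
  operation adds at most one cell. In particular trees whose unfolding is
  exponentially large do not add computational power.  A program has no built-in
  arithmetic or equality; it can only construct pairs, take them apart, and test
  for the empty tree.
\<close>

datatype tree = Leaf | Node tree tree

primrec left :: "tree \<Rightarrow> tree" where
  "left Leaf = Leaf"
| "left (Node l r) = l"

primrec right :: "tree \<Rightarrow> tree" where
  "right Leaf = Leaf"
| "right (Node l r) = r"

datatype expr = EVar nat | ELeaf | ENode expr expr | ELeft expr | ERight expr

datatype com =
    Skip
  | Assign nat expr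
  | Seq com com
  | Cond expr com com
  | While expr com

type_synonym store = "nat \<Rightarrow> tree"

primrec eval_expr :: "expr \<Rightarrow> store \<Rightarrow> tree" where
  "eval_expr (EVar x) s = s x"
| "eval_expr ELeaf s = Leaf"
| "eval_expr (ENode a b) s = Node (eval_expr a s) (eval_expr b s)"
| "eval_expr (ELeft a) s = left (eval_expr a s)"
| "eval_expr (ERight a) s = right (eval_expr a s)"

text \<open>
  \<open>exec c s t s'\<close>: started in store \<open>s\<close>, the program \<open>c\<close> terminates in store \<open>s'\<close>
  after \<open>t\<close> steps. Evaluating an expression costs one step for each tree operation
  in it (this is the datatype function \<open>size\<close>), plus one for the assignment or test.
\<close>

inductive exec :: "com \<Rightarrow> store \<Rightarrow> nat \<Rightarrow> store \<Rightarrow> bool" where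
  Skip: "exec Skip s 1 s"
| Assign: "exec (Assign x e) s (size e + 1) (s(x := eval_expr e s))"
| Seq: "exec c1 s t1 s' \<Longrightarrow> exec c2 s' t2 s'' \<Longrightarrow> exec (Seq c1 c2) s (t1 + t2) s''"
| CondTrue: "eval_expr e s \<noteq> Leaf \<Longrightarrow> exec c1 s t s' \<Longrightarrow> exec (Cond e c1 c2) s (size e + 1 + t) s'"
| CondFalse: "eval_expr e s = Leaf \<Longrightarrow> exec c2 s t s' \<Longrightarrow> exec (Cond e c1 c2) s (size e + 1 + t) s'"
| WhileFalse: "eval_expr e s = Leaf \<Longrightarrow> exec (While e c) s (size e + 1) s"
| WhileTrue: "eval_expr e s \<noteq> Leaf \<Longrightarrow> exec c s t1 s' \<Longrightarrow> exec (While e c) s' t2 s'' \<Longrightarrow>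
    exec (While e c) s (size e + 1 + t1 + t2) s''"

lemma exec_deterministic:
  "exec c s t s' \<Longrightarrow> exec c s u s'' \<Longrightarrow> u = t \<and> s'' = s'"
proof (induction arbitrary: u s'' rule: exec.induct)
  case (Seq c1 s t1 s1 c2 t2 s2)
  from Seq.prems show ?case by cases (use Seq.IH in blast)
next
  case (CondTrue e s c1 t s' c2)
  from CondTrue.prems show ?case by cases (use CondTrue in blast)+
next
  case (CondFalse e s c2 t s' c1)
  from CondFalse.prems show ?case by cases (use CondFalse in blast)+
next
  case (WhileTrue e s c t1 s1 t2 s2)
  from WhileTrue.prems show ?case by cases (use WhileTrue in blast)+
qed (auto elim: exec.cases)

text \<open>The input is passed, and the output returned, in variable \<open>0\<close>.\<close>

definition input_store :: "tree \<Rightarrow> store" where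
  "input_store x = (\<lambda>_. Leaf)(0 := x)"

text \<open>
  A search problem is given by its set \<open>I\<close> of instances, an encoding \<open>enc\<close> of the
  instances and, for each instance, the set of (encoded) correct answers. Nothing is
  required of the program on inputs that do not encode an instance. The size of an
  input is the number of pairs in its encoding.
\<close>

definition poly_time_solvable :: "'i set \<Rightarrow> ('i \<Rightarrow> tree) \<Rightarrow> ('i \<Rightarrow> tree set) \<Rightarrow> bool" where
  "poly_time_solvable I enc answers \<longleftrightarrow>
     (\<exists>(p :: com) (q :: nat poly). \<forall>x\<in>I. \<exists>t s.
        exec p (input_store (enc x)) t s \<and> t \<le> poly q (size (enc x)) \<and> s 0 \<in> answers x)"

section \<open>Maximum Matching Cut as a computational problem\<close>

fun encode_list :: "tree list \<Rightarrow> tree" where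
  "encode_list [] = Leaf"
| "encode_list (x # xs) = Node x (encode_list xs)"

fun encode_bool :: "bool \<Rightarrow> tree" where
  "encode_bool False = Leaf"
| "encode_bool True = Node Leaf Leaf"

text \<open>The adjacency matrix of the graph with vertices \<open>{0..<n}\<close> and edge set \<open>E\<close>.\<close>

definition encode_edges :: "nat \<Rightarrow> nat set set \<Rightarrow> tree" where
  "encode_edges n E =
     encode_list (map (\<lambda>i. encode_list (map (\<lambda>j. encode_bool ({i, j} \<in> E)) [0..<n])) [0..<n])"

definition encode_graph :: "nat ugraph \<Rightarrow> tree" where
  "encode_graph G = encode_edges (card (verts G)) (edges G)"

fun encode_option :: "tree option \<Rightarrow> tree" where
  "encode_option None = Leaf"
| "encode_option (Some x) = Node x Leaf"

definition mmc_instances :: "nat ugraph set" where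
  "mmc_instances = {G. simple_graph G \<and> connected_graph G \<and> (\<exists>n. verts G = {0..<n})}"

definition mmc_answers :: "nat ugraph \<Rightarrow> tree set" where
  "mmc_answers G =
     (if \<exists>M. matching_cut G M
      then {encode_option (Some (encode_edges (card (verts G)) M)) | M. maximum_matching_cut G M}
      else {encode_option None})"

text \<open>
  Here \<open>H\<close> is not part of the input: program and polynomial may depend on it.
\<close>

definition mmc_poly_time_on_free :: "'h ugraph \<Rightarrow> bool" where
  "mmc_poly_time_on_free H \<longleftrightarrow>
     poly_time_solvable {G \<in> mmc_instances. graph_free H G} encode_graph mmc_answers"

end

theory Submission
  imports Defs
begin

text \<open>
  Let \<open>k\<close> be the number of vertices of \<open>H\<close>, and call a set \<open>U\<close> of at most \<open>k\<close> vertices of \<open>G\<close>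
  \<^emph>\<open>dominating\<close> if the vertices outside its closed neighbourhood \<open>N[U]\<close> are pairwise non-adjacent.
  If \<open>G\<close> contains \<open>H\<close> on \<open>U\<close> and has no induced \<open>H + P\<^sub>2\<close>, then \<open>U\<close> is dominating, because an
  edge outside \<open>N[U]\<close> would complete an induced \<open>H + P\<^sub>2\<close>. So a graph without a dominating set is
  \<open>H\<close>-free (\<open>graph_free_without_dominating_guess\<close>) and may be given to the program for \<open>H\<close>-free
  graphs. Which case applies is decided by trying all sets of at most \<open>k\<close> vertices; there are
  polynomially many since \<open>k\<close> is fixed.

  Let now \<open>U\<close> be dominating. A matching cut is a 2-colouring in which every vertex has at most one
  neighbour of the other colour. Hence its restriction to \<open>N[U]\<close> is determined by the colour of each
  \<open>u\<close> in \<open>U\<close> and by the at most one neighbour of \<open>u\<close> that is coloured differently: again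
  polynomially many guesses. What remains are the vertices \<open>v\<close> outside \<open>N[U]\<close>, all of whose
  neighbours are coloured already. For each colour of \<open>v\<close> there is at most one neighbour, its
  \<^emph>\<open>slot\<close>, that may become the other end of a cut edge at \<open>v\<close>, and no slot can serve two vertices.
  A largest cut extending the guess is thus a largest assignment of vertices to distinct slots,
  under the condition that the vertices that have a neighbour of the other colour whatever their
  colour are all assigned.

  Since a vertex has at most two slots, such an assignment is found by inserting the vertices one
  after the other, the evicted occupant of a slot moving on to its other slot. The argument that
  this is optimal is the easy half of Hall's and Koenig's theorems: if an insertion fails, then
  the slots of the vertex lie in a \<^emph>\<open>tight\<close> set, one that is fully occupied by items that have no slot
  outside it. A tight set admits no further item and stays tight (\<open>stuck_persists\<close>), and counting
  along the union of the tight sets bounds every other assignment (\<open>stuck_maximum\<close>). Inserting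
  the obligatory vertices first gives \<open>greedy_placement\<close> and then \<open>complete_optimal\<close>.
  Each candidate is checked to be a matching cut before the best one is selected, so only the
  completeness of the search needs this argument (\<open>solve_correct\<close>).

  For the running time, \<open>polytime f\<close> says that some program computes \<open>f\<close> on the codes of its
  arguments in polynomial time and that the codes of the results have polynomial size. This class of
  functions contains the constructors and destructors of the usual data types and is closed under
  composition, pairing, case distinction and loops whose intermediate results stay of polynomial
  size (\<open>polytime_fold\<close>). The algorithm is an ordinary functional program over lists, for which
  \<open>polytime\<close> follows by applying these closure rules.
\<close>

section \<open>Encodings and polynomial bounds\<close>

class encodable =
  fixes enc :: "'a \<Rightarrow> tree"

instantiation unit :: encodable begin
definition enc_unit :: "unit \<Rightarrow> tree" where "enc_unit x = Leaf"
instance ..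
end

text \<open>
  The encodings of Booleans, lists and options agree with the ones that fix the format of instances
  and answers, so that adjacency matrices are values of type \<^typ>\<open>bool list list\<close>.
\<close>

instantiation bool :: encodable begin
definition enc_bool :: "bool \<Rightarrow> tree" where "enc_bool = encode_bool"
instance ..
end

instantiation list :: (encodable) encodable begin
definition enc_list :: "'a list \<Rightarrow> tree" where "enc_list xs = encode_list (map enc xs)"
instance ..
end

text \<open>
  Unary, so that \<^term>\<open>n\<close> has the same code as a list of \<^term>\<open>n\<close> units and iterating over a number
  is a special case of iterating over a list.
\<close>

instantiation nat :: encodable begin
definition enc_nat :: "nat \<Rightarrow> tree" where "enc_nat n = encode_list (replicate n Leaf)"
instance ..
end

instantiation option :: (encodable) encodable begin
definition enc_option :: "'a option \<Rightarrow> tree" where "enc_option x = encode_option (map_option enc x)"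
instance ..
end

instantiation prod :: (encodable, encodable) encodable begin
definition enc_prod :: "'a \<times> 'b \<Rightarrow> tree" where "enc_prod x = Node (enc (fst x)) (enc (snd x))"
instance ..
end

lemma enc_simps [simp]:
  "enc () = Leaf"
  "enc False = Leaf"
  "enc True = Node Leaf Leaf"
  "enc ([] :: 'a::encodable list) = Leaf"
  "enc (x # xs :: 'a list) = Node (enc x) (enc xs)"
  "enc (0::nat) = Leaf"
  "enc (Suc n) = Node Leaf (enc n)"
  "enc (None :: 'a option) = Leaf"
  "enc (Some x) = Node (enc x) Leaf"
  "enc (x, y :: 'b::encodable) = Node (enc x) (enc y)"
  by (simp_all add: enc_unit_def enc_bool_def enc_list_def enc_nat_def enc_option_def enc_prod_def)

lemma size_enc_nat [simp]: "size (enc (n::nat)) = n"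
  by (induction n) auto

lemma length_le_size_enc: "length xs \<le> size (enc xs)"
  by (induction xs) auto

lemma size_enc_elem: "x \<in> set xs \<Longrightarrow> size (enc x) < size (enc xs)"
  by (induction xs) auto

lemma size_enc_list_le: "(\<And>x. x \<in> set xs \<Longrightarrow> size (enc x) \<le> b) \<Longrightarrow> size (enc xs) \<le> length xs * Suc b"
proof (induction xs)
  case (Cons x xs)
  have "size (enc x) \<le> b" "size (enc xs) \<le> length xs * Suc b"
    using Cons by auto
  then show ?case by simp
qed simp

lemma size_enc_append: "size (enc (xs @ ys)) = size (enc xs) + size (enc ys)"
  by (induction xs) auto

lemma size_enc_rev: "size (enc (rev xs)) = size (enc xs)"
  by (induction xs) (auto simp: size_enc_append)

text \<open>
  Bounds are functions of the argument itself rather than of its size; this allows adding up the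
  costs of the parts of a program without naming their polynomials.
\<close>

definition poly_bounded :: "('a::encodable \<Rightarrow> nat) \<Rightarrow> bool" where
  "poly_bounded g \<longleftrightarrow> (\<exists>q. \<forall>x. g x \<le> poly q (size (enc x)))"

lemma poly_nat_mono: "m \<le> n \<Longrightarrow> poly q m \<le> poly q (n::nat)"
  by (induction q) (auto intro!: add_mono mult_mono)

lemma poly_bounded_mono: "poly_bounded g \<Longrightarrow> (\<And>x. f x \<le> g x) \<Longrightarrow> poly_bounded f"
  unfolding poly_bounded_def by (meson order_trans)

lemma poly_bounded_const: "poly_bounded (\<lambda>x. c)"
  unfolding poly_bounded_def by (rule exI[of _ "[:c:]"]) simp

lemma poly_bounded_size: "poly_bounded (\<lambda>x. size (enc x))"
  unfolding poly_bounded_def by (rule exI[of _ "[:0, 1:]"]) simp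

lemma poly_bounded_add:
  assumes "poly_bounded f" "poly_bounded g"
  shows "poly_bounded (\<lambda>x. f x + g x)"
proof -
  from assms obtain q r where "\<forall>x. f x \<le> poly q (size (enc x))" "\<forall>x. g x \<le> poly r (size (enc x))"
    unfolding poly_bounded_def by blast
  then have "\<forall>x. f x + g x \<le> poly (q + r) (size (enc x))" by (simp add: add_mono)
  then show ?thesis unfolding poly_bounded_def by blast
qed

lemma poly_bounded_mult:
  assumes "poly_bounded f" "poly_bounded g"
  shows "poly_bounded (\<lambda>x. f x * g x)"
proof -
  from assms obtain q r where "\<forall>x. f x \<le> poly q (size (enc x))" "\<forall>x. g x \<le> poly r (size (enc x))"
    unfolding poly_bounded_def by blast
  then have "\<forall>x. f x * g x \<le> poly (q * r) (size (enc x))" by (simp add: mult_mono)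
  then show ?thesis unfolding poly_bounded_def by blast
qed

lemma poly_bounded_poly:
  assumes "poly_bounded f"
  shows "poly_bounded (\<lambda>x. poly q (f x))"
proof -
  from assms obtain r where "\<forall>x. f x \<le> poly r (size (enc x))"
    unfolding poly_bounded_def by blast
  then have "\<forall>x. poly q (f x) \<le> poly (pcompose q r) (size (enc x))"
    by (simp add: poly_pcompose poly_nat_mono)
  then show ?thesis unfolding poly_bounded_def by blast
qed

lemma poly_bounded_comp:
  assumes "poly_bounded g" "poly_bounded (\<lambda>x. size (enc (f x)))"
  shows "poly_bounded (\<lambda>x. g (f x))"
proof -
  from assms(1) obtain q where "\<forall>x. g x \<le> poly q (size (enc x))"
    unfolding poly_bounded_def by blast
  then show ?thesis by (intro poly_bounded_mono[OF poly_bounded_poly[OF assms(2), of q]]) simp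
qed

section \<open>Executions with time bounds\<close>

definition exec_within :: "com \<Rightarrow> store \<Rightarrow> nat \<Rightarrow> store \<Rightarrow> bool" where
  "exec_within c s T s' \<longleftrightarrow> (\<exists>t\<le>T. exec c s t s')"

lemma exec_within_mono: "exec_within c s T s' \<Longrightarrow> T \<le> T' \<Longrightarrow> exec_within c s T' s'"
  unfolding exec_within_def by (meson order_trans)

lemma exec_within_Assign: "exec_within (Assign x e) s (size e + 1) (s(x := eval_expr e s))"
  unfolding exec_within_def using exec.Assign by blast

lemma exec_within_Seq:
  "exec_within c1 s T1 s1 \<Longrightarrow> exec_within c2 s1 T2 s2 \<Longrightarrow> exec_within (Seq c1 c2) s (T1 + T2) s2"
  unfolding exec_within_def using exec.Seq by (meson add_mono)

lemma exec_within_Cond: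
  assumes "exec_within (if eval_expr e s \<noteq> Leaf then c1 else c2) s T s'"
  shows "exec_within (Cond e c1 c2) s (size e + 1 + T) s'"
proof -
  from assms obtain t where t: "t \<le> T" "exec (if eval_expr e s \<noteq> Leaf then c1 else c2) s t s'"
    unfolding exec_within_def by blast
  have "exec (Cond e c1 c2) s (size e + 1 + t) s'"
  proof (cases "eval_expr e s = Leaf")
    case True
    then show ?thesis using t(2) by (intro exec.CondFalse) simp_all
  next
    case False
    then show ?thesis using t(2) by (intro exec.CondTrue) simp_all
  qed
  then show ?thesis unfolding exec_within_def using t(1) by (meson add_left_mono)
qed

lemma exec_within_WhileFalse:
  "eval_expr e s = Leaf \<Longrightarrow> exec_within (While e c) s (size e + 1) s"
  unfolding exec_within_def using exec.WhileFalse by blast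

lemma exec_within_WhileTrue:
  assumes "eval_expr e s \<noteq> Leaf" "exec_within c s T1 s1" "exec_within (While e c) s1 T2 s2"
  shows "exec_within (While e c) s (size e + 1 + T1 + T2) s2"
  using assms exec.WhileTrue[OF assms(1)] unfolding exec_within_def by (meson add_mono order_refl)

fun assigned :: "com \<Rightarrow> nat set" where
  "assigned Skip = {}"
| "assigned (Assign x e) = {x}"
| "assigned (Seq c1 c2) = assigned c1 \<union> assigned c2"
| "assigned (Cond e c1 c2) = assigned c1 \<union> assigned c2"
| "assigned (While e c) = assigned c"

lemma finite_assigned: "finite (assigned c)"
  by (induction c) auto

lemma exec_unassigned: "exec c s t s' \<Longrightarrow> z \<notin> assigned c \<Longrightarrow> s' z = s z"
  by (induction rule: exec.induct) auto

lemma exec_within_unassigned: "exec_within c s t s' \<Longrightarrow> z \<notin> assigned c \<Longrightarrow> s' z = s z"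
  unfolding exec_within_def using exec_unassigned by blast

lemma fresh_variable:
  assumes "finite A"
  obtains z where "z \<notin> assigned c" "z \<notin> A"
proof -
  have "finite (assigned c \<union> A)" using assms by (simp add: finite_assigned)
  then obtain z where "z \<notin> assigned c \<union> A" using ex_new_if_finite[OF infinite_UNIV_nat] by blast
  then show thesis using that by blast
qed

section \<open>Functions computable in polynomial time\<close>

text \<open>
  The store is arbitrary except for the argument in variable \<open>0\<close>. So a program may run
  after others that have left values in the variables that it uses.
\<close>

definition computes :: "com \<Rightarrow> ('a::encodable \<Rightarrow> nat) \<Rightarrow> ('a \<Rightarrow> 'b::encodable) \<Rightarrow> bool" where
  "computes p T f \<longleftrightarrow> (\<forall>x s. s 0 = enc x \<longrightarrow> (\<exists>s'. exec_within p s (T x) s' \<and> s' 0 = enc (f x)))"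

lemma computesD:
  "computes p T f \<Longrightarrow> s 0 = enc x \<Longrightarrow> \<exists>s'. exec_within p s (T x) s' \<and> s' 0 = enc (f x)"
  unfolding computes_def by blast

text \<open>
  The bound on the size of the result does not follow from the time bound: by repeatedly pairing a
  tree with itself, a program builds an exponentially large tree in linear time.
\<close>

definition polytime :: "('a::encodable \<Rightarrow> 'b::encodable) \<Rightarrow> bool" where
  "polytime f \<longleftrightarrow> poly_bounded (\<lambda>x. size (enc (f x))) \<and> (\<exists>p T. poly_bounded T \<and> computes p T f)"

lemma polytimeI:
  assumes "poly_bounded (\<lambda>x. size (enc (f x)))" "poly_bounded T"
    "\<And>x s. s 0 = enc x \<Longrightarrow> \<exists>s'. exec_within p s (T x) s' \<and> s' 0 = enc (f x)"
  shows "polytime f"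
  using assms unfolding polytime_def computes_def by blast

lemma polytimeE:
  assumes "polytime f"
  obtains p T where "poly_bounded (\<lambda>x. size (enc (f x)))" "poly_bounded T" "computes p T f"
  using assms unfolding polytime_def by blast

lemma polytime_size: "polytime f \<Longrightarrow> poly_bounded (\<lambda>x. size (enc (f x)))"
  unfolding polytime_def by blast

lemma polytime_expr:
  fixes f :: "'a::encodable \<Rightarrow> 'b::encodable"
  assumes "poly_bounded (\<lambda>x. size (enc (f x)))"
    "\<And>x s. s 0 = enc x \<Longrightarrow> eval_expr e s = enc (f x)"
  shows "polytime f"
proof (rule polytimeI[OF assms(1) poly_bounded_const])
  fix x :: 'a and s :: store assume "s 0 = enc x"
  then show "\<exists>s'. exec_within (Assign 0 e) s (size e + 1) s' \<and> s' 0 = enc (f x)"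
    using exec_within_Assign assms(2) by (metis fun_upd_same)
qed

lemma polytime_recode:
  assumes "\<And>x. enc (f x) = enc x"
  shows "polytime f"
  by (rule polytime_expr[where e = "EVar 0"]) (simp_all add: assms poly_bounded_size)

lemma polytime_id: "polytime (\<lambda>x. x)"
  by (rule polytime_recode) simp

lemma ex_const_expr: "\<exists>e. \<forall>s. eval_expr e s = t"
proof (induction t)
  case Leaf
  show ?case by (rule exI[of _ ELeaf]) simp
next
  case (Node l r)
  then obtain a b where "\<forall>s. eval_expr a s = l" "\<forall>s. eval_expr b s = r" by blast
  then show ?case by (intro exI[of _ "ENode a b"]) simp
qed

lemma polytime_const: "polytime (\<lambda>x. c)"
  using ex_const_expr[of "enc c"] by (auto intro: polytime_expr poly_bounded_const)

lemma polytime_comp: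
  assumes "polytime g" "polytime f"
  shows "polytime (\<lambda>x. g (f x))"
proof -
  from assms(1) obtain p T where *: "poly_bounded (\<lambda>x. size (enc (g x)))" "poly_bounded T" "computes p T g"
    by (rule polytimeE)
  note p = *(1,2) computesD[OF *(3)]
  from assms(2) obtain p' T' where *: "poly_bounded (\<lambda>x. size (enc (f x)))" "poly_bounded T'" "computes p' T' f"
    by (rule polytimeE)
  note p' = *(1,2) computesD[OF *(3)]
  show ?thesis
  proof (rule polytimeI[where p = "Seq p' p"])
    show "poly_bounded (\<lambda>x. size (enc (g (f x))))" using poly_bounded_comp[OF p(1) p'(1)] .
    show "poly_bounded (\<lambda>x. T' x + T (f x))"
      using poly_bounded_add[OF p'(2) poly_bounded_comp[OF p(2) p'(1)]] .
    fix x and s :: store assume "s 0 = enc (x::'c)"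
    with p' obtain s1 where "exec_within p' s (T' x) s1" "s1 0 = enc (f x)" by blast
    with p(3) obtain s2 where "exec_within p s1 (T (f x)) s2" "s2 0 = enc (g (f x))" by blast
    then show "\<exists>s'. exec_within (Seq p' p) s (T' x + T (f x)) s' \<and> s' 0 = enc (g (f x))"
      using \<open>exec_within p' s (T' x) s1\<close> exec_within_Seq by blast
  qed
qed

text \<open>
  Programs communicate through variable \<open>0\<close> only. Values needed later are kept in variables
  that the intermediate program does not assign.
\<close>

lemma polytime_Pair:
  assumes "polytime f" "polytime g"
  shows "polytime (\<lambda>x. (f x, g x))"
proof -
  from assms(1) obtain p T where *: "poly_bounded (\<lambda>x. size (enc (f x)))" "poly_bounded T" "computes p T f"
    by (rule polytimeE)
  note p = *(1,2) computesD[OF *(3)]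
  from assms(2) obtain p' T' where *: "poly_bounded (\<lambda>x. size (enc (g x)))" "poly_bounded T'" "computes p' T' g"
    by (rule polytimeE)
  note p' = *(1,2) computesD[OF *(3)]
  obtain z where z: "z \<notin> assigned p" "z \<notin> {0}" using fresh_variable[of "{0}" p] by blast
  obtain z' where z': "z' \<notin> assigned p'" "z' \<notin> {0, z}" using fresh_variable[of "{0, z}" p'] by blast
  let ?prog = "Seq (Seq (Assign z (EVar 0)) p) (Seq (Seq (Assign z' (EVar 0)) (Assign 0 (EVar z)))
    (Seq p' (Assign 0 (ENode (EVar z') (EVar 0)))))"
  let ?c = "size (EVar 0) + 1 + (size (EVar 0) + 1 + (size (EVar z) + 1)) + (size (ENode (EVar z') (EVar 0)) + 1)"
  show ?thesis
  proof (rule polytimeI[where p = ?prog])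
    show "poly_bounded (\<lambda>x. size (enc (f x, g x)))"
      using poly_bounded_add[OF poly_bounded_add[OF p(1) p'(1)] poly_bounded_const[of 1]] by simp
    show "poly_bounded (\<lambda>x. ?c + (T x + T' x))"
      by (intro poly_bounded_add poly_bounded_const p(2) p'(2))
    fix x and s :: store assume s: "s 0 = enc (x::'a)"
    let ?s1 = "s(z := enc x)"
    have 1: "exec_within (Assign z (EVar 0)) s (size (EVar 0) + 1) ?s1"
      using exec_within_Assign[of z "EVar 0" s] s by simp
    have "?s1 0 = enc x" using s z by simp
    with p(3) obtain s2 where 2: "exec_within p ?s1 (T x) s2" "s2 0 = enc (f x)" by blast
    have s2z: "s2 z = enc x" using exec_within_unassigned[OF 2(1) z(1)] by simp
    let ?s3 = "s2(z' := enc (f x))"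
    have 3: "exec_within (Assign z' (EVar 0)) s2 (size (EVar 0) + 1) ?s3"
      using exec_within_Assign[of z' "EVar 0" s2] 2 by simp
    let ?s4 = "?s3(0 := enc x)"
    have 4: "exec_within (Assign 0 (EVar z)) ?s3 (size (EVar z) + 1) ?s4"
      using exec_within_Assign[of 0 "EVar z" ?s3] s2z z' by simp
    have "?s4 0 = enc x" by simp
    with p'(3) obtain s5 where 5: "exec_within p' ?s4 (T' x) s5" "s5 0 = enc (g x)" by blast
    have s5z: "s5 z' = enc (f x)" using exec_within_unassigned[OF 5(1) z'(1)] z' by simp
    have 6: "exec_within (Assign 0 (ENode (EVar z') (EVar 0))) s5 (size (ENode (EVar z') (EVar 0)) + 1)
      (s5(0 := enc (f x, g x)))"
      using exec_within_Assign[of 0 "ENode (EVar z') (EVar 0)" s5] s5z 5 by simp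
    have "exec_within ?prog s (size (EVar 0) + 1 + T x + (size (EVar 0) + 1 + (size (EVar z) + 1) +
       (T' x + (size (ENode (EVar z') (EVar 0)) + 1)))) (s5(0 := enc (f x, g x)))"
      by (intro exec_within_Seq) (rule 1 2 3 4 5 6)+
    then have "exec_within ?prog s (?c + (T x + T' x)) (s5(0 := enc (f x, g x)))"
      by (rule exec_within_mono) simp
    then show "\<exists>s'. exec_within ?prog s (?c + (T x + T' x)) s' \<and> s' 0 = enc (f x, g x)"
      by (intro exI[of _ "s5(0 := enc (f x, g x))"]) simp
  qed
qed

lemma polytime_fst: "polytime (f :: 'a::encodable \<Rightarrow> 'b::encodable \<times> 'c::encodable) \<Longrightarrow> polytime (\<lambda>x. fst (f x))"
proof (rule polytime_comp[where g = fst], rule polytime_expr[where e = "ELeft (EVar 0)"])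
  show "poly_bounded (\<lambda>x. size (enc (fst (x :: 'b \<times> 'c))))"
    by (rule poly_bounded_mono[OF poly_bounded_size]) (auto simp: enc_prod_def)
qed (auto simp: enc_prod_def)

lemma polytime_snd: "polytime (f :: 'a::encodable \<Rightarrow> 'b::encodable \<times> 'c::encodable) \<Longrightarrow> polytime (\<lambda>x. snd (f x))"
proof (rule polytime_comp[where g = snd], rule polytime_expr[where e = "ERight (EVar 0)"])
  show "poly_bounded (\<lambda>x. size (enc (snd (x :: 'b \<times> 'c))))"
    by (rule poly_bounded_mono[OF poly_bounded_size]) (auto simp: enc_prod_def)
qed (auto simp: enc_prod_def)

lemma polytime_comp2:
  assumes "polytime (\<lambda>p. F (fst p) (snd p))" "polytime a" "polytime b"
  shows "polytime (\<lambda>x. F (a x) (b x))"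
  using polytime_comp[OF assms(1) polytime_Pair[OF assms(2,3)]] by simp

lemma polytime_comp3:
  assumes "polytime (\<lambda>p. F (fst p) (fst (snd p)) (snd (snd p)))" "polytime a" "polytime b" "polytime c"
  shows "polytime (\<lambda>x. F (a x) (b x) (c x))"
  using polytime_comp[OF assms(1) polytime_Pair[OF assms(2) polytime_Pair[OF assms(3,4)]]] by simp

text \<open>
  The only test that a program can perform is whether a tree is empty. All case distinctions reduce
  to this one.
\<close>

lemma polytime_branch:
  fixes b :: "'a::encodable \<Rightarrow> 'b::encodable" and f g :: "'a \<Rightarrow> 'c::encodable"
  assumes "polytime b" "polytime f" "polytime g"
  shows "polytime (\<lambda>x. if enc (b x) \<noteq> Leaf then f x else g x)"
proof -
  from assms(2) obtain p T where *: "poly_bounded (\<lambda>x. size (enc (f x)))" "poly_bounded T" "computes p T f"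
    by (rule polytimeE)
  note p = *(1,2) computesD[OF *(3)]
  from assms(3) obtain p' T' where *: "poly_bounded (\<lambda>x. size (enc (g x)))" "poly_bounded T'" "computes p' T' g"
    by (rule polytimeE)
  note p' = *(1,2) computesD[OF *(3)]
  let ?h = "\<lambda>y :: 'b \<times> 'a. if enc (fst y) \<noteq> Leaf then f (snd y) else g (snd y)"
  let ?prog = "Cond (ELeft (EVar 0)) (Seq (Assign 0 (ERight (EVar 0))) p) (Seq (Assign 0 (ERight (EVar 0))) p')"
  have sz: "poly_bounded (\<lambda>y. size (enc (snd y)))"
    using polytime_size[OF polytime_snd[OF polytime_id]] .
  have "polytime ?h"
  proof (rule polytimeI[where p = ?prog])
    show "poly_bounded (\<lambda>y. size (enc (?h y)))"
      by (rule poly_bounded_mono[OF poly_bounded_add[OF poly_bounded_comp[OF p(1) sz] poly_bounded_comp[OF p'(1) sz]]])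
         auto
    show "poly_bounded (\<lambda>y. size (ELeft (EVar 0)) + 1 + ((size (ERight (EVar 0)) + 1) + (T (snd y) + T' (snd y))))"
      by (intro poly_bounded_add poly_bounded_const poly_bounded_comp[OF p(2) sz] poly_bounded_comp[OF p'(2) sz])
    fix y and s :: store assume s: "s 0 = enc (y::'b\<times>'a)"
    let ?s1 = "s(0 := enc (snd y))"
    have 1: "exec_within (Assign 0 (ERight (EVar 0))) s (size (ERight (EVar 0)) + 1) ?s1"
      using exec_within_Assign[of 0 "ERight (EVar 0)" s] s by (simp add: enc_prod_def)
    have b: "eval_expr (ELeft (EVar 0)) s = enc (fst y)" using s by (simp add: enc_prod_def)
    show "\<exists>s'. exec_within ?prog s (size (ELeft (EVar 0)) + 1 + ((size (ERight (EVar 0)) + 1) + (T (snd y) + T' (snd y)))) s'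
       \<and> s' 0 = enc (?h y)"
    proof (cases "enc (fst y) = Leaf")
      case True
      from p'(3)[of ?s1] obtain s2 where 2: "exec_within p' ?s1 (T' (snd y)) s2" "s2 0 = enc (g (snd y))" by auto
      show ?thesis using exec_within_mono[OF exec_within_Seq[OF 1 2(1)], of "(size (ERight (EVar 0)) + 1) + (T (snd y) + T' (snd y))"] 2(2) True b
        by (intro exI[of _ s2] conjI exec_within_Cond) auto
    next
      case False
      from p(3)[of ?s1] obtain s2 where 2: "exec_within p ?s1 (T (snd y)) s2" "s2 0 = enc (f (snd y))" by auto
      show ?thesis using exec_within_mono[OF exec_within_Seq[OF 1 2(1)], of "(size (ERight (EVar 0)) + 1) + (T (snd y) + T' (snd y))"] 2(2) False b
        by (intro exI[of _ s2] conjI exec_within_Cond) auto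
    qed
  qed
  from polytime_comp[OF this polytime_Pair[OF assms(1) polytime_id]] show ?thesis
    unfolding fst_conv snd_conv .
qed

lemma polytime_if:
  assumes "polytime b" "polytime f" "polytime g"
  shows "polytime (\<lambda>x. if b x then f x else g x)"
proof -
  have "enc b \<noteq> Leaf \<longleftrightarrow> b" for b by (cases b) auto
  with polytime_branch[OF assms] show ?thesis by simp
qed

text \<open>
  Destructors such as \<^const>\<open>hd\<close> have an unspecified but fixed value on the constructor that
  they do not match, which a program can contain as a constant.
\<close>

lemma polytime_expr_or_const:
  fixes f :: "'a::encodable \<Rightarrow> 'b::encodable"
  assumes "poly_bounded (\<lambda>x. size (enc (f x)))"
    "\<And>x s. s 0 = enc x \<Longrightarrow> enc x \<noteq> Leaf \<Longrightarrow> eval_expr e s = enc (f x)"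
    "\<And>x. enc x = Leaf \<Longrightarrow> f x = c"
  shows "polytime f"
proof -
  obtain d where d: "\<forall>s. eval_expr d s = enc c" using ex_const_expr by blast
  show ?thesis
  proof (rule polytimeI[OF assms(1) poly_bounded_const])
    fix x :: 'a and s :: store assume s: "s 0 = enc x"
    let ?e = "if enc x = Leaf then d else e"
    have "eval_expr ?e s = enc (f x)" using s assms(2,3) d by simp
    then have "exec_within (Assign 0 ?e) s (size d + size e + 1) (s(0 := enc (f x)))"
      using exec_within_mono[OF exec_within_Assign[of 0 ?e s], of "size d + size e + 1"] by simp
    then show "\<exists>s'. exec_within (Cond (EVar 0) (Assign 0 e) (Assign 0 d)) s
        (size (EVar 0) + 1 + (size d + size e + 1)) s' \<and> s' 0 = enc (f x)"
      using s by (intro exI[of _ "s(0 := enc (f x))"] conjI exec_within_Cond) (auto split: if_splits)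
  qed
qed

section \<open>Loops\<close>

text \<open>
  The loop keeps the triple of environment, remaining list and accumulator in variable \<^term>\<open>z\<close>,
  which the program for the step does not assign.
\<close>

lemma exec_within_loop:
  fixes x :: "'a::encodable" and ys :: "'b::encodable list" and a :: "'c::encodable"
  assumes step: "\<And>y a s. s 0 = enc (x, y, a) \<Longrightarrow> \<exists>s'. exec_within p s (T (x, y, a)) s' \<and> s' 0 = enc (f x y a)"
    and z: "z \<notin> assigned p" "z \<noteq> 0"
    and B: "\<And>ys1 y ys2. ys = ys1 @ y # ys2 \<Longrightarrow> T (x, y, fold (f x) ys1 a) \<le> B"
    and b_def: "b = Seq (Assign 0 (ENode (ELeft (EVar z)) (ENode (ELeft (ELeft (ERight (EVar z)))) (ERight (ERight (EVar z))))))
      (Seq p (Assign z (ENode (ELeft (EVar z)) (ENode (ERight (ELeft (ERight (EVar z)))) (EVar 0)))))"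
    and k_def: "k = size (ENode (ELeft (EVar z)) (ENode (ELeft (ELeft (ERight (EVar z)))) (ERight (ERight (EVar z))))) + 1
      + (size (ENode (ELeft (EVar z)) (ENode (ERight (ELeft (ERight (EVar z)))) (EVar 0))) + 1) + (size (ELeft (ERight (EVar z))) + 1)"
    and s: "s z = enc (x, ys, a)"
  shows "\<exists>s'. exec_within (While (ELeft (ERight (EVar z))) b) s (length ys * (B + k) + k) s' \<and>
    s' z = enc (x, [] :: 'b list, fold (f x) ys a)"
  using B s
proof (induction ys arbitrary: a s)
  case Nil
  have "eval_expr (ELeft (ERight (EVar z))) s = Leaf" using Nil by simp
  from exec_within_mono[OF exec_within_WhileFalse[OF this]] Nil show ?case
    by (intro exI[of _ s]) (simp add: k_def)
next
  case (Cons y ys)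
  let ?e1 = "ENode (ELeft (EVar z)) (ENode (ELeft (ELeft (ERight (EVar z)))) (ERight (ERight (EVar z))))"
  let ?e2 = "ENode (ELeft (EVar z)) (ENode (ERight (ELeft (ERight (EVar z)))) (EVar 0))"
  let ?s1 = "s(0 := enc (x, y, a))"
  have 1: "exec_within (Assign 0 ?e1) s (size ?e1 + 1) ?s1"
    using exec_within_Assign[of 0 ?e1 s] Cons.prems(2) by simp
  obtain s2 where 2: "exec_within p ?s1 (T (x, y, a)) s2" "s2 0 = enc (f x y a)"
    using step[of ?s1 y a] by auto
  have s2z: "s2 z = enc (x, y # ys, a)"
    using exec_within_unassigned[OF 2(1) z(1)] z(2) Cons.prems(2) by simp
  let ?s3 = "s2(z := enc (x, ys, f x y a))"
  have 3: "exec_within (Assign z ?e2) s2 (size ?e2 + 1) ?s3"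
    using exec_within_Assign[of z ?e2 s2] s2z 2(2) by simp
  have body: "exec_within b s (size ?e1 + 1 + (T (x, y, a) + (size ?e2 + 1))) ?s3"
    unfolding b_def by (intro exec_within_Seq) (rule 1 2 3)+
  have IH: "\<exists>s'. exec_within (While (ELeft (ERight (EVar z))) b) ?s3 (length ys * (B + k) + k) s' \<and>
    s' z = enc (x, [] :: 'b list, fold (f x) ys (f x y a))"
  proof (rule Cons.IH)
    show "T (x, y', fold (f x) ys1 (f x y a)) \<le> B" if "ys = ys1 @ y' # ys2" for ys1 y' ys2
      using Cons.prems(1)[of "y # ys1" y' ys2] that by simp
  qed simp
  from IH obtain s' where
    4: "exec_within (While (ELeft (ERight (EVar z))) b) ?s3 (length ys * (B + k) + k) s'"
    and s': "s' z = enc (x, [] :: 'b list, fold (f x) ys (f x y a))" by auto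
  have "eval_expr (ELeft (ERight (EVar z))) s \<noteq> Leaf" using Cons.prems(2) by simp
  from exec_within_WhileTrue[OF this body 4]
  have "exec_within (While (ELeft (ERight (EVar z))) b) s (length (y # ys) * (B + k) + k) s'"
  proof (rule exec_within_mono)
    have "T (x, y, a) \<le> B" using Cons.prems(1)[of "[]" y ys] by simp
    then show "size (ELeft (ERight (EVar z))) + 1 + (size ?e1 + 1 + (T (x, y, a) + (size ?e2 + 1))) +
       (length ys * (B + k) + k) \<le> length (y # ys) * (B + k) + k"
      unfolding k_def by simp
  qed
  then show ?case using s' by auto
qed

text \<open>
  Bounded recursion: without the premise on the size of the intermediate results, iterating
  \<open>\<lambda>a. a @ a\<close> would be allowed, whose results grow exponentially.
\<close>

lemma polytime_fold:
  fixes f :: "'a::encodable \<Rightarrow> 'b::encodable \<Rightarrow> 'c::encodable \<Rightarrow> 'c"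
  assumes step: "polytime (\<lambda>p. f (fst p) (fst (snd p)) (snd (snd p)))"
    and ys: "polytime ys" and a: "polytime a"
    and S: "poly_bounded S"
      "\<And>x ys1 ys2. ys x = ys1 @ ys2 \<Longrightarrow> size (enc (fold (f x) ys1 (a x))) \<le> S x"
  shows "polytime (\<lambda>x. fold (f x) (ys x) (a x))"
proof -
  from step obtain p T where *: "poly_bounded T" "computes p T (\<lambda>w. f (fst w) (fst (snd w)) (snd (snd w)))"
    by (rule polytimeE)
  note p = *(1) computesD[OF *(2)]
  from p(1) obtain q where q: "\<And>w. T w \<le> poly q (size (enc w))" unfolding poly_bounded_def by blast
  from polytime_Pair[OF polytime_id polytime_Pair[OF ys a]] obtain p' T'
    where *: "poly_bounded T'" "computes p' T' (\<lambda>x. (x, ys x, a x))"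
    by (rule polytimeE)
  note p' = *(1) computesD[OF *(2)]
  obtain z where z: "z \<notin> assigned p" "z \<notin> {0}" using fresh_variable[of "{0}" p] by blast
  define b where b: "b = Seq (Assign 0 (ENode (ELeft (EVar z)) (ENode (ELeft (ELeft (ERight (EVar z)))) (ERight (ERight (EVar z))))))
      (Seq p (Assign z (ENode (ELeft (EVar z)) (ENode (ERight (ELeft (ERight (EVar z)))) (EVar 0)))))"
  define k where k: "k = size (ENode (ELeft (EVar z)) (ENode (ELeft (ELeft (ERight (EVar z)))) (ERight (ERight (EVar z))))) + 1
      + (size (ENode (ELeft (EVar z)) (ENode (ERight (ELeft (ERight (EVar z)))) (EVar 0))) + 1) + (size (ELeft (ERight (EVar z))) + 1)"
  \<comment> \<open>the step is always applied to the environment, an element of the list and an intermediate result\<close>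
  define B where "B x = poly q (size (enc x) + size (enc (ys x)) + S x + 2)" for x
  let ?out = "ERight (ERight (EVar z))"
  let ?prog = "Seq p' (Seq (Assign z (EVar 0)) (Seq (While (ELeft (ERight (EVar z))) b) (Assign 0 ?out)))"
  let ?T = "\<lambda>x. T' x + ((size (EVar 0) + 1) + ((size (enc (ys x)) * (B x + k) + k) + (size ?out + 1)))"
  show ?thesis
  proof (rule polytimeI[where p = ?prog])
    show "poly_bounded (\<lambda>x. size (enc (fold (f x) (ys x) (a x))))"
      by (rule poly_bounded_mono[OF S(1)]) (use S(2)[of _ _ "[]"] in simp)
    show "poly_bounded ?T"
      unfolding B_def
      by (intro poly_bounded_add poly_bounded_mult poly_bounded_const p'(1) S(1) poly_bounded_poly
          poly_bounded_size polytime_size[OF ys])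
    fix x and s :: store assume s: "s 0 = enc (x :: 'a)"
    from p'(2)[of s x, OF s] obtain s1 where 1: "exec_within p' s (T' x) s1" "s1 0 = enc (x, ys x, a x)" by blast
    let ?s2 = "s1(z := enc (x, ys x, a x))"
    have 2: "exec_within (Assign z (EVar 0)) s1 (size (EVar 0) + 1) ?s2"
      using exec_within_Assign[of z "EVar 0" s1] 1(2) by simp
    have "\<exists>s'. exec_within (While (ELeft (ERight (EVar z))) b) ?s2 (length (ys x) * (B x + k) + k) s' \<and>
       s' z = enc (x, [] :: 'b list, fold (f x) (ys x) (a x))"
    proof (rule exec_within_loop[OF _ z(1) _ _ b k])
      show "\<exists>s'. exec_within p s (T (x, y, a)) s' \<and> s' 0 = enc (f x y a)" if "s 0 = enc (x, y, a)" for y a s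
        using p(2)[of s "(x, y, a)", OF that] by simp
      show "T (x, y, fold (f x) ys1 (a x)) \<le> B x" if "ys x = ys1 @ y # ys2" for ys1 y ys2
      proof -
        have "size (enc (x, y, fold (f x) ys1 (a x))) \<le> size (enc x) + size (enc (ys x)) + S x + 2"
          using S(2)[OF that] size_enc_elem[of y "ys x"] that by simp
        from poly_nat_mono[OF this] show ?thesis unfolding B_def using q order_trans by blast
      qed
    qed (use z in auto)
    then obtain s3 where 3: "exec_within (While (ELeft (ERight (EVar z))) b) ?s2 (length (ys x) * (B x + k) + k) s3"
      "s3 z = enc (x, [] :: 'b list, fold (f x) (ys x) (a x))" by blast
    have "length (ys x) * (B x + k) + k \<le> size (enc (ys x)) * (B x + k) + k"
      using length_le_size_enc by (intro add_mono mult_mono) auto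
    note 3 = exec_within_mono[OF 3(1) this] 3(2)
    let ?s4 = "s3(0 := enc (fold (f x) (ys x) (a x)))"
    have 4: "exec_within (Assign 0 ?out) s3 (size ?out + 1) ?s4"
      using exec_within_Assign[of 0 ?out s3] 3(2) by simp
    have "exec_within ?prog s (?T x) ?s4"
      by (intro exec_within_Seq) (rule 1 2 3 4)+
    then show "\<exists>s'. exec_within ?prog s (?T x) s' \<and> s' 0 = enc (fold (f x) (ys x) (a x))"
      by (intro exI[of _ ?s4]) simp
  qed
qed

section \<open>A library of polynomial-time functions\<close>

text \<open>
  The closure rules are stated pointwise, for terms in a variable \<^term>\<open>x\<close> that stands for the whole
  environment. A bound variable extends the environment to a pair, so under a binder the
  old environment is reached by \<^const>\<open>fst\<close> and the bound variable by \<^const>\<open>snd\<close>.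
\<close>

named_theorems polytime_intros

abbreviation polytime_binary where
  "polytime_binary f \<equiv> polytime (\<lambda>p. f (fst p) (snd p))"

abbreviation polytime_ternary where
  "polytime_ternary f \<equiv> polytime (\<lambda>p. f (fst p) (fst (snd p)) (snd (snd p)))"

lemmas [polytime_intros] = polytime_id polytime_const polytime_Pair polytime_fst polytime_snd polytime_if

lemma polytime_fold_invariant:
  fixes f :: "'a::encodable \<Rightarrow> 'b::encodable \<Rightarrow> 'c::encodable \<Rightarrow> 'c"
  assumes step: "polytime (\<lambda>p. f (fst p) (fst (snd p)) (snd (snd p)))"
    and ys: "polytime ys" and a: "polytime a"
    and inv: "\<And>x. I x (a x)" "\<And>x y c. y \<in> set (ys x) \<Longrightarrow> I x c \<Longrightarrow> I x (f x y c)"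
    and S: "poly_bounded S" "\<And>x c. I x c \<Longrightarrow> size (enc c) \<le> S x"
  shows "polytime (\<lambda>x. fold (f x) (ys x) (a x))"
proof (rule polytime_fold[OF step ys a S(1)])
  fix x ys1 ys2 assume "ys x = ys1 @ ys2"
  then have "I x (fold (f x) ys1 (a x))"
    by (induction ys1 arbitrary: ys2 rule: rev_induct) (simp_all add: inv)
  then show "size (enc (fold (f x) ys1 (a x))) \<le> S x" by (rule S(2))
qed

lemma poly_bounded_elem:
  fixes g :: "'a::encodable \<times> 'b::encodable \<Rightarrow> nat" and ys :: "'a \<Rightarrow> 'b list"
  assumes "poly_bounded g" "polytime ys"
  obtains B where "poly_bounded B" "\<And>x y. y \<in> set (ys x) \<Longrightarrow> g (x, y) \<le> B x"
proof -
  from assms(1) obtain q where q: "\<And>w. g w \<le> poly q (size (enc w))" unfolding poly_bounded_def by blast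
  let ?B = "\<lambda>x. poly q (size (enc x) + size (enc (ys x)))"
  have "poly_bounded ?B"
    by (intro poly_bounded_poly poly_bounded_add poly_bounded_size polytime_size[OF assms(2)])
  moreover have "g (x, y) \<le> ?B x" if "y \<in> set (ys x)" for x y
    using q[of "(x, y)"] poly_nat_mono[of "size (enc (x, y))" "size (enc x) + size (enc (ys x))" q]
      size_enc_elem[OF that] by simp
  ultimately show thesis using that by blast
qed

lemma polytime_not [polytime_intros]:
  assumes "polytime f"
  shows "polytime (\<lambda>x. \<not> f x)"
proof -
  have "(\<lambda>x. \<not> f x) = (\<lambda>x. if f x then False else True)" by auto
  then show ?thesis using assms by (simp only: polytime_if polytime_const)
qed

lemma polytime_conj [polytime_intros]:
  assumes "polytime f" "polytime g"
  shows "polytime (\<lambda>x. f x \<and> g x)"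
proof -
  have "(\<lambda>x. f x \<and> g x) = (\<lambda>x. if f x then g x else False)" by auto
  then show ?thesis using assms by (simp only: polytime_if polytime_const)
qed

lemma polytime_disj [polytime_intros]:
  assumes "polytime f" "polytime g"
  shows "polytime (\<lambda>x. f x \<or> g x)"
proof -
  have "(\<lambda>x. f x \<or> g x) = (\<lambda>x. if f x then True else g x)" by auto
  then show ?thesis using assms by (simp only: polytime_if polytime_const)
qed

lemma polytime_eq_bool [polytime_intros]:
  assumes "polytime f" "polytime g"
  shows "polytime (\<lambda>x. f x = (g x :: bool))"
proof -
  have "(\<lambda>x. f x = (g x :: bool)) = (\<lambda>x. if f x then g x else \<not> g x)" by auto
  then show ?thesis using assms by (simp add: polytime_if polytime_not)
qed

lemma polytime_null [polytime_intros]: "polytime f \<Longrightarrow> polytime (\<lambda>x. f x = [])"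
proof -
  have "(if enc (f x) \<noteq> Leaf then False else True) = (f x = [])" for x by (cases "f x") auto
  then show "polytime f \<Longrightarrow> polytime (\<lambda>x. f x = [])"
    using polytime_branch[OF _ polytime_const[of False] polytime_const[of True], of f] by (simp cong: if_cong)
qed

lemma polytime_is_none [polytime_intros]: "polytime f \<Longrightarrow> polytime (\<lambda>x. f x = None)"
proof -
  have "(if enc (f x) \<noteq> Leaf then False else True) = (f x = None)" for x by (cases "f x") auto
  then show "polytime f \<Longrightarrow> polytime (\<lambda>x. f x = None)"
    using polytime_branch[OF _ polytime_const[of False] polytime_const[of True], of f] by (simp cong: if_cong)
qed

lemma polytime_is_zero [polytime_intros]: "polytime f \<Longrightarrow> polytime (\<lambda>x. f x = (0::nat))"
proof -
  have "(if enc (f x) \<noteq> Leaf then False else True) = (f x = (0::nat))" for x by (cases "f x") auto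
  then show "polytime f \<Longrightarrow> polytime (\<lambda>x. f x = (0::nat))"
    using polytime_branch[OF _ polytime_const[of False] polytime_const[of True], of f] by (simp cong: if_cong)
qed

lemma polytime_Cons [polytime_intros]: "polytime f \<Longrightarrow> polytime g \<Longrightarrow> polytime (\<lambda>x. f x # g x)"
  by (rule polytime_comp2[where F = Cons]) (auto intro: polytime_recode simp: enc_prod_def)

lemma polytime_hd: 
  fixes f :: "'a::encodable \<Rightarrow> 'b::encodable list"
  shows "polytime f \<Longrightarrow> polytime (\<lambda>x. hd (f x))"
proof (rule polytime_comp[where g = hd], rule polytime_expr_or_const[where e = "ELeft (EVar 0)"])
  show "poly_bounded (\<lambda>xs. size (enc (hd (xs :: 'b list))))"
  proof (rule poly_bounded_mono[OF poly_bounded_add[OF poly_bounded_size poly_bounded_const]])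
    show "size (enc (hd xs)) \<le> size (enc xs) + size (enc (hd [] :: 'b))" for xs :: "'b list"
      by (cases xs) auto
  qed
  show "eval_expr (ELeft (EVar 0)) s = enc (hd xs)" if "s 0 = enc xs" "enc xs \<noteq> Leaf" for xs :: "'b list" and s
    using that by (cases xs) auto
  show "hd xs = hd []" if "enc xs = Leaf" for xs :: "'b list"
    using that by (cases xs) auto
qed

lemma polytime_tl: 
  fixes f :: "'a::encodable \<Rightarrow> 'b::encodable list"
  shows "polytime f \<Longrightarrow> polytime (\<lambda>x. tl (f x))"
proof (rule polytime_comp[where g = tl], rule polytime_expr[where e = "ERight (EVar 0)"])
  show "poly_bounded (\<lambda>xs. size (enc (tl (xs :: 'b list))))"
  proof (rule poly_bounded_mono[OF poly_bounded_size])
    show "size (enc (tl xs)) \<le> size (enc xs)" for xs :: "'b list" by (cases xs) auto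
  qed
  show "eval_expr (ERight (EVar 0)) s = enc (tl xs)" if "s 0 = enc xs" for xs :: "'b list" and s
    using that by (cases xs) auto
qed

lemma polytime_case_list [polytime_intros]:
  assumes "polytime f" "polytime g" "polytime (\<lambda>p. h (fst p) (fst (snd p)) (snd (snd p)))"
  shows "polytime (\<lambda>x. case f x of [] \<Rightarrow> g x | y # ys \<Rightarrow> h x y ys)"
proof -
  have "(\<lambda>x. case f x of [] \<Rightarrow> g x | y # ys \<Rightarrow> h x y ys) = (\<lambda>x. if f x = [] then g x else h x (hd (f x)) (tl (f x)))"
    by (auto split: list.split)
  moreover have "polytime (\<lambda>x. h x (hd (f x)) (tl (f x)))"
    using polytime_comp3[OF assms(3) polytime_id polytime_hd[OF assms(1)] polytime_tl[OF assms(1)]] .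
  ultimately show ?thesis using assms by (simp add: polytime_if polytime_null)
qed

lemma polytime_Some [polytime_intros]: 
  fixes f :: "'a::encodable \<Rightarrow> 'b::encodable"
  shows "polytime f \<Longrightarrow> polytime (\<lambda>x. Some (f x))"
proof (rule polytime_comp[where g = Some], rule polytime_expr[where e = "ENode (EVar 0) ELeaf"])
  show "poly_bounded (\<lambda>x. size (enc (Some (x::'b))))"
    using poly_bounded_add[OF poly_bounded_size poly_bounded_const[of 1]] by simp
qed auto

lemma polytime_the: 
  fixes f :: "'a::encodable \<Rightarrow> 'b::encodable option"
  shows "polytime f \<Longrightarrow> polytime (\<lambda>x. the (f x))"
proof (rule polytime_comp[where g = the], rule polytime_expr_or_const[where e = "ELeft (EVar 0)"])
  show "poly_bounded (\<lambda>x. size (enc (the (x :: 'b option))))"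
  proof (rule poly_bounded_mono[OF poly_bounded_add[OF poly_bounded_size poly_bounded_const]])
    show "size (enc (the x)) \<le> size (enc x) + size (enc (the None :: 'b))" for x :: "'b option"
      by (cases x) auto
  qed
  show "eval_expr (ELeft (EVar 0)) s = enc (the x)" if "s 0 = enc x" "enc x \<noteq> Leaf" for x :: "'b option" and s
    using that by (cases x) auto
  show "the x = the None" if "enc x = Leaf" for x :: "'b option"
    using that by (cases x) auto
qed

lemma polytime_case_option [polytime_intros]:
  assumes "polytime f" "polytime g" "polytime (\<lambda>p. h (fst p) (snd p))"
  shows "polytime (\<lambda>x. case f x of None \<Rightarrow> g x | Some y \<Rightarrow> h x y)"
proof -
  have "(\<lambda>x. case f x of None \<Rightarrow> g x | Some y \<Rightarrow> h x y) = (\<lambda>x. if f x = None then g x else h x (the (f x)))"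
    by (auto split: option.split)
  moreover have "polytime (\<lambda>x. h x (the (f x)))"
    using polytime_comp2[OF assms(3) polytime_id polytime_the[OF assms(1)]] .
  ultimately show ?thesis using assms by (simp add: polytime_if polytime_is_none)
qed

lemma polytime_Suc [polytime_intros]: "polytime f \<Longrightarrow> polytime (\<lambda>x. Suc (f x))"
proof (rule polytime_comp[where g = Suc], rule polytime_expr[where e = "ENode ELeaf (EVar 0)"])
  show "poly_bounded (\<lambda>x. size (enc (Suc x)))"
    using poly_bounded_add[OF poly_bounded_size[where 'a = nat] poly_bounded_const[of 1]] by simp
qed auto

lemma polytime_pred: "polytime f \<Longrightarrow> polytime (\<lambda>x. f x - Suc 0)"
proof (rule polytime_comp[where g = "\<lambda>n. n - Suc 0"], rule polytime_expr[where e = "ERight (EVar 0)"])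
  show "poly_bounded (\<lambda>n::nat. size (enc (n - Suc 0)))"
    by (rule poly_bounded_mono[OF poly_bounded_size]) simp
  show "eval_expr (ERight (EVar 0)) s = enc (n - Suc 0)" if "s 0 = enc n" for n and s
    using that by (cases n) auto
qed

lemma polytime_rev: "polytime f \<Longrightarrow> polytime (\<lambda>x. rev (f x))"
proof -
  assume f: "polytime f"
  have "polytime (\<lambda>x. fold (\<lambda>y a. y # a) (f x) [])"
  proof (rule polytime_fold[OF _ f polytime_const polytime_size[OF f]])
    fix x ys1 ys2 assume "f x = ys1 @ ys2"
    then show "size (enc (fold (\<lambda>y a. y # a) ys1 [])) \<le> size (enc (f x))"
      by (simp add: fold_Cons_rev size_enc_rev size_enc_append)
  qed (intro polytime_intros)
  then show ?thesis by (simp add: fold_Cons_rev)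
qed

lemma polytime_map [polytime_intros]:
  assumes h: "polytime (\<lambda>p. h (fst p) (snd p))" and ys: "polytime ys"
  shows "polytime (\<lambda>x. map (h x) (ys x))"
proof -
  obtain B where B: "poly_bounded B" "\<And>x y. y \<in> set (ys x) \<Longrightarrow> size (enc (h (fst (x, y)) (snd (x, y)))) \<le> B x"
    using poly_bounded_elem[OF polytime_size[OF h] ys] by blast
  have fold: "fold (\<lambda>y a. h x y # a) zs c = rev (map (h x) zs) @ c" for x zs c
    by (induction zs arbitrary: c) auto
  have "polytime (\<lambda>x. fold (\<lambda>y a. h x y # a) (ys x) [])"
  proof (rule polytime_fold[OF _ ys polytime_const])
    show "polytime (\<lambda>p. h (fst p) (fst (snd p)) # snd (snd p))"
      by (intro polytime_intros polytime_comp2[OF h])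
    show "poly_bounded (\<lambda>x. size (enc (ys x)) * (B x + 1))"
      by (intro poly_bounded_mult poly_bounded_add poly_bounded_const B(1) polytime_size[OF ys])
    fix x ys1 ys2 assume eq: "ys x = ys1 @ ys2"
    have "size (enc (map (h x) ys1)) \<le> length (map (h x) ys1) * Suc (B x)"
      by (rule size_enc_list_le) (use B(2) eq in auto)
    also have "\<dots> \<le> size (enc (ys x)) * Suc (B x)"
      using length_le_size_enc[of "ys x"] eq by (intro mult_right_mono) auto
    finally show "size (enc (fold (\<lambda>y a. h x y # a) ys1 [])) \<le> size (enc (ys x)) * (B x + 1)"
      by (simp add: fold size_enc_rev)
  qed
  from polytime_rev[OF this] show ?thesis by (simp add: fold)
qed

lemma size_enc_filter: "size (enc (filter P xs)) \<le> size (enc xs)"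
  by (induction xs) auto

lemma polytime_filter [polytime_intros]:
  assumes P: "polytime (\<lambda>p. P (fst p) (snd p))" and ys: "polytime ys"
  shows "polytime (\<lambda>x. filter (P x) (ys x))"
proof -
  have fold: "fold (\<lambda>y a. if P x y then y # a else a) zs c = rev (filter (P x) zs) @ c" for x zs c
    by (induction zs arbitrary: c) auto
  have "polytime (\<lambda>x. fold (\<lambda>y a. if P x y then y # a else a) (ys x) [])"
  proof (rule polytime_fold[OF _ ys polytime_const polytime_size[OF ys]])
    show "polytime (\<lambda>p. if P (fst p) (fst (snd p)) then fst (snd p) # snd (snd p) else snd (snd p))"
      by (intro polytime_intros polytime_comp2[OF P])
    fix x ys1 ys2 assume eq: "ys x = ys1 @ ys2"
    show "size (enc (fold (\<lambda>y a. if P x y then y # a else a) ys1 [])) \<le> size (enc (ys x))"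
      using size_enc_filter[of "P x" ys1] by (simp add: fold size_enc_rev eq size_enc_append)
  qed
  from polytime_rev[OF this] show ?thesis by (simp add: fold)
qed

lemma polytime_Bex [polytime_intros]:
  assumes "polytime (\<lambda>p. P (fst p) (snd p))" "polytime ys"
  shows "polytime (\<lambda>x. \<exists>y\<in>set (ys x). P x y)"
proof -
  have "(\<lambda>x. \<exists>y\<in>set (ys x). P x y) = (\<lambda>x. \<not> filter (P x) (ys x) = [])"
    by (auto simp: filter_empty_conv)
  then show ?thesis using assms by (simp only: polytime_intros)
qed

lemma polytime_Ball [polytime_intros]:
  assumes "polytime (\<lambda>p. P (fst p) (snd p))" "polytime ys"
  shows "polytime (\<lambda>x. \<forall>y\<in>set (ys x). P x y)"
proof -
  have "(\<lambda>x. \<forall>y\<in>set (ys x). P x y) = (\<lambda>x. \<not> (\<exists>y\<in>set (ys x). \<not> P x y))" by auto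
  then show ?thesis using assms by (simp only: polytime_intros)
qed

lemma polytime_append [polytime_intros]:
  assumes "polytime f" "polytime g"
  shows "polytime (\<lambda>x. f x @ g x)"
proof -
  have "polytime (\<lambda>x. fold (\<lambda>y a. y # a) (rev (f x)) (g x))"
  proof (rule polytime_fold[OF _ polytime_rev[OF assms(1)] assms(2)])
    show "poly_bounded (\<lambda>x. size (enc (f x)) + size (enc (g x)))"
      by (intro poly_bounded_add polytime_size assms)
    fix x ys1 ys2 assume "rev (f x) = ys1 @ ys2"
    then have "size (enc (f x)) = size (enc ys1) + size (enc ys2)"
      by (metis size_enc_append size_enc_rev)
    then show "size (enc (fold (\<lambda>y a. y # a) ys1 (g x))) \<le> size (enc (f x)) + size (enc (g x))"
      by (simp add: fold_Cons_rev size_enc_rev size_enc_append)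
  qed (intro polytime_intros)
  then show ?thesis by (simp add: fold_Cons_rev)
qed

lemma polytime_concat [polytime_intros]:
  fixes f :: "'a::encodable \<Rightarrow> 'b::encodable list list"
  assumes "polytime f"
  shows "polytime (\<lambda>x. concat (f x))"
proof -
  have fold: "fold (\<lambda>y a. a @ y) zs c = c @ concat zs" for zs and c :: "'b list"
    by (induction zs arbitrary: c) auto
  have size: "size (enc (concat zs)) \<le> size (enc zs)" for zs :: "'b list list"
    by (induction zs) (auto simp: size_enc_append)
  have "polytime (\<lambda>x. fold (\<lambda>y a. a @ y) (f x) [])"
  proof (rule polytime_fold[OF _ assms polytime_const polytime_size[OF assms]])
    fix x ys1 ys2 assume "f x = ys1 @ ys2"
    then show "size (enc (fold (\<lambda>y a. a @ y) ys1 [])) \<le> size (enc (f x))"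
      using size[of ys1] by (simp add: fold size_enc_append)
  qed (intro polytime_intros)
  then show ?thesis by (simp add: fold)
qed

lemma polytime_replicate_unit: "polytime f \<Longrightarrow> polytime (\<lambda>x. replicate (f x) ())"
proof (rule polytime_comp[where g = "\<lambda>n. replicate n ()"], rule polytime_recode)
  show "enc (replicate n ()) = enc n" for n by (induction n) auto
qed

lemma fold_replicate: "fold (\<lambda>_. f) (replicate n ()) a = (f ^^ n) a"
  by (induction n arbitrary: a) (simp_all add: funpow_swap1)

lemma polytime_funpow:
  fixes f :: "'a::encodable \<Rightarrow> 'b::encodable \<Rightarrow> 'b"
  assumes "polytime (\<lambda>p. f (fst p) (snd p))" "polytime n" "polytime a" "poly_bounded S"
    "\<And>x m. m \<le> n x \<Longrightarrow> size (enc ((f x ^^ m) (a x))) \<le> S x"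
  shows "polytime (\<lambda>x. (f x ^^ n x) (a x))"
proof -
  have "polytime (\<lambda>x. fold (\<lambda>_. f x) (replicate (n x) ()) (a x))"
  proof (rule polytime_fold[OF _ polytime_replicate_unit[OF assms(2)] assms(3,4)])
    show "polytime (\<lambda>p. f (fst p) (snd (snd p)))"
      by (intro polytime_intros polytime_comp2[OF assms(1)])
    fix x ys1 ys2 assume "replicate (n x) () = ys1 @ ys2"
    then have "ys1 = replicate (length ys1) ()" "length ys1 \<le> n x"
      by (simp_all add: replicate_eqI, metis length_append length_replicate le_add1)
    then show "size (enc (fold (\<lambda>_. f x) ys1 (a x))) \<le> S x"
      using assms(5) by (metis fold_replicate)
  qed
  then show ?thesis by (simp add: fold_replicate)
qed

lemma polytime_diff:
  assumes "polytime f" "polytime g"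
  shows "polytime (\<lambda>x. f x - (g x :: nat))"
proof -
  have iter: "((\<lambda>n. n - Suc 0) ^^ m) n = n - m" for n m :: nat
    by (induction m) auto
  have "polytime (\<lambda>x. ((\<lambda>n. n - Suc 0) ^^ g x) (f x))"
    by (rule polytime_funpow[OF _ assms(2,1) polytime_size[OF assms(1)]])
       (auto simp: iter intro!: polytime_pred polytime_intros)
  then show ?thesis by (simp add: iter)
qed

lemma polytime_le [polytime_intros]:
  assumes "polytime f" "polytime g"
  shows "polytime (\<lambda>x. f x \<le> (g x :: nat))"
proof -
  have "(\<lambda>x. f x \<le> (g x :: nat)) = (\<lambda>x. f x - g x = 0)" by auto
  then show ?thesis using assms by (simp only: polytime_intros polytime_diff)
qed

lemma polytime_less [polytime_intros]:
  assumes "polytime f" "polytime g"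
  shows "polytime (\<lambda>x. f x < (g x :: nat))"
proof -
  have "(\<lambda>x. f x < (g x :: nat)) = (\<lambda>x. Suc (f x) \<le> g x)" by auto
  then show ?thesis using assms by (simp only: polytime_intros)
qed

lemma polytime_eq_nat [polytime_intros]:
  assumes "polytime f" "polytime g"
  shows "polytime (\<lambda>x. f x = (g x :: nat))"
proof -
  have "(\<lambda>x. f x = (g x :: nat)) = (\<lambda>x. f x \<le> g x \<and> g x \<le> f x)" by auto
  then show ?thesis using assms by (simp only: polytime_intros)
qed

lemma polytime_length [polytime_intros]:
  assumes "polytime (f :: 'a::encodable \<Rightarrow> 'b::encodable list)"
  shows "polytime (\<lambda>x. length (f x))"
proof -
  have fold: "fold (\<lambda>_. Suc) zs n = length zs + n" for zs :: "'b list" and n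
    by (induction zs arbitrary: n) auto
  have "polytime (\<lambda>x. fold (\<lambda>_. Suc) (f x) 0)"
  proof (rule polytime_fold[OF _ assms polytime_const polytime_size[OF assms]])
    fix x ys1 ys2 assume "f x = ys1 @ ys2"
    then show "size (enc (fold (\<lambda>_. Suc) ys1 0)) \<le> size (enc (f x))"
      using length_le_size_enc[of ys1] by (simp add: fold size_enc_append)
  qed (intro polytime_intros)
  then show ?thesis by (simp add: fold)
qed

text \<open>
  The list is built from its end. The singleton \<open>[n]\<close> as a starting point makes the next element
  the predecessor of the first one, so the loop needs no counter.
\<close>

lemma polytime_upt [polytime_intros]:
  assumes "polytime f"
  shows "polytime (\<lambda>x. [0..<f x])"
proof -
  let ?step = "\<lambda>is. case is of [] \<Rightarrow> [] | i # _ \<Rightarrow> if i = 0 then is else (i - Suc 0) # is"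
  have iter: "(?step ^^ m) [n] = [n - m..<Suc n]" if "m \<le> n" for m n
    using that
  proof (induction m)
    case (Suc m)
    have "[n - m..<Suc n] = (n - m) # [Suc (n - m)..<Suc n]" by (rule upt_conv_Cons) simp
    moreover have "[n - Suc m..<Suc n] = (n - Suc m) # [Suc (n - Suc m)..<Suc n]" by (rule upt_conv_Cons) simp
    moreover have "Suc (n - Suc m) = n - m" using Suc by simp
    ultimately show ?case using Suc by simp
  qed simp
  have "polytime (\<lambda>x. (?step ^^ f x) [f x])"
  proof (rule polytime_funpow[OF _ assms])
    show "poly_bounded (\<lambda>x. Suc (f x) * Suc (f x))"
      using poly_bounded_mult[of "\<lambda>x. f x + 1" "\<lambda>x. f x + 1"] poly_bounded_add[OF _ poly_bounded_const[of 1], of f]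
        polytime_size[OF assms] by simp
    fix x m assume m: "m \<le> f x"
    have "size (enc [f x - m..<Suc (f x)]) \<le> length [f x - m..<Suc (f x)] * Suc (f x)"
      by (rule size_enc_list_le) auto
    also have "\<dots> \<le> Suc (f x) * Suc (f x)" by (intro mult_right_mono) auto
    finally show "size (enc ((?step ^^ m) [f x])) \<le> Suc (f x) * Suc (f x)" by (simp only: iter[OF m])
  qed (intro polytime_intros polytime_pred assms)+
  then have "polytime (\<lambda>x. [0..<Suc (f x)])" by (simp only: iter[OF order_refl] diff_self_eq_0)
  then have "polytime (\<lambda>x. filter (\<lambda>i. i < f x) [0..<Suc (f x)])"
    by (intro polytime_intros polytime_comp[OF assms])
  moreover have "filter (\<lambda>i. i < n) [0..<Suc n] = [0..<n]" for n :: nat by simp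
  ultimately show ?thesis by (simp only:)
qed

lemma polytime_drop:
  assumes "polytime n" "polytime (xs :: 'a::encodable \<Rightarrow> 'b::encodable list)"
  shows "polytime (\<lambda>x. drop (n x) (xs x))"
proof -
  have iter: "(tl ^^ m) zs = drop m zs" for m and zs :: "'b list"
    by (induction m) (simp_all add: drop_Suc tl_drop)
  have "polytime (\<lambda>x. (tl ^^ n x) (xs x))"
  proof (rule polytime_funpow[OF _ assms polytime_size[OF assms(2)]])
    fix x m
    show "size (enc ((tl ^^ m) (xs x))) \<le> size (enc (xs x))"
      using size_enc_append[of "take m (xs x)" "drop m (xs x)"] by (simp add: iter)
  qed (intro polytime_tl polytime_intros)
  then show ?thesis by (simp add: iter)
qed

lemma polytime_nth_default [polytime_intros]:
  assumes "polytime d" "polytime xs" "polytime n"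
  shows "polytime (\<lambda>x. nth_default (d x) (xs x) (n x))"
proof -
  have "nth_default e zs i = (case drop i zs of [] \<Rightarrow> e | y # _ \<Rightarrow> y)" for e i and zs :: "'b list"
    by (cases "i < length zs") (simp_all add: nth_default_def Cons_nth_drop_Suc[symmetric])
  then show ?thesis using assms by (simp only:) (intro polytime_intros polytime_drop)
qed

section \<open>Placing items in slots\<close>

text \<open>
  An item \<^term>\<open>v\<close> may be given one of two colours \<^term>\<open>k\<close>, and then occupies the slot \<open>slot v k\<close>.
  The value \<open>None\<close> of \<open>slot v k\<close> says that this colour is not available for placing the item.
  A placement \<open>\<sigma>\<close> colours some of the items such that no slot is occupied twice.
\<close>

definition occupies :: "('v \<Rightarrow> bool \<Rightarrow> 'x option) \<Rightarrow> ('v \<Rightarrow> bool option) \<Rightarrow> 'v \<Rightarrow> 'x \<Rightarrow> bool" where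
  "occupies slot \<sigma> v x \<longleftrightarrow> (\<exists>k. \<sigma> v = Some k \<and> slot v k = Some x)"

definition placement :: "('v \<Rightarrow> bool \<Rightarrow> 'x option) \<Rightarrow> ('v \<Rightarrow> bool option) \<Rightarrow> bool" where
  "placement slot \<sigma> \<longleftrightarrow> (\<forall>v\<in>dom \<sigma>. \<exists>x. occupies slot \<sigma> v x) \<and>
     (\<forall>v w x. occupies slot \<sigma> v x \<longrightarrow> occupies slot \<sigma> w x \<longrightarrow> v = w)"

definition slots_of :: "('v \<Rightarrow> bool \<Rightarrow> 'x option) \<Rightarrow> 'v \<Rightarrow> 'x set" where
  "slots_of slot v = {x. \<exists>k. slot v k = Some x}"

text \<open>
  A tight set is a certificate, in the manner of Hall's theorem, that no item all of whose slots lie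
  in it can be added.
\<close>

definition tight :: "('v \<Rightarrow> bool \<Rightarrow> 'x option) \<Rightarrow> ('v \<Rightarrow> bool option) \<Rightarrow> 'x set \<Rightarrow> bool" where
  "tight slot \<sigma> Z \<longleftrightarrow> finite Z \<and> (\<forall>z\<in>Z. \<exists>v. occupies slot \<sigma> v z \<and> slots_of slot v \<subseteq> Z)"

definition stuck :: "('v \<Rightarrow> bool \<Rightarrow> 'x option) \<Rightarrow> ('v \<Rightarrow> bool option) \<Rightarrow> 'v \<Rightarrow> bool" where
  "stuck slot \<sigma> v \<longleftrightarrow> (\<exists>Z. tight slot \<sigma> Z \<and> slots_of slot v \<subseteq> Z)"

lemma occupies_dom: "occupies slot \<sigma> v x \<Longrightarrow> v \<in> dom \<sigma>"
  unfolding occupies_def by auto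

lemma occupies_slots_of: "occupies slot \<sigma> v x \<Longrightarrow> x \<in> slots_of slot v"
  unfolding occupies_def slots_of_def by auto

lemma occupies_unique: "occupies slot \<sigma> v x \<Longrightarrow> occupies slot \<sigma> v y \<Longrightarrow> x = y"
  unfolding occupies_def by auto

lemma placement_inj: "placement slot \<sigma> \<Longrightarrow> occupies slot \<sigma> v x \<Longrightarrow> occupies slot \<sigma> w x \<Longrightarrow> v = w"
  unfolding placement_def by blast

lemma placement_slot:
  assumes "placement slot \<sigma>"
  obtains h where "\<And>v. v \<in> dom \<sigma> \<Longrightarrow> occupies slot \<sigma> v (h v)" "inj_on h (dom \<sigma>)"
proof -
  obtain h where h: "\<forall>v\<in>dom \<sigma>. occupies slot \<sigma> v (h v)"
    using assms unfolding placement_def by metis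
  moreover have "inj_on h (dom \<sigma>)"
    by (rule inj_onI) (use h placement_inj[OF assms] in metis)
  ultimately show thesis using that by blast
qed

definition confined :: "('v \<Rightarrow> bool \<Rightarrow> 'x option) \<Rightarrow> ('v \<Rightarrow> bool option) \<Rightarrow> 'x set \<Rightarrow> 'v set" where
  "confined slot \<sigma> Z = {v \<in> dom \<sigma>. slots_of slot v \<subseteq> Z}"

lemma confined_card:
  assumes "placement slot \<sigma>" "finite Z"
  shows "finite (confined slot \<sigma> Z)" "card (confined slot \<sigma> Z) \<le> card Z"
proof -
  obtain h where h: "\<And>v. v \<in> dom \<sigma> \<Longrightarrow> occupies slot \<sigma> v (h v)" "inj_on h (dom \<sigma>)"
    using placement_slot[OF assms(1)] by blast
  have inj: "inj_on h (confined slot \<sigma> Z)"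
    using h(2) unfolding confined_def inj_on_def by blast
  have sub: "h ` confined slot \<sigma> Z \<subseteq> Z"
    using h(1) occupies_slots_of unfolding confined_def by fastforce
  show "finite (confined slot \<sigma> Z)" using inj_on_finite[OF inj sub assms(2)] .
  show "card (confined slot \<sigma> Z) \<le> card Z" using card_inj_on_le[OF inj sub assms(2)] .
qed

lemma tight_card:
  assumes "placement slot \<sigma>" "tight slot \<sigma> Z"
  shows "card (confined slot \<sigma> Z) = card Z"
proof -
  have fin: "finite Z" using assms(2) unfolding tight_def by blast
  obtain g where g: "\<forall>z\<in>Z. occupies slot \<sigma> (g z) z \<and> slots_of slot (g z) \<subseteq> Z"
    using assms(2) unfolding tight_def by metis
  have "inj_on g Z" by (rule inj_onI) (use g occupies_unique in metis)
  moreover have "g ` Z \<subseteq> confined slot \<sigma> Z"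
    using g unfolding confined_def by (auto dest: occupies_dom)
  ultimately have "card Z \<le> card (confined slot \<sigma> Z)"
    using confined_card(1)[OF assms(1) fin] by (simp add: card_inj_on_le)
  then show ?thesis using confined_card(2)[OF assms(1) fin] by simp
qed

text \<open>
  The placement of the same items may have changed completely; but the items confined to \<^term>\<open>Z\<close> are
  as many as its elements, so in every placement that includes them they fill \<^term>\<open>Z\<close>.
\<close>

lemma tight_persists:
  assumes \<sigma>: "placement slot \<sigma>" and \<tau>: "placement slot \<tau>" and dom: "dom \<sigma> \<subseteq> dom \<tau>"
    and tight: "tight slot \<sigma> Z"
  shows "tight slot \<tau> Z"
proof -
  have fin: "finite Z" using tight unfolding tight_def by blast
  obtain h where h: "\<And>v. v \<in> dom \<tau> \<Longrightarrow> occupies slot \<tau> v (h v)" "inj_on h (dom \<tau>)"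
    using placement_slot[OF \<tau>] by blast
  have inj: "inj_on h (confined slot \<tau> Z)"
    using h(2) unfolding confined_def inj_on_def by blast
  have sub: "h ` confined slot \<tau> Z \<subseteq> Z"
    using h(1) occupies_slots_of unfolding confined_def by fastforce
  have "confined slot \<sigma> Z \<subseteq> confined slot \<tau> Z" using dom unfolding confined_def by blast
  then have "card Z \<le> card (confined slot \<tau> Z)"
    using tight_card[OF \<sigma> tight] card_mono[OF confined_card(1)[OF \<tau> fin]] by metis
  then have "h ` confined slot \<tau> Z = Z"
    using card_image[OF inj] card_subset_eq[OF fin sub] card_mono[OF fin sub] by simp
  show ?thesis unfolding tight_def
  proof (intro conjI ballI fin)
    fix z assume "z \<in> Z"
    with \<open>h ` confined slot \<tau> Z = Z\<close> obtain v where "v \<in> confined slot \<tau> Z" "z = h v" by blast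
    then show "\<exists>v. occupies slot \<tau> v z \<and> slots_of slot v \<subseteq> Z" using h(1) unfolding confined_def by blast
  qed
qed

lemma stuck_persists:
  "placement slot \<sigma> \<Longrightarrow> placement slot \<tau> \<Longrightarrow> dom \<sigma> \<subseteq> dom \<tau> \<Longrightarrow> stuck slot \<sigma> v \<Longrightarrow> stuck slot \<tau> v"
  unfolding stuck_def using tight_persists by blast

lemma stuck_not_placeable:
  assumes "placement slot \<sigma>" "placement slot \<tau>" "dom \<sigma> \<subseteq> dom \<tau>" "v \<notin> dom \<sigma>" "stuck slot \<sigma> v"
  shows "v \<notin> dom \<tau>"
proof
  assume v: "v \<in> dom \<tau>"
  obtain Z where Z: "tight slot \<sigma> Z" "slots_of slot v \<subseteq> Z" using assms(5) unfolding stuck_def by blast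
  have fin: "finite Z" using Z unfolding tight_def by blast
  have "insert v (confined slot \<sigma> Z) \<subseteq> confined slot \<tau> Z" "v \<notin> confined slot \<sigma> Z"
    using v assms(3,4) Z(2) unfolding confined_def by auto
  then have "card Z < card (confined slot \<tau> Z)"
    using tight_card[OF assms(1) Z(1)] card_mono[OF confined_card(1)[OF assms(2) fin]]
      confined_card(1)[OF assms(1) fin] by (metis card_insert_disjoint Suc_le_eq)
  then show False using confined_card(2)[OF assms(2) fin] by simp
qed

text \<open>
  Let \<^term>\<open>Z\<close> be the union of the certificates. An item of \<open>\<tau>\<close> is either confined to \<^term>\<open>Z\<close>, and there are at most
  \<^term>\<open>card Z\<close> of these, or it belongs to \<open>\<sigma>\<close> and is not confined to \<^term>\<open>Z\<close>; and \<open>\<sigma>\<close> has exactly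
  \<^term>\<open>card Z\<close> items that are.
\<close>

lemma stuck_maximum:
  assumes \<sigma>: "placement slot \<sigma>" and \<tau>: "placement slot \<tau>" and fin: "finite (dom \<sigma>)" "finite (dom \<tau>)"
    and stuck: "\<And>v. v \<in> dom \<tau> - dom \<sigma> \<Longrightarrow> stuck slot \<sigma> v"
  shows "card (dom \<tau>) \<le> card (dom \<sigma>)"
proof -
  obtain Zof where Zof: "\<forall>v\<in>dom \<tau> - dom \<sigma>. tight slot \<sigma> (Zof v) \<and> slots_of slot v \<subseteq> Zof v"
    using stuck unfolding stuck_def by metis
  define Z where "Z = \<Union> (Zof ` (dom \<tau> - dom \<sigma>))"
  have tight: "tight slot \<sigma> Z"
    unfolding tight_def
  proof (intro conjI ballI)
    show "finite Z" using Zof fin unfolding Z_def tight_def by blast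
    fix z assume "z \<in> Z"
    then obtain u where "u \<in> dom \<tau> - dom \<sigma>" "z \<in> Zof u" unfolding Z_def by blast
    moreover from this obtain v where "occupies slot \<sigma> v z" "slots_of slot v \<subseteq> Zof u"
      using Zof unfolding tight_def by blast
    ultimately show "\<exists>v. occupies slot \<sigma> v z \<and> slots_of slot v \<subseteq> Z" unfolding Z_def by blast
  qed
  then have finZ: "finite Z" unfolding tight_def by blast
  have "dom \<tau> \<subseteq> confined slot \<tau> Z \<union> (dom \<sigma> - confined slot \<sigma> Z)"
    using Zof unfolding confined_def Z_def by blast
  then have "card (dom \<tau>) \<le> card (confined slot \<tau> Z \<union> (dom \<sigma> - confined slot \<sigma> Z))"
    using fin confined_card(1)[OF \<tau> finZ] by (intro card_mono) auto
  also have "\<dots> \<le> card (confined slot \<tau> Z) + card (dom \<sigma> - confined slot \<sigma> Z)" by (rule card_Un_le)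
  also have "\<dots> = card (confined slot \<tau> Z) + (card (dom \<sigma>) - card (confined slot \<sigma> Z))"
    using confined_card(1)[OF \<sigma> finZ] by (subst card_Diff_subset) (auto simp: confined_def)
  also have "\<dots> \<le> card (confined slot \<sigma> Z) + (card (dom \<sigma>) - card (confined slot \<sigma> Z))"
    using confined_card(2)[OF \<tau> finZ] tight_card[OF \<sigma> tight] by simp
  also have "\<dots> = card (dom \<sigma>)"
    using card_mono[of "dom \<sigma>" "confined slot \<sigma> Z"] fin(1) by (auto simp: confined_def)
  finally show ?thesis .
qed

section \<open>Insertion by eviction\<close>

text \<open>
  Starting from slot \<^term>\<open>x\<close>, move on to the other slot of its occupant, then to the other slot of the
  occupant found there, and so on. The number is that of the moves needed to reach a free slot.
\<close>

inductive escape :: "('v \<Rightarrow> bool \<Rightarrow> 'x option) \<Rightarrow> ('v \<Rightarrow> bool option) \<Rightarrow> nat \<Rightarrow> 'x \<Rightarrow> bool"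
  for slot \<sigma> where
  free: "(\<And>w. \<not> occupies slot \<sigma> w x) \<Longrightarrow> escape slot \<sigma> 0 x"
| evict: "\<sigma> w = Some k \<Longrightarrow> slot w k = Some x \<Longrightarrow> slot w (\<not> k) = Some y \<Longrightarrow> escape slot \<sigma> m y
    \<Longrightarrow> escape slot \<sigma> (Suc m) x"

lemma escape_unique:
  assumes "placement slot \<sigma>"
  shows "escape slot \<sigma> m x \<Longrightarrow> escape slot \<sigma> n x \<Longrightarrow> n = m"
proof (induction arbitrary: n rule: escape.induct)
  case (free x)
  from free.prems show ?case by cases (use free.hyps in \<open>auto simp: occupies_def\<close>)
next
  case (evict w k x y m)
  from evict.prems show ?case
  proof cases
    case free
    then show ?thesis using evict.hyps by (auto simp: occupies_def)
  next
    case (evict w' k' y' m')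
    have "w' = w"
      by (rule placement_inj[OF assms, of _ x]) (use evict evict.hyps \<open>\<sigma> w = Some k\<close> \<open>slot w k = Some x\<close> in \<open>auto simp: occupies_def\<close>)
    then show ?thesis using evict \<open>\<sigma> w = Some k\<close> \<open>slot w (\<not> k) = Some y\<close> evict.IH by auto
  qed
qed

text \<open>
  Slots at different distances from the free slot are different, and so are their occupants.
\<close>

lemma escape_length:
  assumes "placement slot \<sigma>" "finite (dom \<sigma>)" "escape slot \<sigma> m x"
  shows "m \<le> card (dom \<sigma>)"
proof -
  have "\<exists>W \<subseteq> dom \<sigma>. finite W \<and> card W = m \<and> (\<forall>w\<in>W. \<exists>y j. j \<le> m \<and> occupies slot \<sigma> w y \<and> escape slot \<sigma> j y)"
    using assms(3)
  proof induction
    case (free x)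
    show ?case by (rule exI[of _ "{}"]) auto
  next
    case (evict w k x y m)
    then obtain W where W: "W \<subseteq> dom \<sigma>" "finite W" "card W = m"
      "\<forall>w\<in>W. \<exists>y j. j \<le> m \<and> occupies slot \<sigma> w y \<and> escape slot \<sigma> j y" by blast
    have wx: "occupies slot \<sigma> w x" using evict by (auto simp: occupies_def)
    have x: "escape slot \<sigma> (Suc m) x" using evict escape.evict by metis
    have "w \<notin> W"
    proof
      assume "w \<in> W"
      then obtain y' j where "j \<le> m" "occupies slot \<sigma> w y'" "escape slot \<sigma> j y'" using W(4) by blast
      then show False using escape_unique[OF assms(1) x] occupies_unique[OF wx] by fastforce
    qed
    then have "card (insert w W) = Suc m" using W by simp
    moreover have "insert w W \<subseteq> dom \<sigma>" using W(1) occupies_dom[OF wx] by simp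
    moreover have "\<forall>w'\<in>insert w W. \<exists>y j. j \<le> Suc m \<and> occupies slot \<sigma> w' y \<and> escape slot \<sigma> j y"
      using W(4) wx x by (metis insertE le_Suc_eq)
    ultimately show ?case using W(2) by blast
  qed
  then show ?thesis using card_mono[OF assms(2)] by blast
qed

text \<open>
  Placing \<^term>\<open>v\<close> at \<^term>\<open>x\<close> changes the walk only at \<^term>\<open>x\<close>, and the rest of a
  walk to a free slot does not return to \<^term>\<open>x\<close>, since the distance decreases along it.
\<close>

lemma escape_after_eviction:
  assumes "placement slot \<sigma>" "escape slot \<sigma> (Suc n) x" "occupies slot \<sigma> w x" "v \<notin> dom \<sigma>" "slot v k = Some x"
  shows "escape slot \<sigma> m y \<Longrightarrow> m \<le> n \<Longrightarrow> escape slot ((\<sigma>(w := None))(v \<mapsto> k)) m y"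
proof (induction rule: escape.induct)
  case (free y)
  have "y \<noteq> x" using free.hyps assms(3) by blast
  show ?case
  proof (rule escape.free)
    fix w' show "\<not> occupies slot ((\<sigma>(w := None))(v \<mapsto> k)) w' y"
      using free.hyps[of w'] \<open>y \<noteq> x\<close> assms(5) by (auto simp: occupies_def split: if_splits)
  qed
next
  case (evict w' k' y y' m)
  have "escape slot \<sigma> (Suc m) y" using evict.hyps escape.evict by metis
  then have "y \<noteq> x" using escape_unique[OF assms(1,2)] evict.prems by fastforce
  then have "w' \<noteq> w" using assms(3) evict.hyps by (auto simp: occupies_def)
  moreover have "w' \<noteq> v" using assms(4) evict.hyps by auto
  ultimately have "((\<sigma>(w := None))(v \<mapsto> k)) w' = Some k'" using evict.hyps by simp
  then show ?case
    by (rule escape.evict) (use evict.hyps evict.IH evict.prems in auto)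
qed

text \<open>
  A state consists of a placement and the item in hand, if any, with the colour that it is about to get.
  The item is placed, and the occupant that it evicts is taken in hand with its other colour,
  which is \<open>True\<close> if and only if its colour was \<open>False\<close>.
  If the wanted colour is not available, then the state does not change any more, so that a failed
  insertion is recognised by an item left in hand.
\<close>

fun bump :: "('v \<Rightarrow> bool \<Rightarrow> 'x option) \<Rightarrow> 'v list \<Rightarrow>
    ('v \<Rightarrow> bool option) \<times> ('v \<times> bool) option \<Rightarrow> ('v \<Rightarrow> bool option) \<times> ('v \<times> bool) option" where
  "bump slot items (\<sigma>, None) = (\<sigma>, None)"
| "bump slot items (\<sigma>, Some (v, k)) =
    (case slot v k of
       None \<Rightarrow> (\<sigma>, Some (v, k))
     | Some x \<Rightarrow>
        (case filter (\<lambda>w. occupies slot \<sigma> w x) items of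
           [] \<Rightarrow> (\<sigma>(v \<mapsto> k), None)
         | w # _ \<Rightarrow> ((\<sigma>(w := None))(v \<mapsto> k), Some (w, \<sigma> w = Some False))))"

definition held :: "('v \<times> bool) option \<Rightarrow> 'v set" where
  "held h = (case h of None \<Rightarrow> {} | Some (v, k) \<Rightarrow> {v})"

lemma held_simps [simp]: "held None = {}" "held (Some (v, k)) = {v}"
  by (simp_all add: held_def)

text \<open>
  The invariant of the process: no item gets lost or added.
\<close>

definition consistent :: "('v \<Rightarrow> bool \<Rightarrow> 'x option) \<Rightarrow> 'v set \<Rightarrow> ('v \<Rightarrow> bool option) \<times> ('v \<times> bool) option \<Rightarrow> bool" where
  "consistent slot D st \<longleftrightarrow> placement slot (fst st) \<and> dom (fst st) \<inter> held (snd st) = {} \<and> dom (fst st) \<union> held (snd st) = D"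

lemma placement_replace:
  assumes "placement slot \<sigma>" "slot v k = Some x" "v \<notin> dom \<sigma>" "\<And>w. occupies slot \<sigma> w x \<Longrightarrow> w \<notin> dom \<rho>"
    "\<rho> \<subseteq>\<^sub>m \<sigma>"
  shows "placement slot (\<rho>(v \<mapsto> k))"
proof -
  have v: "\<rho> v = None" using assms(3,5) by (metis domIff map_le_implies_dom_le subsetD)
  have occ: "occupies slot (\<rho>(v \<mapsto> k)) u y \<longleftrightarrow> (if u = v then y = x else occupies slot \<rho> u y)" for u y
    using assms(2) by (auto simp: occupies_def)
  have sub: "occupies slot \<rho> u y \<Longrightarrow> occupies slot \<sigma> u y" for u y
    using assms(5) unfolding occupies_def map_le_def by force
  have "\<exists>y. occupies slot \<rho> u y" if "u \<in> dom \<rho>" for u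
  proof -
    have "\<sigma> u = \<rho> u" using that assms(5) unfolding map_le_def by simp
    moreover have "u \<in> dom \<sigma>" using that assms(5) map_le_implies_dom_le by blast
    ultimately show ?thesis using assms(1) unfolding placement_def occupies_def by metis
  qed
  moreover have "\<not> occupies slot \<rho> u x" for u using sub assms(4) occupies_dom by metis
  ultimately show ?thesis
    unfolding placement_def occ using placement_inj[OF assms(1)] sub by (simp split: if_splits) blast
qed

lemma bump_consistent:
  assumes "consistent slot D st" "D \<subseteq> set items"
  shows "consistent slot D (bump slot items st)"
proof (cases st)
  case (Pair \<sigma> h)
  show ?thesis
  proof (cases h)
    case None
    then show ?thesis using assms Pair by simp
  next
    case (Some vk)
    obtain v k where vk: "vk = (v, k)" by (cases vk)
    have P: "placement slot \<sigma>" and v: "v \<notin> dom \<sigma>" and D: "insert v (dom \<sigma>) = D"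
      using assms(1) Pair Some vk unfolding consistent_def by auto
    show ?thesis
    proof (cases "slot v k")
      case None
      then show ?thesis using assms Pair Some vk by simp
    next
      case s: (Some x)
      show ?thesis
      proof (cases "filter (\<lambda>w. occupies slot \<sigma> w x) items")
        case Nil
        have "\<not> occupies slot \<sigma> w x" for w
          using Nil assms(2) D occupies_dom[of slot \<sigma> w x] by (auto simp: filter_empty_conv)
        then have "placement slot (\<sigma>(v \<mapsto> k))"
          by (intro placement_replace[OF P s v]) auto
        then show ?thesis using Nil s Pair Some vk D by (simp add: consistent_def)
      next
        case (Cons w ws)
        have "w \<in> set (filter (\<lambda>w. occupies slot \<sigma> w x) items)" using Cons by simp
        then have w: "occupies slot \<sigma> w x" by simp
        have "placement slot ((\<sigma>(w := None))(v \<mapsto> k))"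
        proof (rule placement_replace[OF P s v])
          show "w' \<notin> dom (\<sigma>(w := None))" if "occupies slot \<sigma> w' x" for w'
            using placement_inj[OF P w that] by simp
          show "\<sigma>(w := None) \<subseteq>\<^sub>m \<sigma>" by (simp add: map_le_def)
        qed
        moreover have "w \<in> dom \<sigma>" using w by (rule occupies_dom)
        ultimately show ?thesis using Cons s Pair Some vk D v by (auto simp: consistent_def)
      qed
    qed
  qed
qed

lemma bump_iter_consistent:
  "consistent slot D st \<Longrightarrow> D \<subseteq> set items \<Longrightarrow> consistent slot D ((bump slot items ^^ n) st)"
  by (induction n) (auto intro: bump_consistent)

lemma bump_iter_done: "(bump slot items ^^ n) (\<sigma>, None) = (\<sigma>, None)"
  by (induction n) auto

lemma bump_succeeds:
  assumes "escape slot \<sigma> m x" "slot v k = Some x" "consistent slot D (\<sigma>, Some (v, k))" "D \<subseteq> set items" "m < n"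
  shows "snd ((bump slot items ^^ n) (\<sigma>, Some (v, k))) = None"
  using assms
proof (induction m arbitrary: \<sigma> x v k n)
  case 0
  obtain n' where n: "n = Suc n'" using 0 by (cases n) auto
  from 0(1) have "\<not> occupies slot \<sigma> w x" for w by cases auto
  then have "filter (\<lambda>w. occupies slot \<sigma> w x) items = []" by simp
  then have "bump slot items (\<sigma>, Some (v, k)) = (\<sigma>(v \<mapsto> k), None)" using 0(2) by simp
  then show ?case by (simp add: n funpow_Suc_right bump_iter_done del: funpow.simps)
next
  case (Suc m)
  obtain n' where n: "n = Suc n'" "m < n'" using Suc.prems by (cases n) auto
  have P: "placement slot \<sigma>" and v: "v \<notin> dom \<sigma>" and D: "insert v (dom \<sigma>) = D"
    using Suc.prems(3) unfolding consistent_def by auto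
  from Suc.prems(1) obtain w j y where w: "\<sigma> w = Some j" "slot w j = Some x" "slot w (\<not> j) = Some y"
    and esc: "escape slot \<sigma> m y" by cases auto
  have wx: "occupies slot \<sigma> w x" using w by (auto simp: occupies_def)
  have "w \<in> set (filter (\<lambda>w. occupies slot \<sigma> w x) items)"
    using wx occupies_dom[OF wx] D Suc.prems(4) by auto
  then obtain w' ws where filter: "filter (\<lambda>w. occupies slot \<sigma> w x) items = w' # ws"
    by (cases "filter (\<lambda>w. occupies slot \<sigma> w x) items") auto
  then have "w' \<in> set (filter (\<lambda>w. occupies slot \<sigma> w x) items)" by simp
  then have "occupies slot \<sigma> w' x" by simp
  then have "w' = w" using placement_inj[OF P _ wx] by blast
  let ?\<sigma>' = "(\<sigma>(w := None))(v \<mapsto> k)"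
  have step: "bump slot items (\<sigma>, Some (v, k)) = (?\<sigma>', Some (w, \<not> j))"
    using filter \<open>w' = w\<close> Suc.prems(2) w(1) by simp
  have "consistent slot D (?\<sigma>', Some (w, \<not> j))"
    using bump_consistent[OF Suc.prems(3,4)] step by simp
  moreover have "escape slot ?\<sigma>' m y"
    using escape_after_eviction[OF P Suc.prems(1) wx v Suc.prems(2) esc] by simp
  ultimately have "snd ((bump slot items ^^ n') (?\<sigma>', Some (w, \<not> j))) = None"
    using Suc.IH w(3) Suc.prems(4) n(2) by blast
  then show ?case by (simp only: n(1) funpow_Suc_right comp_apply step)
qed

text \<open>
  A walk that reaches a free slot does so within as many steps as there are items (\<open>escape_length\<close>);
  one more step places the last item in hand.
\<close>

definition insert_item :: "('v \<Rightarrow> bool \<Rightarrow> 'x option) \<Rightarrow> 'v list \<Rightarrow> 'v \<Rightarrow> ('v \<Rightarrow> bool option) \<Rightarrow> ('v \<Rightarrow> bool option)" where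
  "insert_item slot items v \<sigma> =
    (let attempt = (\<lambda>k. (bump slot items ^^ Suc (length items)) (\<sigma>, Some (v, k))) in
     if snd (attempt True) = None then fst (attempt True)
     else if snd (attempt False) = None then fst (attempt False)
     else \<sigma>)"

text \<open>
  If both attempts fail, then the slots from which no free slot can be reached form the
  certificate: they are all occupied, and the other slot of an occupant has the same property.
\<close>

lemma insert_item_cases:
  assumes "placement slot \<sigma>" "v \<notin> dom \<sigma>" "insert v (dom \<sigma>) \<subseteq> set items"
  shows "placement slot (insert_item slot items v \<sigma>) \<and>
     (dom (insert_item slot items v \<sigma>) = insert v (dom \<sigma>) \<or> insert_item slot items v \<sigma> = \<sigma> \<and> stuck slot \<sigma> v)"
proof -
  let ?attempt = "\<lambda>k. (bump slot items ^^ Suc (length items)) (\<sigma>, Some (v, k))"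
  have start: "consistent slot (insert v (dom \<sigma>)) (\<sigma>, Some (v, k))" for k
    using assms(1,2) by (simp add: consistent_def)
  have "consistent slot (insert v (dom \<sigma>)) (?attempt k)" for k
    by (rule bump_iter_consistent[OF start assms(3)])
  then have success: "placement slot (fst (?attempt k)) \<and> dom (fst (?attempt k)) = insert v (dom \<sigma>)"
    if "snd (?attempt k) = None" for k
    using that unfolding consistent_def by (metis Un_empty_right held_simps(1))
  have fin: "finite (dom \<sigma>)" using assms(3) by (meson List.finite_set finite_subset subset_insertI)
  have len: "m < Suc (length items)" if "escape slot \<sigma> m x" for m x
  proof -
    have "m \<le> card (dom \<sigma>)" using escape_length[OF assms(1) fin that] .
    also have "\<dots> \<le> card (set items)" using assms(3) by (intro card_mono) auto
    also have "\<dots> \<le> length items" by (rule card_length)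
    finally show ?thesis by simp
  qed
  have "stuck slot \<sigma> v" if fail: "\<And>k. snd (?attempt k) \<noteq> None"
  proof -
    \<comment> \<open>finite because all these slots are occupied by items\<close>
    define Z where "Z = {x. \<forall>m. \<not> escape slot \<sigma> m x}"
    have occ: "\<exists>w. occupies slot \<sigma> w z" if "z \<in> Z" for z
      using that escape.free[of slot \<sigma> z] unfolding Z_def by blast
    obtain h where h: "\<And>v. v \<in> dom \<sigma> \<Longrightarrow> occupies slot \<sigma> v (h v)" using placement_slot[OF assms(1)] by blast
    have "Z \<subseteq> h ` dom \<sigma>"
      using occ h occupies_dom occupies_unique by (metis (no_types, lifting) image_eqI subsetI)
    then have "finite Z" using fin finite_surj by blast
    moreover have "slots_of slot w \<subseteq> Z" if w: "occupies slot \<sigma> w z" and z: "z \<in> Z" for w z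
    proof
      fix y assume "y \<in> slots_of slot w"
      then obtain j where j: "slot w j = Some y" unfolding slots_of_def by blast
      obtain k where k: "\<sigma> w = Some k" "slot w k = Some z" using w unfolding occupies_def by blast
      show "y \<in> Z"
      proof (cases "j = k")
        case True
        then show ?thesis using j k z by simp
      next
        case False
        then have "slot w (\<not> k) = Some y" using j by (cases j; cases k) auto
        then show ?thesis using escape.evict[of \<sigma> w k slot z, OF k] z unfolding Z_def by blast
      qed
    qed
    ultimately have "tight slot \<sigma> Z" unfolding tight_def using occ by blast
    moreover have "slots_of slot v \<subseteq> Z"
      unfolding slots_of_def Z_def using bump_succeeds[OF _ _ start assms(3) len] fail by blast
    ultimately show ?thesis unfolding stuck_def by blast
  qed
  note stuck = this
  consider (True) "snd (?attempt True) = None" | (False) "snd (?attempt True) \<noteq> None" "snd (?attempt False) = None"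
    | (none) "snd (?attempt True) \<noteq> None" "snd (?attempt False) \<noteq> None" by blast
  then show ?thesis
  proof cases
    case True
    then have "insert_item slot items v \<sigma> = fst (?attempt True)"
      unfolding insert_item_def Let_def by (simp only: if_True simp_thms)
    then show ?thesis using success[OF True] by simp
  next
    case False
    then have "insert_item slot items v \<sigma> = fst (?attempt False)"
      unfolding insert_item_def Let_def by (simp only: if_True if_False simp_thms)
    then show ?thesis using success[OF False(2)] by simp
  next
    case none
    then have "insert_item slot items v \<sigma> = \<sigma>"
      unfolding insert_item_def Let_def by (simp only: if_False simp_thms)
    moreover have "snd (?attempt k) \<noteq> None" for k using none by (cases k) (simp_all only: simp_thms)
    ultimately show ?thesis using stuck assms(1) by simp
  qed
qed

lemma fold_insert_item:
  assumes "placement slot \<sigma>" "dom \<sigma> \<inter> set vs = {}" "dom \<sigma> \<union> set vs \<subseteq> set items" "distinct vs"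
  shows "placement slot (fold (insert_item slot items) vs \<sigma>) \<and>
    dom \<sigma> \<subseteq> dom (fold (insert_item slot items) vs \<sigma>) \<and>
    dom (fold (insert_item slot items) vs \<sigma>) \<subseteq> dom \<sigma> \<union> set vs \<and>
    (\<forall>v \<in> set vs - dom (fold (insert_item slot items) vs \<sigma>). stuck slot (fold (insert_item slot items) vs \<sigma>) v)"
  using assms
proof (induction vs arbitrary: \<sigma>)
  case (Cons v vs)
  let ?\<sigma>1 = "insert_item slot items v \<sigma>"
  let ?\<tau> = "fold (insert_item slot items) vs ?\<sigma>1"
  have 1: "placement slot ?\<sigma>1 \<and> (dom ?\<sigma>1 = insert v (dom \<sigma>) \<or> ?\<sigma>1 = \<sigma> \<and> stuck slot \<sigma> v)"
    using Cons.prems by (intro insert_item_cases) auto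
  then have "dom ?\<sigma>1 \<subseteq> insert v (dom \<sigma>)" by (metis order_refl subset_insertI)
  then have "placement slot ?\<sigma>1" "dom ?\<sigma>1 \<inter> set vs = {}" "dom ?\<sigma>1 \<union> set vs \<subseteq> set items" "distinct vs"
    using 1 Cons.prems(2-4) by (simp, fastforce, fastforce, simp)
  note IH = Cons.IH[OF this]
  note IH1 = conjunct1[OF IH] and IH2 = conjunct1[OF conjunct2[OF IH]]
    and IH3 = conjunct1[OF conjunct2[OF conjunct2[OF IH]]] and IH4 = conjunct2[OF conjunct2[OF conjunct2[OF IH]]]
  have sub: "dom \<sigma> \<subseteq> dom ?\<sigma>1" using 1 by (metis order_refl subset_insertI)
  have sup: "dom ?\<sigma>1 \<subseteq> insert v (dom \<sigma>)" using 1 by (metis order_refl subset_insertI)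
  have mono: "dom \<sigma> \<subseteq> dom ?\<tau>" using sub IH2 by (rule order_trans)
  have stuck: "stuck slot ?\<tau> v" if "v \<notin> dom ?\<tau>"
  proof (rule stuck_persists[OF Cons.prems(1) _ mono])
    have "v \<notin> dom ?\<sigma>1" using that IH2 by (meson subsetD)
    then show "stuck slot \<sigma> v" using 1 by (metis insertI1)
  qed (rule IH1)
  have upper: "dom ?\<tau> \<subseteq> dom \<sigma> \<union> set (v # vs)"
  proof -
    have "dom ?\<tau> \<subseteq> dom ?\<sigma>1 \<union> set vs" by (rule IH3)
    also have "\<dots> \<subseteq> insert v (dom \<sigma>) \<union> set vs" using sup by (intro Un_mono order_refl)
    finally show ?thesis by simp
  qed
  have "fold (insert_item slot items) (v # vs) \<sigma> = ?\<tau>" by simp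
  moreover have "\<forall>u \<in> set (v # vs) - dom ?\<tau>. stuck slot ?\<tau> u"
    using stuck IH4 by (metis DiffE DiffI set_ConsD)
  ultimately show ?case using mono upper IH1 by (simp only: simp_thms)
qed simp

text \<open>
  Required items never fail, since a certificate for the failure would contradict \<open>\<tau>\<close>,
  which places all of them. Optional items only come later, and an insertion never
  removes an item. Those that could not be placed are stuck in the final placement,
  so that \<open>stuck_maximum\<close> applies.
\<close>

lemma greedy_placement:
  assumes items: "set req \<union> set opt \<subseteq> set items" "distinct (req @ opt)"
    and \<tau>: "placement slot \<tau>" "set req \<subseteq> dom \<tau>" "dom \<tau> \<subseteq> set req \<union> set opt"
  defines "\<sigma> \<equiv> fold (insert_item slot items) (req @ opt) Map.empty"
  shows "placement slot \<sigma>" "set req \<subseteq> dom \<sigma>" "dom \<sigma> \<subseteq> set req \<union> set opt" "card (dom \<tau>) \<le> card (dom \<sigma>)"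
proof -
  let ?\<rho> = "fold (insert_item slot items) req Map.empty"
  have empty: "placement slot Map.empty" by (simp add: placement_def occupies_def)
  have 1: "placement slot ?\<rho>" "dom ?\<rho> \<subseteq> set req" "\<forall>v \<in> set req - dom ?\<rho>. stuck slot ?\<rho> v"
    using fold_insert_item[OF empty, of req items] items by auto
  have req: "dom ?\<rho> = set req"
    using stuck_not_placeable[OF 1(1) \<tau>(1)] 1(2,3) \<tau>(2) by blast
  have \<sigma>: "\<sigma> = fold (insert_item slot items) opt ?\<rho>" by (simp add: \<sigma>_def)
  have 2: "placement slot \<sigma>" "dom ?\<rho> \<subseteq> dom \<sigma>" "dom \<sigma> \<subseteq> dom ?\<rho> \<union> set opt"
     "\<forall>v \<in> set opt - dom \<sigma>. stuck slot \<sigma> v"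
    using fold_insert_item[OF 1(1), of opt items] items unfolding req \<sigma> by auto
  show "placement slot \<sigma>" by (rule 2)
  show "set req \<subseteq> dom \<sigma>" "dom \<sigma> \<subseteq> set req \<union> set opt" using 2 req by auto
  show "card (dom \<tau>) \<le> card (dom \<sigma>)"
  proof (rule stuck_maximum[OF 2(1) \<tau>(1)])
    show "finite (dom \<sigma>)" "finite (dom \<tau>)"
      using 2(3) \<tau>(3) req finite_subset by (metis List.finite_set finite_Un)+
    show "stuck slot \<sigma> v" if "v \<in> dom \<tau> - dom \<sigma>" for v
      using that 2 \<tau>(3) req by blast
  qed
qed

section \<open>Extending a precolouring\<close>

definition opposite :: "nat \<Rightarrow> (nat \<Rightarrow> nat \<Rightarrow> bool) \<Rightarrow> (nat \<Rightarrow> bool option) \<Rightarrow> nat \<Rightarrow> bool \<Rightarrow> nat list" where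
  "opposite n adj d v k = filter (\<lambda>x. adj v x \<and> d x = Some (\<not> k)) [0..<n]"

text \<open>
  The slot of \<^term>\<open>v\<close> with colour \<^term>\<open>k\<close> is its only precoloured neighbour of the other colour,
  unless that neighbour already has a cut edge to another precoloured vertex.
\<close>

definition cut_slot :: "nat \<Rightarrow> (nat \<Rightarrow> nat \<Rightarrow> bool) \<Rightarrow> (nat \<Rightarrow> bool option) \<Rightarrow> nat \<Rightarrow> bool \<Rightarrow> nat option" where
  "cut_slot n adj d v k =
    (case opposite n adj d v k of
       [] \<Rightarrow> None
     | x # xs \<Rightarrow> if xs = [] \<and> \<not> (\<exists>y\<in>set [0..<n]. adj x y \<and> d y = Some k) then Some x else None)"

text \<open>
  Both colours of such a vertex give it a neighbour of the other colour, so it is the end of a cut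
  edge in every proper extension.
\<close>

definition required :: "nat \<Rightarrow> (nat \<Rightarrow> nat \<Rightarrow> bool) \<Rightarrow> (nat \<Rightarrow> bool option) \<Rightarrow> nat list" where
  "required n adj d =
    filter (\<lambda>v. d v = None \<and> \<not> (opposite n adj d v True = [] \<or> opposite n adj d v False = [])) [0..<n]"

definition optional :: "nat \<Rightarrow> (nat \<Rightarrow> nat \<Rightarrow> bool) \<Rightarrow> (nat \<Rightarrow> bool option) \<Rightarrow> nat list" where
  "optional n adj d =
    filter (\<lambda>v. d v = None \<and> (opposite n adj d v True = [] \<or> opposite n adj d v False = [])) [0..<n]"

text \<open>
  An optional vertex that has not been placed gets a colour without neighbours of the other colour.
\<close>

definition complete :: "nat \<Rightarrow> (nat \<Rightarrow> nat \<Rightarrow> bool) \<Rightarrow> (nat \<Rightarrow> bool option) \<Rightarrow> (nat \<Rightarrow> bool option) \<Rightarrow> nat \<Rightarrow> bool" where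
  "complete n adj d \<sigma> y =
    (case d y of Some b \<Rightarrow> b | None \<Rightarrow> (case \<sigma> y of Some k \<Rightarrow> k | None \<Rightarrow> opposite n adj d y True = []))"

text \<open>
  The 2-colourings whose bichromatic edges form a matching.
\<close>

definition proper :: "('v \<Rightarrow> 'v \<Rightarrow> bool) \<Rightarrow> ('v \<Rightarrow> bool) \<Rightarrow> bool" where
  "proper adj c \<longleftrightarrow> (\<forall>v x y. adj v x \<longrightarrow> adj v y \<longrightarrow> c x \<noteq> c v \<longrightarrow> c y \<noteq> c v \<longrightarrow> x = y)"

definition cut_vertices :: "('v \<Rightarrow> 'v \<Rightarrow> bool) \<Rightarrow> ('v \<Rightarrow> bool) \<Rightarrow> 'v set" where
  "cut_vertices adj c = {v. \<exists>y. adj v y \<and> c y \<noteq> c v}"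

lemma properD: "proper adj c \<Longrightarrow> adj v x \<Longrightarrow> adj v y \<Longrightarrow> c x \<noteq> c v \<Longrightarrow> c y \<noteq> c v \<Longrightarrow> x = y"
  unfolding proper_def by blast

text \<open>
  The precoloured vertices will be the closed neighbourhood of a dominating set, so that the
  remaining vertices are pairwise non-adjacent.
\<close>

locale precolouring =
  fixes n :: nat and adj :: "nat \<Rightarrow> nat \<Rightarrow> bool" and d :: "nat \<Rightarrow> bool option"
  assumes sym: "adj i j \<Longrightarrow> adj j i"
    and less: "adj i j \<Longrightarrow> i < n"
    and independent: "d i = None \<Longrightarrow> d j = None \<Longrightarrow> \<not> adj i j"
begin

definition uncoloured :: "nat set" where
  "uncoloured = {v. v < n \<and> d v = None}"

definition extends :: "(nat \<Rightarrow> bool) \<Rightarrow> bool" where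
  "extends c \<longleftrightarrow> (\<forall>v<n. d v \<noteq> None \<longrightarrow> d v = Some (c v))"

definition precut :: "nat set" where
  "precut = {x. d x \<noteq> None \<and> (\<exists>y. adj x y \<and> d y \<noteq> None \<and> d y \<noteq> d x)}"

lemma less2: "adj i j \<Longrightarrow> j < n"
  using sym less by blast

lemma set_opposite: "set (opposite n adj d v k) = {x. adj v x \<and> d x = Some (\<not> k)}"
  unfolding opposite_def using less2 by auto

lemma distinct_opposite: "distinct (opposite n adj d v k)"
  unfolding opposite_def by simp

lemma cut_slot_eq_Some:
  "cut_slot n adj d v k = Some x \<longleftrightarrow>
    {x. adj v x \<and> d x = Some (\<not> k)} = {x} \<and> \<not> (\<exists>y. adj x y \<and> d y = Some k)"
proof -
  have blocked: "(\<exists>y\<in>set [0..<n]. adj x y \<and> d y = Some k) \<longleftrightarrow> (\<exists>y. adj x y \<and> d y = Some k)" for x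
    using less2 by auto
  show ?thesis
  proof (cases "opposite n adj d v k")
    case Nil
    then show ?thesis using set_opposite[of v k] by (auto simp: cut_slot_def)
  next
    case (Cons u us)
    then have "{x. adj v x \<and> d x = Some (\<not> k)} = {x} \<longleftrightarrow> us = [] \<and> u = x"
      using set_opposite[of v k] distinct_opposite[of v k] by (cases us) auto
    moreover have "cut_slot n adj d v k =
        (if us = [] \<and> \<not> (\<exists>y. adj u y \<and> d y = Some k) then Some u else None)"
      unfolding cut_slot_def blocked Cons by simp
    ultimately show ?thesis by (cases "us = [] \<and> u = x") auto
  qed
qed

lemma items: "set (required n adj d) \<union> set (optional n adj d) = uncoloured"
  unfolding required_def optional_def uncoloured_def by auto

lemma distinct_items: "distinct (required n adj d @ optional n adj d)"
  unfolding required_def optional_def by auto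

text \<open>
  The other end of the only cut edge at an uncoloured vertex is its slot. A slot shared by two
  vertices would have two cut edges. So a proper extension is a placement of the uncoloured
  vertices at which it has cut edges.
\<close>

lemma placement_of_colouring:
  assumes c: "proper adj c" "extends c"
  defines "\<tau> \<equiv> \<lambda>v. if v \<in> uncoloured \<inter> cut_vertices adj c then Some (c v) else None"
  shows "placement (cut_slot n adj d) \<tau>" "set (required n adj d) \<subseteq> dom \<tau>" "dom \<tau> = uncoloured \<inter> cut_vertices adj c"
proof -
  have ext: "d x = Some (c x)" if "adj v x" "v \<in> uncoloured" for v x
  proof -
    have "d x \<noteq> None" using independent that unfolding uncoloured_def by blast
    then show ?thesis using c(2) less2[OF that(1)] unfolding extends_def by blast
  qed
  have slot: "cut_slot n adj d v (c v) = Some x" if "v \<in> uncoloured" "adj v x" "c x \<noteq> c v" for v x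
    unfolding cut_slot_eq_Some
  proof
    show "{x. adj v x \<and> d x = Some (\<not> c v)} = {x}"
    proof (intro equalityI subsetI)
      fix u assume "u \<in> {x. adj v x \<and> d x = Some (\<not> c v)}"
      then have u: "adj v u" "d u = Some (\<not> c v)" by auto
      then have "c u \<noteq> c v" using ext[OF u(1) that(1)] by simp
      then show "u \<in> {x}" using properD[OF c(1) u(1) that(2) _ that(3)] by simp
    next
      fix u assume "u \<in> {x}"
      then show "u \<in> {x. adj v x \<and> d x = Some (\<not> c v)}" using ext[OF that(2,1)] that(2,3) by simp
    qed
    show "\<not> (\<exists>y. adj x y \<and> d y = Some (c v))"
    proof
      assume "\<exists>y. adj x y \<and> d y = Some (c v)"
      then obtain y where y: "adj x y" "d y = Some (c v)" by blast
      then have "c y = c v" using c(2) less2[OF y(1)] unfolding extends_def by auto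
      then have "y = v" using properD[OF c(1) y(1) sym[OF that(2)]] that(3) by auto
      then show False using y(2) that(1) unfolding uncoloured_def by simp
    qed
  qed
  show dom: "dom \<tau> = uncoloured \<inter> cut_vertices adj c" unfolding \<tau>_def by (auto split: if_splits)
  have occ: "\<exists>x. adj v x \<and> c x \<noteq> c v \<and> cut_slot n adj d v (c v) = Some x" if "v \<in> dom \<tau>" for v
    using that slot unfolding dom cut_vertices_def by blast
  have occ2: "adj v x \<and> c x \<noteq> c v" if "occupies (cut_slot n adj d) \<tau> v x" for v x
  proof -
    have "v \<in> dom \<tau>" using that by (rule occupies_dom)
    then obtain y where y: "adj v y \<and> c y \<noteq> c v \<and> cut_slot n adj d v (c v) = Some y" using occ by blast
    then show ?thesis using that unfolding occupies_def \<tau>_def by (auto split: if_splits)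
  qed
  show "placement (cut_slot n adj d) \<tau>"
    unfolding placement_def
  proof (intro conjI ballI allI impI)
    fix v assume v: "v \<in> dom \<tau>"
    then have "\<tau> v = Some (c v)" unfolding dom unfolding \<tau>_def by simp
    then show "\<exists>x. occupies (cut_slot n adj d) \<tau> v x" using occ[OF v] unfolding occupies_def by blast
  next
    fix v w x assume "occupies (cut_slot n adj d) \<tau> v x" "occupies (cut_slot n adj d) \<tau> w x"
    then show "v = w" using occ2[of v x] occ2[of w x] properD[OF c(1), of x v w] sym by metis
  qed
  show "set (required n adj d) \<subseteq> dom \<tau>"
  proof
    fix v assume v: "v \<in> set (required n adj d)"
    then have u: "v \<in> uncoloured" using items by blast
    have "opposite n adj d v (c v) \<noteq> []" using v unfolding required_def by (cases "c v") auto
    then obtain x where "x \<in> set (opposite n adj d v (c v))" 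
      by (cases "opposite n adj d v (c v)") auto
    then have "adj v x" "d x = Some (\<not> c v)" unfolding set_opposite by auto
    then have "v \<in> cut_vertices adj c" using ext[OF _ u] unfolding cut_vertices_def by fastforce
    then show "v \<in> dom \<tau>" using u dom by simp
  qed
qed

lemma finite_cut_vertices: "finite (cut_vertices adj c)"
  by (rule finite_subset[of _ "{..<n}"]) (auto simp: cut_vertices_def less)

text \<open>
  Cut edges between precoloured vertices are the same in all extensions, and every other cut edge
  joins an uncoloured vertex to its slot. So maximising the cut means placing as many uncoloured
  vertices as possible.
\<close>

lemma card_cut_vertices:
  assumes c: "proper adj c" "extends c"
  shows "card (cut_vertices adj c) = card precut + 2 * card (uncoloured \<inter> cut_vertices adj c)"
proof -
  let ?P = "uncoloured \<inter> cut_vertices adj c"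
  \<comment> \<open>the other end of the only cut edge at an uncoloured vertex\<close>
  obtain h where h: "\<forall>v\<in>?P. adj v (h v) \<and> c (h v) \<noteq> c v"
  proof -
    have "\<forall>v\<in>?P. \<exists>x. adj v x \<and> c x \<noteq> c v" unfolding cut_vertices_def by blast
    then show ?thesis using that by (metis (no_types, lifting) bchoice)
  qed
  have ext: "d v = Some (c v)" if "v < n" "v \<notin> uncoloured" for v
    using c(2) that unfolding extends_def uncoloured_def by auto
  have coloured: "h v \<notin> uncoloured" if "v \<in> ?P" for v
    using that h independent unfolding uncoloured_def by blast
  have differ: "c y \<noteq> c x" if "adj x y" "d y \<noteq> None" "d y \<noteq> d x" "d x \<noteq> None" for x y
  proof -
    have "d y = Some (c y)" "d x = Some (c x)"
      using that c(2) less[OF that(1)] less2[OF that(1)] unfolding extends_def by blast+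
    then show ?thesis using that(3) by auto
  qed
  have inj: "inj_on h ?P"
  proof (rule inj_onI)
    fix v w assume vw: "v \<in> ?P" "w \<in> ?P" "h v = h w"
    show "v = w"
      using properD[OF c(1), of "h v" v w] h vw sym by metis
  qed
  have not_precut: "h v \<notin> precut" if v: "v \<in> ?P" for v
  proof
    assume "h v \<in> precut"
    then obtain y where y: "adj (h v) y" "d y \<noteq> None" "d y \<noteq> d (h v)" "d (h v) \<noteq> None" unfolding precut_def by blast
    then have "c y \<noteq> c (h v)" using differ by blast
    then have "y = v" using properD[OF c(1) y(1)] h v sym by metis
    then show False using v y(2) by (simp add: uncoloured_def)
  qed
  have precut_cut: "precut \<subseteq> cut_vertices adj c - uncoloured"
  proof
    fix x assume "x \<in> precut"
    then obtain y where y: "adj x y" "d y \<noteq> None" "d y \<noteq> d x" "d x \<noteq> None" unfolding precut_def by blast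
    then have "c y \<noteq> c x" using differ by blast
    then show "x \<in> cut_vertices adj c - uncoloured"
      using y unfolding cut_vertices_def uncoloured_def by blast
  qed
  have "cut_vertices adj c - uncoloured \<subseteq> precut \<union> h ` ?P"
  proof
    fix x assume x: "x \<in> cut_vertices adj c - uncoloured"
    then obtain y where y: "adj x y" "c y \<noteq> c x" unfolding cut_vertices_def by blast
    have dx: "d x = Some (c x)" using x ext less[OF y(1)] by blast
    show "x \<in> precut \<union> h ` ?P"
    proof (cases "y \<in> uncoloured")
      case True
      then have P: "y \<in> ?P" using sym[OF y(1)] y(2) unfolding cut_vertices_def by auto
      then have "x = h y" using properD[OF c(1) sym[OF y(1)]] h y(2) by metis
      then show ?thesis using P by blast
    next
      case False
      then have "d y = Some (c y)" using ext less2[OF y(1)] by blast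
      then show ?thesis using y dx unfolding precut_def by auto
    qed
  qed
  moreover have "h ` ?P \<subseteq> cut_vertices adj c"
  proof
    fix x assume "x \<in> h ` ?P"
    then obtain v where v: "v \<in> ?P" "x = h v" by blast
    then have "adj x v" "c v \<noteq> c x" using h sym by auto
    then show "x \<in> cut_vertices adj c" unfolding cut_vertices_def by blast
  qed
  ultimately have eq: "cut_vertices adj c = ?P \<union> (precut \<union> h ` ?P)"
    using precut_cut by blast
  have fin: "finite ?P" "finite precut" "finite (h ` ?P)"
    using finite_cut_vertices[of c] precut_cut by (auto intro: finite_subset)
  have disj: "?P \<inter> (precut \<union> h ` ?P) = {}" using precut_cut coloured by blast
  have "card (cut_vertices adj c) = card (?P \<union> (precut \<union> h ` ?P))"
    by (rule arg_cong[of _ _ card]) (rule eq)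
  also have "\<dots> = card ?P + card (precut \<union> h ` ?P)"
    by (rule card_Un_disjoint[OF fin(1) finite_UnI[OF fin(2,3)] disj])
  also have "card (precut \<union> h ` ?P) = card precut + card ?P"
  proof -
    have "precut \<inter> h ` ?P = {}" using not_precut by blast
    from card_Un_disjoint[OF fin(2,3) this] show ?thesis by (simp only: card_image[OF inj])
  qed
  finally show ?thesis by (simp only: mult_2 ac_simps)
qed

text \<open>
  The colouring \<open>c'\<close> witnesses that the precolouring itself does not violate properness.
  All further cut edges join a placed vertex to its slot, and slots are not shared.
\<close>

lemma complete_proper:
  assumes \<sigma>: "placement (cut_slot n adj d) \<sigma>" "set (required n adj d) \<subseteq> dom \<sigma>" "dom \<sigma> \<subseteq> uncoloured"
    and c': "proper adj c'" "extends c'"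
  defines "c \<equiv> complete n adj d \<sigma>"
  shows "proper adj c" "extends c" "dom \<sigma> \<subseteq> uncoloured \<inter> cut_vertices adj c"
proof -
  have coloured: "c x = c' x" "d x = Some (c x)" if "x < n" "x \<notin> uncoloured" for x
    using that c'(2) unfolding c_def complete_def extends_def uncoloured_def by auto
  show ext: "extends c" unfolding extends_def
  proof (intro allI impI)
    fix v assume "v < n" "d v \<noteq> None"
    then show "d v = Some (c v)" by (intro coloured(2)) (auto simp: uncoloured_def)
  qed
  have placed: "cut_slot n adj d v (c v) = Some x" if occ: "occupies (cut_slot n adj d) \<sigma> v x" for v x
  proof -
    obtain k where k: "\<sigma> v = Some k" "cut_slot n adj d v k = Some x" using occ unfolding occupies_def by blast
    moreover have "d v = None" using \<sigma>(3) k unfolding uncoloured_def by blast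
    ultimately show ?thesis unfolding c_def complete_def by simp
  qed
  have nbr: "x < n \<and> x \<notin> uncoloured" if "adj v x" "v \<in> uncoloured" for v x
    using that less2 independent unfolding uncoloured_def by blast
  have occ: "occupies (cut_slot n adj d) \<sigma> v x" if "v \<in> uncoloured" "adj v x" "c x \<noteq> c v" for v x
  proof -
    have x: "d x = Some (\<not> c v)" using coloured(2) nbr[OF that(2,1)] that(3) by auto
    have "v \<in> dom \<sigma>"
    proof (rule ccontr)
      assume v: "v \<notin> dom \<sigma>"
      then have "opposite n adj d v True = [] \<or> opposite n adj d v False = []"
        using \<sigma>(2) that(1) unfolding required_def uncoloured_def by auto
      then have "opposite n adj d v (c v) = []"
        using v that(1) unfolding c_def complete_def uncoloured_def
        by (cases "opposite n adj d v True = []") (auto simp: dom_def)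
      then have "{x. adj v x \<and> d x = Some (\<not> c v)} = {}" unfolding set_opposite[symmetric] by simp
      then show False using x that(2) by blast
    qed
    then obtain s where s: "occupies (cut_slot n adj d) \<sigma> v s" using \<sigma>(1) unfolding placement_def by blast
    have "{x. adj v x \<and> d x = Some (\<not> c v)} = {s}" using placed[OF s] unfolding cut_slot_eq_Some by blast
    then have "x = s" using x that(2) by blast
    then show ?thesis using s by simp
  qed
  \<comment> \<open>a slot in use has no cut edge to another precoloured vertex\<close>
  have free: "c y = c x" if "v \<in> uncoloured" "adj v x" "c x \<noteq> c v" "adj x y" "y \<notin> uncoloured" for v x y
  proof (rule ccontr)
    assume "c y \<noteq> c x"
    then have "c y = c v" using that(3) by blast
    then have "d y = Some (c v)" using coloured(2)[of y] less2[OF that(4)] that(5) by simp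
    then show False
      using placed[OF occ[OF that(1-3)]] that(4) unfolding cut_slot_eq_Some by blast
  qed
  show "proper adj c" unfolding proper_def
  proof (intro allI impI)
    fix v x y assume a: "adj v x" "adj v y" "c x \<noteq> c v" "c y \<noteq> c v"
    show "x = y"
    proof (cases "v \<in> uncoloured")
      case True
      show ?thesis by (rule occupies_unique[OF occ[OF True a(1,3)] occ[OF True a(2,4)]])
    next
      case v: False
      consider "x \<in> uncoloured" "y \<in> uncoloured" | "x \<in> uncoloured" "y \<notin> uncoloured"
        | "x \<notin> uncoloured" "y \<in> uncoloured" | "x \<notin> uncoloured" "y \<notin> uncoloured" by blast
      then show ?thesis
      proof cases
        case 1
        then show ?thesis
          using placement_inj[OF \<sigma>(1) occ[of x v] occ[of y v]] sym a by metis
      next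
        case 2
        then show ?thesis using free[of x v y] sym a by metis
      next
        case 3
        then show ?thesis using free[of y v x] sym a by metis
      next
        case 4
        have "c' x = c x" "c' y = c y" "c' v = c v"
          using coloured(1)[of x] coloured(1)[of y] coloured(1)[of v] 4 v less less2 a by metis+
        then show ?thesis using properD[OF c'(1) a(1,2)] a(3,4) by metis
      qed
    qed
  qed
  show "dom \<sigma> \<subseteq> uncoloured \<inter> cut_vertices adj c"
  proof
    fix v assume v: "v \<in> dom \<sigma>"
    then obtain s where s: "occupies (cut_slot n adj d) \<sigma> v s" using \<sigma>(1) unfolding placement_def by blast
    then have "{x. adj v x \<and> d x = Some (\<not> c v)} = {s}" using placed unfolding cut_slot_eq_Some by blast
    then have "adj v s" "d s = Some (\<not> c v)" by auto
    moreover have "c s \<noteq> c v" using calculation ext less2 unfolding extends_def by fastforce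
    ultimately show "v \<in> uncoloured \<inter> cut_vertices adj c" using v \<sigma>(3) unfolding cut_vertices_def by blast
  qed
qed

lemma complete_optimal:
  assumes c': "proper adj c'" "extends c'"
  defines "c \<equiv> complete n adj d
     (fold (insert_item (cut_slot n adj d) [0..<n]) (required n adj d @ optional n adj d) Map.empty)"
  shows "proper adj c" "extends c" "card (cut_vertices adj c') \<le> card (cut_vertices adj c)"
proof -
  let ?\<sigma> = "fold (insert_item (cut_slot n adj d) [0..<n]) (required n adj d @ optional n adj d) Map.empty"
  note \<tau> = placement_of_colouring[OF c']
  have sub: "set (required n adj d) \<union> set (optional n adj d) \<subseteq> set [0..<n]"
    unfolding items uncoloured_def by auto
  have \<tau>3: "dom (\<lambda>v. if v \<in> uncoloured \<inter> cut_vertices adj c' then Some (c' v) else None) \<subseteq>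
      set (required n adj d) \<union> set (optional n adj d)"
    unfolding items \<tau>(3) by blast
  note greedy = greedy_placement[OF sub distinct_items \<tau>(1,2) \<tau>3]
  note c = complete_proper[OF greedy(1,2) greedy(3)[unfolded items] c', folded c_def]
  show "proper adj c" "extends c" by (rule c)+
  have "card (uncoloured \<inter> cut_vertices adj c') \<le> card (dom ?\<sigma>)" using greedy(4) unfolding \<tau>(3) .
  also have "\<dots> \<le> card (uncoloured \<inter> cut_vertices adj c)"
    using c(3) finite_cut_vertices by (intro card_mono) auto
  finally show "card (cut_vertices adj c') \<le> card (cut_vertices adj c)"
    using card_cut_vertices[OF c'] card_cut_vertices[OF c(1,2)] by simp
qed

end

text \<open>
  Placements as lists of length at most \<^term>\<open>n\<close>, which is the form in which a program can store them. Entries beyond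
  the end of a list count as \<open>None\<close>.
\<close>

definition set_entry :: "nat \<Rightarrow> 'a option list \<Rightarrow> nat \<Rightarrow> 'a option \<Rightarrow> 'a option list" where
  "set_entry n \<sigma> v e = map (\<lambda>j. if j = v then e else nth_default None \<sigma> j) [0..<n]"

definition bump_list :: "(nat \<Rightarrow> bool \<Rightarrow> nat option) \<Rightarrow> nat \<Rightarrow>
    bool option list \<times> (nat \<times> bool) option \<Rightarrow> bool option list \<times> (nat \<times> bool) option" where
  "bump_list slot n st =
    (case snd st of
       None \<Rightarrow> st
     | Some h \<Rightarrow>
       (case slot (fst h) (snd h) of
          None \<Rightarrow> st
        | Some x \<Rightarrow>
          (case filter (\<lambda>w. case nth_default None (fst st) w of None \<Rightarrow> False | Some k \<Rightarrow> slot w k = Some x) [0..<n] of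
             [] \<Rightarrow> (set_entry n (fst st) (fst h) (Some (snd h)), None)
           | w # _ \<Rightarrow> (set_entry n (set_entry n (fst st) w None) (fst h) (Some (snd h)),
                        Some (w, nth_default None (fst st) w = Some False)))))"

definition insert_item_list :: "(nat \<Rightarrow> bool \<Rightarrow> nat option) \<Rightarrow> nat \<Rightarrow> nat \<Rightarrow> bool option list \<Rightarrow> bool option list" where
  "insert_item_list slot n v \<sigma> =
    (let attempt = (\<lambda>k. (bump_list slot n ^^ Suc n) (\<sigma>, Some (v, k))) in
     if snd (attempt True) = None then fst (attempt True)
     else if snd (attempt False) = None then fst (attempt False)
     else \<sigma>)"

lemma nth_default_set_entry:
  assumes "length \<sigma> \<le> n" "v < n"
  shows "nth_default None (set_entry n \<sigma> v e) = (nth_default None \<sigma>)(v := e)"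
proof
  fix j
  show "nth_default None (set_entry n \<sigma> v e) j = ((nth_default None \<sigma>)(v := e)) j"
    using assms by (cases "j < n") (auto simp: set_entry_def nth_default_def)
qed

lemma length_set_entry [simp]: "length (set_entry n \<sigma> v e) = n"
  by (simp add: set_entry_def)

definition in_range :: "nat \<Rightarrow> bool option list \<times> (nat \<times> bool) option \<Rightarrow> bool" where
  "in_range n st \<longleftrightarrow> length (fst st) \<le> n \<and> (\<forall>h. snd st = Some h \<longrightarrow> fst h < n)"

lemma bump_list_in_range: "in_range n st \<Longrightarrow> in_range n (bump_list slot n st)"
proof -
  have *: "w < n" if "filter P [0..<n] = w # ws" for P w ws
    using that by (metis atLeastLessThan_iff filter_is_subset list.set_intros(1) set_upt subsetD)
  show "in_range n st \<Longrightarrow> in_range n (bump_list slot n st)"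
    unfolding bump_list_def in_range_def by (auto split: option.split list.split dest: *)
qed

lemma bump_list_refines:
  assumes "in_range n st"
  shows "map_prod (nth_default None) id (bump_list slot n st) = bump slot [0..<n] (map_prod (nth_default None) id st)"
proof (cases st)
  case (Pair \<sigma> h)
  show ?thesis
  proof (cases h)
    case None
    then show ?thesis using Pair by (simp add: bump_list_def)
  next
    case (Some vk)
    obtain v k where vk: "vk = (v, k)" by (cases vk)
    have r: "length \<sigma> \<le> n" "v < n" using assms Pair Some vk by (auto simp: in_range_def)
    have occ: "(\<lambda>w. case nth_default None \<sigma> w of None \<Rightarrow> False | Some k \<Rightarrow> slot w k = Some x) =
       (\<lambda>w. occupies slot (nth_default None \<sigma>) w x)" for x
      by (auto simp: occupies_def split: option.split)
    show ?thesis
    proof (cases "slot v k")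
      case None
      then show ?thesis using Pair Some vk by (simp add: bump_list_def)
    next
      case s: (Some x)
      show ?thesis
      proof (cases "filter (\<lambda>w. occupies slot (nth_default None \<sigma>) w x) [0..<n]")
        case Nil
        then show ?thesis using Pair Some vk s r by (simp add: bump_list_def occ nth_default_set_entry)
      next
        case (Cons w ws)
        then have "w < n"
          by (metis atLeastLessThan_iff filter_is_subset list.set_intros(1) set_upt subsetD)
        then show ?thesis using Cons Pair Some vk s r by (simp add: bump_list_def occ nth_default_set_entry)
      qed
    qed
  qed
qed

lemma bump_list_iter:
  assumes "in_range n st"
  shows "in_range n ((bump_list slot n ^^ m) st) \<and>
    map_prod (nth_default None) id ((bump_list slot n ^^ m) st) = (bump slot [0..<n] ^^ m) (map_prod (nth_default None) id st)"
proof (induction m)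
  case (Suc m)
  then show ?case
    using bump_list_in_range[of n "(bump_list slot n ^^ m) st" slot]
      bump_list_refines[of n "(bump_list slot n ^^ m) st" slot]
    by (simp only: funpow.simps comp_apply)
qed (use assms in simp)

lemma insert_item_list_refines:
  assumes "length \<sigma> \<le> n" "v < n"
  shows "length (insert_item_list slot n v \<sigma>) \<le> n"
    "nth_default None (insert_item_list slot n v \<sigma>) = insert_item slot [0..<n] v (nth_default None \<sigma>)"
proof -
  have "in_range n (\<sigma>, Some (v, k))" for k using assms by (simp add: in_range_def)
  note iter = bump_list_iter[OF this, where slot = slot and m = "Suc n"]
  show "length (insert_item_list slot n v \<sigma>) \<le> n"
    unfolding insert_item_list_def Let_def using iter assms(1) unfolding in_range_def by presburger
  have eq: "(bump slot [0..<n] ^^ Suc n) (nth_default None \<sigma>, Some (v, k)) =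
      map_prod (nth_default None) id ((bump_list slot n ^^ Suc n) (\<sigma>, Some (v, k)))" for k
    using iter[of k] unfolding map_prod_simp id_apply by metis
  show "nth_default None (insert_item_list slot n v \<sigma>) = insert_item slot [0..<n] v (nth_default None \<sigma>)"
    unfolding insert_item_list_def insert_item_def Let_def length_upt diff_zero eq fst_map_prod snd_map_prod id_apply
    by (simp only: if_distrib[of "nth_default None"])
qed

lemma fold_insert_item_list_refines:
  assumes "length \<sigma> \<le> n" "\<And>v. v \<in> set vs \<Longrightarrow> v < n"
  shows "length (fold (insert_item_list slot n) vs \<sigma>) \<le> n \<and>
    nth_default None (fold (insert_item_list slot n) vs \<sigma>) = fold (insert_item slot [0..<n]) vs (nth_default None \<sigma>)"
  using assms
proof (induction vs arbitrary: \<sigma>)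
  case (Cons v vs)
  have v: "v < n" using Cons.prems by simp
  note 1 = insert_item_list_refines[OF Cons.prems(1) v, of slot]
  from Cons.IH[OF 1(1)] Cons.prems(2) show ?case by (simp add: 1(2))
qed simp

definition extend :: "nat \<Rightarrow> (nat \<Rightarrow> nat \<Rightarrow> bool) \<Rightarrow> (nat \<Rightarrow> bool option) \<Rightarrow> bool option list" where
  "extend n adj d =
    fold (insert_item_list (cut_slot n adj d) n) (required n adj d @ optional n adj d) []"

lemma extend_refines:
  "nth_default None (extend n adj d) =
    fold (insert_item (cut_slot n adj d) [0..<n]) (required n adj d @ optional n adj d) Map.empty"
proof -
  have "nth_default None [] = (Map.empty :: nat \<Rightarrow> bool option)" by (auto simp: nth_default_def)
  then show ?thesis
    unfolding extend_def
    by (subst conjunct2[OF fold_insert_item_list_refines]) (auto simp: required_def optional_def)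
qed

section \<open>The algorithm\<close>

definition adj :: "bool list list \<Rightarrow> nat \<Rightarrow> nat \<Rightarrow> bool" where
  "adj A i j = nth_default False (nth_default [] A i) j"

text \<open>
  A guess is a list of triples \<open>(u, b, w)\<close>: vertex \<open>u\<close> has colour \<open>b\<close>, and \<open>w\<close> is its only
  neighbour of the other colour, or \<open>w = u\<close> if there is none. Such a triple determines the colours
  of \<open>u\<close> and of all its neighbours. Contradictions between triples are settled in favour of the first one;
  they do not occur for the guesses that come from a matching cut. The value is the exclusive or of
  \<open>b\<close> and the condition that \<open>y\<close> is the exceptional neighbour, where \<open>y \<noteq> u\<close> takes care of \<open>w = u\<close>.
\<close>

definition precolour :: "(nat \<Rightarrow> nat \<Rightarrow> bool) \<Rightarrow> (nat \<times> bool \<times> nat) list \<Rightarrow> nat \<Rightarrow> bool option" where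
  "precolour E L y =
    (case filter (\<lambda>t. y = fst t \<or> E (fst t) y) L of
       [] \<Rightarrow> None
     | t # _ \<Rightarrow> Some (\<not> (fst (snd t) = (\<not> y = fst t \<and> y = snd (snd t)))))"

definition candidate :: "nat \<Rightarrow> (nat \<Rightarrow> nat \<Rightarrow> bool) \<Rightarrow> (nat \<times> bool \<times> nat) list \<Rightarrow> bool list" where
  "candidate n E L =
    map (complete n E (precolour E L) (nth_default None (extend n E (precolour E L)))) [0..<n]"

definition triples :: "nat \<Rightarrow> (nat \<times> bool \<times> nat) list" where
  "triples n = concat (map (\<lambda>u. concat (map (\<lambda>b. map (\<lambda>w. (u, b, w)) [0..<n]) [False, True])) [0..<n])"

primrec guesses :: "nat \<Rightarrow> nat \<Rightarrow> (nat \<times> bool \<times> nat) list list" where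
  "guesses 0 n = [[]]"
| "guesses (Suc k) n = concat (map (\<lambda>t. map (\<lambda>L. t # L) (guesses k n)) (triples n))"

text \<open>
  Whether a vertex is precoloured is determined by the first components of the triples. So this is
  a statement about the set of guessed vertices: no edge lies outside its closed neighbourhood.
\<close>

definition dominating :: "nat \<Rightarrow> (nat \<Rightarrow> nat \<Rightarrow> bool) \<Rightarrow> (nat \<times> bool \<times> nat) list \<Rightarrow> bool" where
  "dominating n E L \<longleftrightarrow> (\<forall>i\<in>set [0..<n]. \<forall>j\<in>set [0..<n].
     \<not> (precolour E L i = None \<and> precolour E L j = None \<and> E i j))"

definition cut_colouring :: "nat \<Rightarrow> (nat \<Rightarrow> nat \<Rightarrow> bool) \<Rightarrow> (nat \<Rightarrow> bool) \<Rightarrow> bool" where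
  "cut_colouring n E c \<longleftrightarrow>
    (\<forall>v\<in>set [0..<n]. \<forall>x\<in>set [0..<n]. \<forall>y\<in>set [0..<n].
       \<not> (E v x \<and> E v y \<and> \<not> c x = c v \<and> \<not> c y = c v) \<or> x = y) \<and>
    (\<exists>x\<in>set [0..<n]. \<exists>y\<in>set [0..<n]. \<not> c x = c y)"

text \<open>
  The number of ends of cut edges. If these form a matching, then it is twice their number.
\<close>

definition cut_size :: "nat \<Rightarrow> (nat \<Rightarrow> nat \<Rightarrow> bool) \<Rightarrow> (nat \<Rightarrow> bool) \<Rightarrow> nat" where
  "cut_size n E c = length (filter (\<lambda>v. \<exists>y\<in>set [0..<n]. E v y \<and> \<not> c y = c v) [0..<n])"

definition best :: "nat \<Rightarrow> (nat \<Rightarrow> nat \<Rightarrow> bool) \<Rightarrow> bool list list \<Rightarrow> bool list option" where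
  "best n E cs = fold (\<lambda>c b. case b of None \<Rightarrow> Some c
     | Some c' \<Rightarrow> if cut_size n E (nth_default False c') < cut_size n E (nth_default False c) then Some c else b) cs None"

definition cut_matrix :: "nat \<Rightarrow> (nat \<Rightarrow> nat \<Rightarrow> bool) \<Rightarrow> (nat \<Rightarrow> bool) \<Rightarrow> bool list list" where
  "cut_matrix n E c = map (\<lambda>i. map (\<lambda>j. E i j \<and> \<not> c i = c j) [0..<n]) [0..<n]"

definition has_dominating_guess :: "nat \<Rightarrow> bool list list \<Rightarrow> bool" where
  "has_dominating_guess k A \<longleftrightarrow> (\<exists>L\<in>set (guesses k (length A)). dominating (length A) (adj A) L)"

text \<open>
  All guesses are tried, including those that are not dominating: the candidates that do not
  describe a matching cut are discarded anyway.
\<close>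

definition solve :: "nat \<Rightarrow> bool list list \<Rightarrow> bool list list option" where
  "solve k A =
    (case best (length A) (adj A)
        (filter (\<lambda>c. cut_colouring (length A) (adj A) (nth_default False c))
          (map (candidate (length A) (adj A)) (guesses k (length A)))) of
       None \<Rightarrow> None
     | Some c \<Rightarrow> Some (cut_matrix (length A) (adj A) (nth_default False c)))"

section \<open>Running time of the algorithm\<close>

lemma polytime_eq_Some_bool [polytime_intros]:
  assumes "polytime f" "polytime g"
  shows "polytime (\<lambda>x. f x = Some (g x :: bool))"
proof -
  have "(\<lambda>x. f x = Some (g x :: bool)) = (\<lambda>x. case f x of None \<Rightarrow> False | Some y \<Rightarrow> y = g x)"
    by (auto split: option.split)
  then show ?thesis by (simp only:) (intro polytime_intros assms polytime_comp[OF assms(2)])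
qed

lemma polytime_eq_Some_nat [polytime_intros]:
  assumes "polytime f" "polytime g"
  shows "polytime (\<lambda>x. f x = Some (g x :: nat))"
proof -
  have "(\<lambda>x. f x = Some (g x :: nat)) = (\<lambda>x. case f x of None \<Rightarrow> False | Some y \<Rightarrow> y = g x)"
    by (auto split: option.split)
  then show ?thesis by (simp only:) (intro polytime_intros assms polytime_comp[OF assms(2)])
qed

lemma polytime_adj: "polytime A \<Longrightarrow> polytime i \<Longrightarrow> polytime j \<Longrightarrow> polytime (\<lambda>x. adj (A x) (i x) (j x))"
  unfolding adj_def by (intro polytime_intros)

lemma polytime_opposite:
  assumes "polytime n" "polytime_ternary E" "polytime_binary d" "polytime v" "polytime k"
  shows "polytime (\<lambda>x. opposite (n x) (E x) (d x) (v x) (k x))"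
  unfolding opposite_def
  by (intro polytime_intros polytime_comp3[OF assms(2)] polytime_comp2[OF assms(3)]
      polytime_comp[OF assms(1)] polytime_comp[OF assms(4)] polytime_comp[OF assms(5)] assms)

lemma polytime_cut_slot:
  assumes "polytime n" "polytime_ternary E" "polytime_binary d" "polytime v" "polytime k"
  shows "polytime (\<lambda>x. cut_slot (n x) (E x) (d x) (v x) (k x))"
  unfolding cut_slot_def
  by (intro polytime_intros polytime_opposite polytime_comp3[OF assms(2)] polytime_comp2[OF assms(3)]
      polytime_comp[OF assms(1)] polytime_comp[OF assms(4)] polytime_comp[OF assms(5)] assms)

lemma polytime_required:
  assumes "polytime n" "polytime_ternary E" "polytime_binary d"
  shows "polytime (\<lambda>x. required (n x) (E x) (d x))"
  unfolding required_def
  by (intro polytime_intros polytime_opposite polytime_comp3[OF assms(2)] polytime_comp2[OF assms(3)]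
      polytime_comp[OF assms(1)] assms)

lemma polytime_optional:
  assumes "polytime n" "polytime_ternary E" "polytime_binary d"
  shows "polytime (\<lambda>x. optional (n x) (E x) (d x))"
  unfolding optional_def
  by (intro polytime_intros polytime_opposite polytime_comp3[OF assms(2)] polytime_comp2[OF assms(3)]
      polytime_comp[OF assms(1)] assms)

lemma polytime_complete:
  assumes "polytime n" "polytime_ternary E" "polytime_binary d" "polytime_binary \<sigma>" "polytime y"
  shows "polytime (\<lambda>x. complete (n x) (E x) (d x) (\<sigma> x) (y x))"
  unfolding complete_def
  by (intro polytime_intros polytime_opposite polytime_comp3[OF assms(2)] polytime_comp2[OF assms(3)]
      polytime_comp2[OF assms(4)] polytime_comp[OF assms(1)] polytime_comp[OF assms(5)] assms)

lemma polytime_set_entry: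
  assumes "polytime n" "polytime \<sigma>" "polytime v" "polytime e"
  shows "polytime (\<lambda>x. set_entry (n x) (\<sigma> x) (v x) (e x))"
  unfolding set_entry_def
  by (intro polytime_intros polytime_comp[OF assms(1)] polytime_comp[OF assms(2)]
      polytime_comp[OF assms(3)] polytime_comp[OF assms(4)] assms)

lemma polytime_bump_list:
  assumes "polytime_ternary slot" "polytime n" "polytime st"
  shows "polytime (\<lambda>x. bump_list (slot x) (n x) (st x))"
  unfolding bump_list_def
  by (intro polytime_intros polytime_set_entry polytime_comp3[OF assms(1)]
      polytime_comp[OF assms(2)] polytime_comp[OF assms(3)] assms)

text \<open>
  However long the process runs and whatever the argument, the placement is the initial one or
  has length \<^term>\<open>n\<close>, and the item in hand is the initial one or less than \<^term>\<open>n\<close>. This keeps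
  the size of the state bounded.
\<close>

lemma bump_list_shape:
  "(length (fst (bump_list slot n st)) = n \<or> fst (bump_list slot n st) = fst st) \<and>
   (snd (bump_list slot n st) = None \<or> snd (bump_list slot n st) = snd st \<or> fst (the (snd (bump_list slot n st))) < n)"
proof -
  have *: "w < n" if "filter P [0..<n] = w # ws" for P w ws
    using that by (metis atLeastLessThan_iff filter_is_subset list.set_intros(1) set_upt subsetD)
  show ?thesis unfolding bump_list_def by (auto split: option.split list.split dest: *)
qed

lemma bump_list_iter_shape:
  "(length (fst ((bump_list slot n ^^ m) st)) = n \<or> fst ((bump_list slot n ^^ m) st) = fst st) \<and>
   (snd ((bump_list slot n ^^ m) st) = None \<or> snd ((bump_list slot n ^^ m) st) = snd st
     \<or> fst (the (snd ((bump_list slot n ^^ m) st))) < n)"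
proof (induction m)
  case (Suc m)
  show ?case
    unfolding funpow.simps comp_apply
    using bump_list_shape[where slot = slot and n = n and st = "(bump_list slot n ^^ m) st"] Suc.IH by metis
qed simp

lemma size_enc_bool_option: "size (enc (e :: bool option)) \<le> 2"
proof (cases e)
  case (Some b)
  then show ?thesis by (cases b) auto
qed simp

lemma size_enc_bool: "size (enc (b :: bool)) \<le> 1"
  by (cases b) auto

lemma size_enc_bool_option_list: "size (enc (xs :: bool option list)) \<le> length xs * 3"
  using size_enc_list_le[of xs 2] size_enc_bool_option by simp

lemma bump_list_iter_size:
  "size (enc ((bump_list slot n ^^ m) st)) \<le> size (enc st) + 4 * n + 10"
proof -
  let ?r = "(bump_list slot n ^^ m) st"
  have 1: "size (enc (fst ?r)) \<le> size (enc (fst st)) + 3 * n"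
    using bump_list_iter_shape[where slot = slot and n = n and m = m and st = st] size_enc_bool_option_list[of "fst ?r"] by auto
  have 2: "size (enc (snd ?r)) \<le> size (enc (snd st)) + n + 9"
  proof (cases "snd ?r")
    case (Some h)
    then have "snd st = Some h \<or> fst h < n"
      using bump_list_iter_shape[where slot = slot and n = n and m = m and st = st] by auto
    moreover have "size (enc (snd ?r)) = fst h + size (enc (snd h)) + 2" using Some by (simp add: enc_prod_def)
    ultimately show ?thesis using size_enc_bool[of "snd h"] Some by auto
  qed simp
  show ?thesis using 1 2 by (simp add: enc_prod_def)
qed

lemma polytime_insert_item_list:
  assumes "polytime_ternary slot" "polytime n" "polytime v" "polytime \<sigma>"
  shows "polytime (\<lambda>x. insert_item_list (slot x) (n x) (v x) (\<sigma> x))"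
proof -
  have attempt: "polytime (\<lambda>x. (bump_list (slot x) (n x) ^^ Suc (n x)) (\<sigma> x, Some (v x, k)))" for k
  proof (rule polytime_funpow)
    show "polytime (\<lambda>p. bump_list (slot (fst p)) (n (fst p)) (snd p))"
      by (intro polytime_intros polytime_bump_list polytime_comp3[OF assms(1)] polytime_comp[OF assms(2)])
    show st: "polytime (\<lambda>x. (\<sigma> x, Some (v x, k)))" by (intro polytime_intros assms)
    show "polytime (\<lambda>x. Suc (n x))" by (intro polytime_intros assms)
    show "poly_bounded (\<lambda>x. size (enc (\<sigma> x, Some (v x, k))) + 4 * size (enc (n x)) + 10)"
      by (intro poly_bounded_add poly_bounded_mult poly_bounded_const polytime_size[OF st] polytime_size[OF assms(2)])
    show "size (enc ((bump_list (slot x) (n x) ^^ m) (\<sigma> x, Some (v x, k)))) \<le>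
      size (enc (\<sigma> x, Some (v x, k))) + 4 * size (enc (n x)) + 10" for x m
      using bump_list_iter_size[where slot = "slot x" and n = "n x" and m = m and st = "(\<sigma> x, Some (v x, k))"] by (simp only: size_enc_nat)
  qed
  show ?thesis unfolding insert_item_list_def Let_def by (intro polytime_intros attempt assms)
qed

lemma length_insert_item_list: "length \<sigma> \<le> n \<Longrightarrow> length (insert_item_list slot n v \<sigma>) \<le> n"
  unfolding insert_item_list_def Let_def
  using bump_list_iter_shape[where slot = slot and n = n and m = "Suc n" and st = "(\<sigma>, Some (v, True))"]
    bump_list_iter_shape[where slot = slot and n = n and m = "Suc n" and st = "(\<sigma>, Some (v, False))"]
  by (simp del: funpow.simps) (metis order_refl)

lemma polytime_extend:
  assumes "polytime n" "polytime_ternary E" "polytime_binary d"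
  shows "polytime (\<lambda>x. extend (n x) (E x) (d x))"
  unfolding extend_def
proof (rule polytime_fold_invariant[where I = "\<lambda>x \<sigma>. length \<sigma> \<le> n x" and S = "\<lambda>x. size (enc (n x)) * 3"])
  show "polytime_ternary (\<lambda>x. insert_item_list (cut_slot (n x) (E x) (d x)) (n x))"
    by (intro polytime_intros polytime_insert_item_list polytime_cut_slot polytime_comp3[OF assms(2)]
        polytime_comp2[OF assms(3)] polytime_comp[OF assms(1)])
  show "polytime (\<lambda>x. required (n x) (E x) (d x) @ optional (n x) (E x) (d x))"
    by (intro polytime_intros polytime_required polytime_optional assms)
  show "polytime (\<lambda>x. [])" by (rule polytime_const)
  show "poly_bounded (\<lambda>x. size (enc (n x)) * 3)"
    by (intro poly_bounded_mult poly_bounded_const polytime_size assms)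
  show "size (enc \<sigma>) \<le> size (enc (n x)) * 3" if "length \<sigma> \<le> n x" for x and \<sigma> :: "bool option list"
    using size_enc_bool_option_list[of \<sigma>] that by simp
qed (simp_all add: length_insert_item_list)

lemma polytime_precolour:
  assumes "polytime_ternary E" "polytime L" "polytime y"
  shows "polytime (\<lambda>x. precolour (E x) (L x) (y x))"
  unfolding precolour_def
  by (intro polytime_intros polytime_comp3[OF assms(1)] polytime_comp[OF assms(2)] polytime_comp[OF assms(3)] assms)

lemma polytime_candidate:
  assumes "polytime n" "polytime_ternary E" "polytime L"
  shows "polytime (\<lambda>x. candidate (n x) (E x) (L x))"
proof -
  have d: "polytime_binary (\<lambda>x. precolour (E x) (L x))"
    by (intro polytime_precolour polytime_intros polytime_comp3[OF assms(2)] polytime_comp[OF assms(3)])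
  show ?thesis unfolding candidate_def
    by (intro polytime_intros polytime_complete polytime_extend polytime_comp3[OF assms(2)] polytime_comp2[OF d]
        polytime_comp[OF assms(1)] assms)
qed

lemma polytime_triples:
  assumes "polytime n"
  shows "polytime (\<lambda>x. triples (n x))"
  unfolding triples_def by (intro polytime_intros polytime_comp[OF assms] assms)

lemma polytime_guesses:
  assumes "polytime n"
  shows "polytime (\<lambda>x. guesses k (n x))"
proof (induction k)
  case 0
  show ?case by (simp add: polytime_const)
next
  case (Suc k)
  show ?case unfolding guesses.simps
    by (intro polytime_intros polytime_triples polytime_comp[OF Suc] assms)
qed

lemma polytime_dominating:
  assumes "polytime n" "polytime_ternary E" "polytime L"
  shows "polytime (\<lambda>x. dominating (n x) (E x) (L x))"
  unfolding dominating_def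
  by (intro polytime_intros polytime_precolour polytime_comp3[OF assms(2)] polytime_comp[OF assms(1)]
      polytime_comp[OF assms(3)] assms)

lemma polytime_cut_colouring:
  assumes "polytime n" "polytime_ternary E" "polytime_binary c"
  shows "polytime (\<lambda>x. cut_colouring (n x) (E x) (c x))"
  unfolding cut_colouring_def
  by (intro polytime_intros polytime_comp3[OF assms(2)] polytime_comp[OF assms(1)]
      polytime_comp2[OF assms(3)] assms)

lemma polytime_cut_size:
  assumes "polytime n" "polytime_ternary E" "polytime_binary c"
  shows "polytime (\<lambda>x. cut_size (n x) (E x) (c x))"
  unfolding cut_size_def
  by (intro polytime_intros polytime_comp3[OF assms(2)] polytime_comp[OF assms(1)]
      polytime_comp2[OF assms(3)] assms)

lemma polytime_best:
  assumes "polytime n" "polytime_ternary E" "polytime cs"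
  shows "polytime (\<lambda>x. best (n x) (E x) (cs x))"
  unfolding best_def
proof (rule polytime_fold_invariant[where I = "\<lambda>x b. b = None \<or> the b \<in> set (cs x)" and S = "\<lambda>x. size (enc (cs x)) + 1"])
  show "polytime_ternary (\<lambda>x c b. case b of None \<Rightarrow> Some c
     | Some c' \<Rightarrow> if cut_size (n x) (E x) (nth_default False c') < cut_size (n x) (E x) (nth_default False c) then Some c else b)"
    by (intro polytime_intros polytime_cut_size polytime_comp3[OF assms(2)] polytime_comp[OF assms(1)])
  show "polytime cs" by fact
  show "polytime (\<lambda>x. None)" by (rule polytime_const)
  show "poly_bounded (\<lambda>x. size (enc (cs x)) + 1)"
    by (intro poly_bounded_add poly_bounded_const polytime_size assms)
  show "size (enc b) \<le> size (enc (cs x)) + 1" if "b = None \<or> the b \<in> set (cs x)" for x b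
    using that size_enc_elem[of "the b" "cs x"] by (cases b) auto
qed (auto split: option.split)

lemma polytime_cut_matrix:
  assumes "polytime n" "polytime_ternary E" "polytime_binary c"
  shows "polytime (\<lambda>x. cut_matrix (n x) (E x) (c x))"
  unfolding cut_matrix_def
  by (intro polytime_intros polytime_comp3[OF assms(2)] polytime_comp[OF assms(1)]
      polytime_comp2[OF assms(3)] assms)

lemma polytime_has_dominating_guess: "polytime (has_dominating_guess k)"
  unfolding has_dominating_guess_def[abs_def]
  by (intro polytime_intros polytime_guesses polytime_dominating polytime_adj)

lemma polytime_solve: "polytime (solve k)"
  unfolding solve_def[abs_def]
  by (intro polytime_intros polytime_best polytime_cut_matrix polytime_cut_colouring polytime_candidate polytime_guesses polytime_adj)

section \<open>Matching cuts and colourings\<close>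

definition cut_edges :: "nat ugraph \<Rightarrow> (nat \<Rightarrow> bool) \<Rightarrow> nat set set" where
  "cut_edges G c = {{i, j} | i j. {i, j} \<in> edges G \<and> c i \<noteq> c j}"

abbreviation joined :: "nat ugraph \<Rightarrow> nat \<Rightarrow> nat \<Rightarrow> bool" where
  "joined G i j \<equiv> {i, j} \<in> edges G"

lemma joined_sym: "joined G i j \<Longrightarrow> joined G j i"
  by (simp add: insert_commute)

lemma joined_verts: "simple_graph G \<Longrightarrow> joined G i j \<Longrightarrow> i \<in> verts G \<and> j \<in> verts G"
  unfolding simple_graph_def by blast

lemma joined_irrefl: "simple_graph G \<Longrightarrow> \<not> joined G i i"
  unfolding simple_graph_def by fastforce

lemma pairwise_disjnt_cut_edges: "pairwise disjnt (cut_edges G c) \<longleftrightarrow> proper (joined G) c"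
proof
  assume disj: "pairwise disjnt (cut_edges G c)"
  show "proper (joined G) c" unfolding proper_def
  proof (intro allI impI)
    fix v x y assume a: "joined G v x" "joined G v y" "c x \<noteq> c v" "c y \<noteq> c v"
    then have "{v, x} \<in> cut_edges G c" "{v, y} \<in> cut_edges G c" unfolding cut_edges_def by blast+
    then have "{v, x} = {v, y}" using pairwiseD[OF disj, of "{v, x}" "{v, y}"] by (auto simp: disjnt_def)
    then show "x = y" by (auto simp: doubleton_eq_iff)
  qed
next
  assume c: "proper (joined G) c"
  show "pairwise disjnt (cut_edges G c)"
  proof (rule pairwiseI)
    fix e e' assume e: "e \<in> cut_edges G c" "e' \<in> cut_edges G c" "e \<noteq> e'"
    show "disjnt e e'"
    proof (rule ccontr)
      assume "\<not> disjnt e e'"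
      then obtain v where v: "v \<in> e" "v \<in> e'" unfolding disjnt_def by blast
      have "\<exists>x. e = {v, x} \<and> joined G v x \<and> c x \<noteq> c v" if "e \<in> cut_edges G c" "v \<in> e" for e
        using that unfolding cut_edges_def by (auto simp: insert_commute)
      then obtain x y where "e = {v, x}" "joined G v x" "c x \<noteq> c v" "e' = {v, y}" "joined G v y" "c y \<noteq> c v"
        using e v by metis
      then show False using properD[OF c] e(3) by metis
    qed
  qed
qed

lemma matching_cut_iff:
  assumes "simple_graph G"
  shows "matching_cut G M \<longleftrightarrow>
    (\<exists>c. proper (joined G) c \<and> (\<exists>x\<in>verts G. \<exists>y\<in>verts G. c x \<noteq> c y) \<and> M = cut_edges G c)"
proof
  assume "matching_cut G M"
  then obtain B R where M: "is_matching G M" and BR: "B \<noteq> {}" "R \<noteq> {}" "B \<inter> R = {}" "B \<union> R = verts G"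
    and eq: "M = {{b, r} | b r. b \<in> B \<and> r \<in> R \<and> {b, r} \<in> edges G}"
    unfolding matching_cut_def by blast
  let ?c = "\<lambda>v. v \<in> B"
  have "M = cut_edges G ?c"
  proof (rule set_eqI)
    fix e
    show "e \<in> M \<longleftrightarrow> e \<in> cut_edges G ?c"
    proof
      assume "e \<in> M"
      then obtain b r where "e = {b, r}" "b \<in> B" "r \<in> R" "joined G b r" unfolding eq by blast
      then show "e \<in> cut_edges G ?c" using BR(3) unfolding cut_edges_def by blast
    next
      assume "e \<in> cut_edges G ?c"
      then obtain i j where ij: "e = {i, j}" "joined G i j" "(i \<in> B) \<noteq> (j \<in> B)" unfolding cut_edges_def by blast
      have "i \<in> B \<union> R" "j \<in> B \<union> R" using joined_verts[OF assms ij(2)] BR(4) by auto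
      then consider "i \<in> B" "j \<in> R" | "j \<in> B" "i \<in> R" using ij(3) by blast
      then show "e \<in> M"
      proof cases
        case 1
        then show ?thesis unfolding eq using ij by blast
      next
        case 2
        moreover have "e = {j, i}" "{j, i} \<in> edges G" using ij by (auto simp: insert_commute)
        ultimately show ?thesis unfolding eq by blast
      qed
    qed
  qed
  moreover from this have "proper (joined G) ?c"
    using M pairwise_disjnt_cut_edges unfolding is_matching_def by blast
  moreover obtain b r where "b \<in> B" "r \<in> R" using BR by blast
  then have "\<exists>x\<in>verts G. \<exists>y\<in>verts G. ?c x \<noteq> ?c y" using BR by blast
  ultimately show "\<exists>c. proper (joined G) c \<and> (\<exists>x\<in>verts G. \<exists>y\<in>verts G. c x \<noteq> c y) \<and> M = cut_edges G c" by blast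
next
  assume "\<exists>c. proper (joined G) c \<and> (\<exists>x\<in>verts G. \<exists>y\<in>verts G. c x \<noteq> c y) \<and> M = cut_edges G c"
  then obtain c x y where c: "proper (joined G) c" "M = cut_edges G c" "x \<in> verts G" "y \<in> verts G" "c x \<noteq> c y" by blast
  let ?B = "{v \<in> verts G. c v}" and ?R = "{v \<in> verts G. \<not> c v}"
  have "is_matching G M"
    unfolding is_matching_def c(2) pairwise_disjnt_cut_edges using c(1) by (auto simp: cut_edges_def)
  moreover have "M = {{b, r} | b r. b \<in> ?B \<and> r \<in> ?R \<and> {b, r} \<in> edges G}"
  proof (rule set_eqI)
    fix e
    show "e \<in> M \<longleftrightarrow> e \<in> {{b, r} | b r. b \<in> ?B \<and> r \<in> ?R \<and> {b, r} \<in> edges G}"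
    proof
      assume "e \<in> M"
      then obtain i j where ij: "e = {i, j}" "joined G i j" "c i \<noteq> c j" unfolding c(2) cut_edges_def by blast
      note V = joined_verts[OF assms ij(2)]
      show "e \<in> {{b, r} | b r. b \<in> ?B \<and> r \<in> ?R \<and> {b, r} \<in> edges G}"
      proof (cases "c i")
        case True
        then show ?thesis using ij V by blast
      next
        case False
        moreover have "e = {j, i}" "{j, i} \<in> edges G" using ij by (auto simp: insert_commute)
        ultimately show ?thesis using ij(3) V by blast
      qed
    next
      assume "e \<in> {{b, r} | b r. b \<in> ?B \<and> r \<in> ?R \<and> {b, r} \<in> edges G}"
      then show "e \<in> M" unfolding c(2) cut_edges_def by blast
    qed
  qed
  moreover have "?B \<noteq> {}" "?R \<noteq> {}" using c(3-5) by blast+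
  moreover have "?B \<inter> ?R = {}" "?B \<union> ?R = verts G" by blast+
  ultimately show "matching_cut G M" unfolding matching_cut_def
    by (intro conjI exI[of _ ?B] exI[of _ ?R])
qed

text \<open>
  The cut edges are pairwise disjoint two-element sets.
\<close>

lemma card_cut_edges:
  assumes "simple_graph G" "proper (joined G) c"
  shows "card (cut_vertices (joined G) c) = 2 * card (cut_edges G c)"
proof -
  have "cut_vertices (joined G) c = \<Union> (cut_edges G c)"
  proof (intro equalityI subsetI)
    fix v assume "v \<in> \<Union> (cut_edges G c)"
    then obtain i j where ij: "v \<in> {i, j}" "joined G i j" "c i \<noteq> c j" unfolding cut_edges_def by blast
    then show "v \<in> cut_vertices (joined G) c"
      using joined_sym[OF ij(2)] unfolding cut_vertices_def by auto
  qed (auto simp: cut_vertices_def cut_edges_def)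
  moreover have "card (\<Union> (cut_edges G c)) = sum card (cut_edges G c)"
    using assms pairwise_disjnt_cut_edges[of G c]
    by (intro card_Union_disjoint) (auto simp: cut_edges_def)
  moreover have "sum card (cut_edges G c) = sum (\<lambda>_. 2) (cut_edges G c)"
    using assms(1) by (intro sum.cong) (auto simp: cut_edges_def simple_graph_def)
  ultimately show ?thesis by simp
qed

text \<open>
  A path between two vertices of different colours contains a cut edge. Hence a colouring whose cut is
  at least as large as that of a matching cut also uses both colours.
\<close>

lemma connected_cut_vertex:
  assumes "connected_graph G" "x \<in> verts G" "y \<in> verts G" "c x \<noteq> c y"
  shows "cut_vertices (joined G) c \<noteq> {}"
proof
  assume empty: "cut_vertices (joined G) c = {}"
  have "(x, y) \<in> {(x, y). {x, y} \<in> edges G}\<^sup>*" using assms unfolding connected_graph_def by blast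
  then have "c y = c x"
    by induction (use empty in \<open>auto simp: cut_vertices_def\<close>)
  then show False using assms(4) by simp
qed

section \<open>Instances as adjacency matrices\<close>

definition matrix_of :: "nat ugraph \<Rightarrow> bool list list" where
  "matrix_of G = map (\<lambda>i. map (\<lambda>j. joined G i j) [0..<card (verts G)]) [0..<card (verts G)]"

lemma enc_matrix_encode_edges: "enc (map (\<lambda>i. map (\<lambda>j. {i, j} \<in> E) [0..<n]) [0..<n]) = encode_edges n E"
  unfolding encode_edges_def enc_list_def enc_bool_def by (simp add: comp_def)

lemma enc_matrix_of: "enc (matrix_of G) = encode_graph G"
  unfolding matrix_of_def encode_graph_def enc_matrix_encode_edges ..

lemma length_matrix_of [simp]: "length (matrix_of G) = card (verts G)"
  by (simp add: matrix_of_def)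

lemma instanceD:
  assumes "G \<in> mmc_instances"
  shows "simple_graph G" "connected_graph G" "verts G = {0..<card (verts G)}"
proof -
  show "simple_graph G" "connected_graph G" using assms unfolding mmc_instances_def by blast+
  obtain n where "verts G = {0..<n}" using assms unfolding mmc_instances_def by blast
  then show "verts G = {0..<card (verts G)}" by simp
qed

lemma adj_matrix_of:
  assumes "G \<in> mmc_instances"
  shows "adj (matrix_of G) = joined G"
proof (intro ext)
  fix i j
  show "adj (matrix_of G) i j = joined G i j"
  proof (cases "i < card (verts G) \<and> j < card (verts G)")
    case True
    then show ?thesis by (simp add: adj_def matrix_of_def nth_default_def)
  next
    case False
    then have "\<not> joined G i j"
      using joined_verts[OF instanceD(1)[OF assms]] instanceD(3)[OF assms] by (metis atLeastLessThan_iff)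
    then show ?thesis using False by (auto simp: adj_def matrix_of_def nth_default_def)
  qed
qed

lemma cut_colouring_iff:
  assumes "G \<in> mmc_instances"
  shows "cut_colouring (card (verts G)) (joined G) c \<longleftrightarrow>
    proper (joined G) c \<and> (\<exists>x\<in>verts G. \<exists>y\<in>verts G. c x \<noteq> c y)"
proof -
  have V: "set [0..<card (verts G)] = verts G" using instanceD(3)[OF assms] by simp
  have "(\<forall>v\<in>verts G. \<forall>x\<in>verts G. \<forall>y\<in>verts G.
      \<not> (joined G v x \<and> joined G v y \<and> \<not> c x = c v \<and> \<not> c y = c v) \<or> x = y) \<longleftrightarrow> proper (joined G) c"
    unfolding proper_def using joined_verts[OF instanceD(1)[OF assms]] by meson
  then show ?thesis unfolding cut_colouring_def V by simp
qed

lemma cut_size_eq: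
  assumes "G \<in> mmc_instances"
  shows "cut_size (card (verts G)) (joined G) c = card (cut_vertices (joined G) c)"
proof -
  have V: "set [0..<card (verts G)] = verts G" using instanceD(3)[OF assms] by simp
  have "cut_size (card (verts G)) (joined G) c =
     card (set (filter (\<lambda>v. \<exists>y\<in>verts G. joined G v y \<and> \<not> c y = c v) [0..<card (verts G)]))"
    unfolding cut_size_def V by (rule distinct_card[symmetric]) simp
  also have "set (filter (\<lambda>v. \<exists>y\<in>verts G. joined G v y \<and> \<not> c y = c v) [0..<card (verts G)]) = cut_vertices (joined G) c"
    unfolding set_filter V cut_vertices_def using joined_verts[OF instanceD(1)[OF assms]] by blast
  finally show ?thesis .
qed

lemma enc_cut_matrix_cut_edges:
  "enc (cut_matrix n (joined G) c) = encode_edges n (cut_edges G c)"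
proof -
  have "cut_matrix n (joined G) c = map (\<lambda>i. map (\<lambda>j. {i, j} \<in> cut_edges G c) [0..<n]) [0..<n]"
    unfolding cut_matrix_def cut_edges_def by (auto simp: doubleton_eq_iff insert_commute)
  then show ?thesis by (simp add: enc_matrix_encode_edges)
qed

section \<open>Correctness of the algorithm\<close>

lemma set_triples: "set (triples n) = {t. fst t < n \<and> snd (snd t) < n}"
  unfolding triples_def by force

lemma set_guesses: "set (guesses k n) = {L. length L = k \<and> set L \<subseteq> set (triples n)}"
proof (induction k)
  case (Suc k)
  show ?case unfolding guesses.simps
  proof (intro set_eqI iffI)
    fix L assume "L \<in> {L. length L = Suc k \<and> set L \<subseteq> set (triples n)}"
    then obtain t L' where "L = t # L'" "length L' = k" "t \<in> set (triples n)" "set L' \<subseteq> set (triples n)"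
      by (cases L) auto
    then show "L \<in> set (concat (map (\<lambda>t. map (\<lambda>L. t # L) (guesses k n)) (triples n)))"
      using Suc by auto
  qed (use Suc in auto)
qed auto

lemma precolour_None: "precolour E L y = None \<longleftrightarrow> (\<forall>t\<in>set L. y \<noteq> fst t \<and> \<not> E (fst t) y)"
proof -
  have "precolour E L y = None \<longleftrightarrow> filter (\<lambda>t. y = fst t \<or> E (fst t) y) L = []"
    unfolding precolour_def by (auto split: list.split)
  then show ?thesis by (auto simp: filter_empty_conv)
qed

lemma precolour_guess:
  assumes sym: "\<And>i j. E i j \<Longrightarrow> E j i" and irrefl: "\<And>i. \<not> E i i" and c: "proper E c"
    and L: "\<And>u b w. (u, b, w) \<in> set L \<Longrightarrow> b = c u \<and> (if \<exists>x. E u x \<and> c x \<noteq> c u then E u w \<and> c w \<noteq> c u else w = u)"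
  shows "precolour E L y = None \<or> precolour E L y = Some (c y)"
proof (cases "filter (\<lambda>t. y = fst t \<or> E (fst t) y) L")
  case Nil
  then show ?thesis by (simp add: precolour_def)
next
  case (Cons t ts)
  obtain u b w where t: "t = (u, b, w)" by (cases t)
  have "t \<in> set (filter (\<lambda>t. y = fst t \<or> E (fst t) y) L)" using Cons by simp
  then have *: "(u, b, w) \<in> set L" "y = u \<or> E u y" using t by auto
  have "(b \<noteq> (y \<noteq> u \<and> y = w)) = c y"
  proof (cases "y = u")
    case True
    then show ?thesis using L[OF *(1)] by simp
  next
    case False
    then have E: "E u y" using * by simp
    show ?thesis
    proof (cases "c y = c u")
      case True
      then have "y \<noteq> w" using L[OF *(1)] False by (auto split: if_splits)
      then show ?thesis using True L[OF *(1)] by simp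
    next
      case diff: False
      then have "E u w \<and> c w \<noteq> c u" using L[OF *(1)] E by (auto split: if_splits)
      then have "y = w" using properD[OF c E _ diff] by blast
      then show ?thesis using diff False L[OF *(1)] by auto
    qed
  qed
  then show ?thesis using Cons t by (simp add: precolour_def)
qed

text \<open>
  The vertices of the dominating guess \<open>L0\<close> with the colours and the oppositely coloured neighbours
  that they have in \<^term>\<open>c\<close> form a guess whose precolouring agrees with \<^term>\<open>c\<close>. The optimal
  extension of this precolouring competes with \<^term>\<open>c\<close>.
\<close>

lemma candidate_at_least:
  assumes G: "G \<in> mmc_instances" and L0: "L0 \<in> set (guesses k (card (verts G)))"
    and dom: "dominating (card (verts G)) (joined G) L0"
    and c: "proper (joined G) c"
  obtains L where "L \<in> set (guesses k (card (verts G)))"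
    "proper (joined G) (nth_default False (candidate (card (verts G)) (joined G) L))"
    "card (cut_vertices (joined G) c) \<le>
      card (cut_vertices (joined G) (nth_default False (candidate (card (verts G)) (joined G) L)))"
proof -
  let ?n = "card (verts G)" and ?E = "joined G"
  note simple = instanceD(1)[OF G] and V = instanceD(3)[OF G]
  have bound: "i < ?n" "j < ?n" if "?E i j" for i j
    using joined_verts[OF simple that] V by (metis atLeastLessThan_iff)+
  \<comment> \<open>the vertex \<open>u\<close> itself stands for the absence of an oppositely coloured neighbour\<close>
  define w where "w u = (if \<exists>x. ?E u x \<and> c x \<noteq> c u then SOME x. ?E u x \<and> c x \<noteq> c u else u)" for u
  have w: "if \<exists>x. ?E u x \<and> c x \<noteq> c u then ?E u (w u) \<and> c (w u) \<noteq> c u else w u = u" for u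
    unfolding w_def using someI_ex[of "\<lambda>x. ?E u x \<and> c x \<noteq> c u"] by auto
  define L where "L = map (\<lambda>t. (fst t, c (fst t), w (fst t))) L0"
  have "w u < ?n" if "u < ?n" for u using w[of u] that bound by (auto split: if_splits)
  then have L: "L \<in> set (guesses k ?n)"
    using L0 unfolding set_guesses set_triples L_def by auto
  define d where "d = precolour ?E L"
  have None: "d y = None \<longleftrightarrow> precolour ?E L0 y = None" for y
    unfolding d_def precolour_None L_def by auto
  have d: "d y = None \<or> d y = Some (c y)" for y
    unfolding d_def
  proof (rule precolour_guess[OF joined_sym joined_irrefl[OF simple] c])
    show "b = c u \<and> (if \<exists>x. ?E u x \<and> c x \<noteq> c u then ?E u v \<and> c v \<noteq> c u else v = u)"
      if "(u, b, v) \<in> set L" for u b v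
    proof -
      have "b = c u" "v = w u" using that unfolding L_def by auto
      then show ?thesis using w[of u] by simp
    qed
  qed
  interpret precolouring ?n ?E d
  proof
    show "\<not> ?E i j" if "d i = None" "d j = None" for i j
    proof
      assume E: "?E i j"
      then have "i \<in> set [0..<?n]" "j \<in> set [0..<?n]" using bound[OF E] by simp_all
      then show False using that dom E unfolding None dominating_def by blast
    qed
  qed (use joined_sym bound in auto)
  have ext: "extends c" unfolding extends_def
  proof (intro allI impI)
    fix v assume "d v \<noteq> None"
    with d[of v] show "d v = Some (c v)" by blast
  qed
  note opt = complete_optimal[OF c ext, folded extend_refines]
  let ?c = "complete ?n ?E d (nth_default None (extend ?n ?E d))"
  let ?r = "nth_default False (candidate ?n ?E L)"
  have same: "?r v = ?c v" if "v < ?n" for v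
    using that unfolding candidate_def d_def by (simp add: nth_default_def)
  have flip: "?r u \<noteq> ?r v \<longleftrightarrow> ?c u \<noteq> ?c v" if "?E v u" for v u
    by (simp only: same[OF bound(1)[OF that]] same[OF bound(2)[OF that]])
  have "proper ?E ?r"
    unfolding proper_def
  proof (intro allI impI)
    fix v x y assume a: "?E v x" "?E v y" "?r x \<noteq> ?r v" "?r y \<noteq> ?r v"
    show "x = y"
      by (rule properD[OF opt(1) a(1,2)]) (use a flip[OF a(1)] flip[OF a(2)] in \<open>simp_all only: simp_thms\<close>)
  qed
  moreover have "cut_vertices ?E ?r = cut_vertices ?E ?c"
    unfolding cut_vertices_def
  proof (intro Collect_cong ex_cong1 conj_cong refl)
    show "?r y \<noteq> ?r v \<longleftrightarrow> ?c y \<noteq> ?c v" if "?E v y" for v y by (rule flip[OF that])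
  qed
  ultimately show thesis using that[OF L] opt(3) by simp
qed

lemma fold_max:
  fixes f :: "'a \<Rightarrow> nat"
  defines "step \<equiv> \<lambda>c b. case b of None \<Rightarrow> Some c | Some c' \<Rightarrow> if f c' < f c then Some c else b"
  shows "(fold step cs b = None \<longleftrightarrow> cs = [] \<and> b = None) \<and>
    (\<forall>r. fold step cs b = Some r \<longrightarrow>
      r \<in> set cs \<union> set_option b \<and> (\<forall>c\<in>set cs \<union> set_option b. f c \<le> f r))"
proof (induction cs arbitrary: b)
  case (Cons c cs)
  have b: "step c b \<noteq> None" "set_option (step c b) \<subseteq> insert c (set_option b)"
    by (cases b; simp add: step_def)+
  have max: "\<exists>y\<in>set_option (step c b). f x \<le> f y" if "x \<in> insert c (set_option b)" for x
    using that by (cases b) (auto simp: step_def)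
  have fold: "fold step (c # cs) b = fold step cs (step c b)" by simp
  show ?case unfolding fold
  proof (intro conjI allI impI ballI)
    show "fold step cs (step c b) = None \<longleftrightarrow> c # cs = [] \<and> b = None"
      using conjunct1[OF Cons.IH[of "step c b"]] b(1) by simp
  next
    fix r assume r: "fold step cs (step c b) = Some r"
    then have IH: "r \<in> set cs \<union> set_option (step c b)"
      "\<And>x. x \<in> set cs \<union> set_option (step c b) \<Longrightarrow> f x \<le> f r"
      using conjunct2[OF Cons.IH[of "step c b"]] by blast+
    show "r \<in> set (c # cs) \<union> set_option b" using IH(1) b(2) by auto
    fix x assume "x \<in> set (c # cs) \<union> set_option b"
    then consider "x \<in> set cs" | "x \<in> insert c (set_option b)" by auto
    then show "f x \<le> f r"
    proof cases
      case 2
      then obtain y where "y \<in> set_option (step c b)" "f x \<le> f y" using max by blast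
      then show ?thesis using IH(2)[of y] by simp
    qed (use IH(2) in blast)
  qed
qed auto

lemma best_None: "best n E cs = None \<longleftrightarrow> cs = []"
  unfolding best_def using fold_max[where f = "\<lambda>c. cut_size n E (nth_default False c)" and cs = cs and b = None] by simp

lemma best_Some:
  assumes "best n E cs = Some r"
  shows "r \<in> set cs" "c \<in> set cs \<Longrightarrow> cut_size n E (nth_default False c) \<le> cut_size n E (nth_default False r)"
  using assms fold_max[where f = "\<lambda>c. cut_size n E (nth_default False c)" and cs = cs and b = None] unfolding best_def by auto

lemma solve_correct:
  assumes G: "G \<in> mmc_instances" and guess: "has_dominating_guess k (matrix_of G)"
  shows "enc (solve k (matrix_of G)) \<in> mmc_answers G"
proof -
  let ?n = "card (verts G)" and ?E = "joined G"
  define cs where "cs = filter (\<lambda>c. cut_colouring ?n ?E (nth_default False c)) (map (candidate ?n ?E) (guesses k ?n))"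
  note simple = instanceD(1)[OF G] and conn = instanceD(2)[OF G]
  have solve: "solve k (matrix_of G) = (case best ?n ?E cs of None \<Rightarrow> None
     | Some c \<Rightarrow> Some (cut_matrix ?n ?E (nth_default False c)))"
    unfolding solve_def length_matrix_of adj_matrix_of[OF G] cs_def ..
  have sound: "matching_cut G (cut_edges G (nth_default False c))"
      "proper ?E (nth_default False c)" if "c \<in> set cs" for c
  proof -
    have c: "proper ?E (nth_default False c)" "\<exists>x\<in>verts G. \<exists>y\<in>verts G. nth_default False c x \<noteq> nth_default False c y"
      using that cut_colouring_iff[OF G, of "nth_default False c"] unfolding cs_def by auto
    show "proper ?E (nth_default False c)" by (rule c)
    show "matching_cut G (cut_edges G (nth_default False c))"
      unfolding matching_cut_iff[OF simple] by (intro exI[of _ "nth_default False c"] conjI c refl)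
  qed
  obtain L0 where L0: "L0 \<in> set (guesses k ?n)" "dominating ?n ?E L0"
    using guess unfolding has_dominating_guess_def length_matrix_of adj_matrix_of[OF G] by blast
  have complete: "\<exists>c\<in>set cs. card M \<le> card (cut_edges G (nth_default False c))" if M: "matching_cut G M" for M
  proof -
    obtain c x y where c: "proper ?E c" "M = cut_edges G c" "x \<in> verts G" "y \<in> verts G" "c x \<noteq> c y"
      using M unfolding matching_cut_iff[OF simple] by blast
    obtain L where L: "L \<in> set (guesses k ?n)" "proper ?E (nth_default False (candidate ?n ?E L))"
      "card (cut_vertices ?E c) \<le> card (cut_vertices ?E (nth_default False (candidate ?n ?E L)))"
      using candidate_at_least[OF G L0 c(1)] .
    let ?r = "nth_default False (candidate ?n ?E L)"
    have "cut_vertices ?E c \<subseteq> verts G" using joined_verts[OF simple] unfolding cut_vertices_def by blast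
    then have "finite (cut_vertices ?E c)" using simple finite_subset unfolding simple_graph_def by blast
    \<comment> \<open>a nonempty cut forces the candidate to use both colours\<close>
    then have "0 < card (cut_vertices ?E c)" using connected_cut_vertex[OF conn c(3-5)] by (simp add: card_gt_0_iff)
    then have "cut_vertices ?E ?r \<noteq> {}" using L(3) by auto
    then obtain v y where vy: "?E v y" "?r y \<noteq> ?r v" unfolding cut_vertices_def by blast
    then have "\<exists>x\<in>verts G. \<exists>y\<in>verts G. ?r x \<noteq> ?r y" using joined_verts[OF simple vy(1)] by blast
    then have "candidate ?n ?E L \<in> set cs"
      unfolding cs_def using L(1,2) cut_colouring_iff[OF G, of ?r] by auto
    moreover have "card M \<le> card (cut_edges G ?r)"
      using L(3) card_cut_edges[OF simple c(1)] card_cut_edges[OF simple L(2)] c(2) by simp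
    ultimately show ?thesis by blast
  qed
  show ?thesis
  proof (cases "best ?n ?E cs")
    case None
    then have "cs = []" by (simp add: best_None)
    then have "\<not> (\<exists>M. matching_cut G M)" using complete by auto
    then show ?thesis using None by (simp add: solve mmc_answers_def)
  next
    case (Some r)
    let ?M = "cut_edges G (nth_default False r)"
    note r = best_Some[OF Some]
    have "maximum_matching_cut G ?M"
      unfolding maximum_matching_cut_def
    proof (intro conjI allI impI)
      show "matching_cut G ?M" by (rule sound(1)[OF r(1)])
      fix M assume "matching_cut G M"
      then obtain c where c: "c \<in> set cs" "card M \<le> card (cut_edges G (nth_default False c))" using complete by blast
      then show "card M \<le> card ?M"
        using r(2)[OF c(1)] card_cut_edges[OF simple sound(2)[OF c(1)]] card_cut_edges[OF simple sound(2)[OF r(1)]]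
        unfolding cut_size_eq[OF G] by simp
    qed
    moreover from this have "\<exists>M. matching_cut G M" unfolding maximum_matching_cut_def by blast
    moreover have "enc (solve k (matrix_of G)) = encode_option (Some (encode_edges ?n ?M))"
      using Some by (simp add: solve enc_cut_matrix_cut_edges)
    ultimately show ?thesis unfolding mmc_answers_def by auto
  qed
qed

section \<open>Graphs without a dominating guess\<close>

lemma path_graph_2: "verts (path_graph 2) = {0, 1}" "edges (path_graph 2) = {{0, 1}}"
  unfolding path_graph_def by (auto simp: less_Suc_eq numeral_2_eq_2)

lemma induced_sum_edge:
  assumes f: "bij_betw f (verts H) U" "(\<lambda>e. f ` e) ` edges H = {e \<in> edges G. e \<subseteq> U}"
    and H: "simple_graph H" and G: "simple_graph G"
    and ij: "joined G i j" "i \<notin> U" "j \<notin> U" "\<And>u. u \<in> U \<Longrightarrow> \<not> joined G u i \<and> \<not> joined G u j"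
  shows "graph_iso (graph_sum H (path_graph 2)) (induced_subgraph G (U \<union> {i, j}))"
proof -
  define g where "g = case_sum f (\<lambda>m::nat. if m = 0 then i else j)"
  have g: "g (Inl h) = f h" "g (Inr 0) = i" "g (Inr (Suc 0)) = j" for h by (simp_all add: g_def)
  have "i \<noteq> j" using joined_irrefl[OF G] ij(1) by blast
  have fU: "f ` verts H = U" and inj: "inj_on f (verts H)" using f(1) by (auto simp: bij_betw_def)
  have verts: "verts (graph_sum H (path_graph 2)) = Inl ` verts H \<union> {Inr 0, Inr 1}"
    by (simp add: graph_sum_def path_graph_2)
  have "bij_betw g (verts (graph_sum H (path_graph 2))) (U \<union> {i, j})"
    unfolding bij_betw_def
  proof
    show "g ` verts (graph_sum H (path_graph 2)) = U \<union> {i, j}"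
      unfolding verts image_Un image_image using fU by (auto simp: g image_iff)
    show "inj_on g (verts (graph_sum H (path_graph 2)))"
      unfolding verts using inj fU ij(2,3) \<open>i \<noteq> j\<close>
      by (auto simp: inj_on_def g)
  qed
  moreover have "(\<lambda>e. g ` e) ` edges (graph_sum H (path_graph 2)) = {e \<in> edges G. e \<subseteq> U} \<union> {{i, j}}"
  proof -
    have "(\<lambda>e. g ` e) ` edges (graph_sum H (path_graph 2)) = (\<lambda>e. f ` e) ` edges H \<union> {{i, j}}"
      by (simp add: graph_sum_def path_graph_2 image_Un image_image g)
    then show ?thesis using f(2) by simp
  qed
  moreover have "{e \<in> edges G. e \<subseteq> U} \<union> {{i, j}} = {e \<in> edges G. e \<subseteq> U \<union> {i, j}}"
  proof (intro equalityI subsetI)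
    fix e assume e: "e \<in> {e \<in> edges G. e \<subseteq> U \<union> {i, j}}"
    then have "card e = 2" using G unfolding simple_graph_def by blast
    then obtain a b where ab: "e = {a, b}" "a \<noteq> b" by (meson card_2_iff)
    then have "joined G a b" "joined G b a" using e by (auto simp: insert_commute)
    moreover have "a \<in> U \<union> {i, j}" "b \<in> U \<union> {i, j}" using e ab by auto
    ultimately show "e \<in> {e \<in> edges G. e \<subseteq> U} \<union> {{i, j}}"
      using ij(4)[of a] ij(4)[of b] ab e by (auto simp: insert_commute)
  qed (use ij(1) in auto)
  ultimately show ?thesis unfolding graph_iso_def induced_subgraph_def by auto
qed

text \<open>
  The vertices of an induced copy of \<^term>\<open>H\<close> would form a guess that is not dominating. An edge outside
  their closed neighbourhood would then extend the copy to an induced copy of the disjoint union of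
  \<^term>\<open>H\<close> and an edge.
\<close>

lemma graph_free_without_dominating_guess:
  assumes G: "G \<in> mmc_instances" and H: "simple_graph H"
    and free: "graph_free (graph_sum H (path_graph 2)) G"
    and no: "\<not> has_dominating_guess (card (verts H)) (matrix_of G)"
  shows "graph_free H G"
  unfolding graph_free_def
proof
  assume "\<exists>U\<subseteq>verts G. graph_iso H (induced_subgraph G U)"
  then obtain U f where U: "U \<subseteq> verts G" and f: "bij_betw f (verts H) U" "(\<lambda>e. f ` e) ` edges H = {e \<in> edges G. e \<subseteq> U}"
    unfolding graph_iso_def induced_subgraph_def by auto
  let ?n = "card (verts G)"
  note simple = instanceD(1)[OF G] and V = instanceD(3)[OF G]
  have "finite U" using U simple unfolding simple_graph_def by (blast intro: finite_subset)
  then obtain us where us: "set us = U" "distinct us" using finite_distinct_list by blast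
  let ?L = "map (\<lambda>u. (u, False, u)) us"
  have "length us = card (verts H)" using bij_betw_same_card[OF f(1)] us distinct_card by metis
  moreover have "u < ?n" if "u \<in> U" for u using that U V by (metis atLeastLessThan_iff subsetD)
  ultimately have "?L \<in> set (guesses (card (verts H)) ?n)"
    using us(1) unfolding set_guesses set_triples by auto
  then have "\<not> dominating ?n (joined G) ?L"
    using no unfolding has_dominating_guess_def length_matrix_of adj_matrix_of[OF G] by blast
  then obtain i j where ij: "i < ?n" "j < ?n" "joined G i j" and
    None: "precolour (joined G) ?L i = None" "precolour (joined G) ?L j = None"
    unfolding dominating_def by auto
  have "u \<noteq> i \<and> u \<noteq> j \<and> \<not> joined G u i \<and> \<not> joined G u j" if "u \<in> U" for u
    using that us(1) None unfolding precolour_None by auto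
  then have "graph_iso (graph_sum H (path_graph 2)) (induced_subgraph G (U \<union> {i, j}))"
    by (intro induced_sum_edge[OF f H simple ij(3)]) blast+
  moreover have "U \<union> {i, j} \<subseteq> verts G" using U joined_verts[OF simple ij(3)] by blast
  ultimately show False using free unfolding graph_free_def by blast
qed

section \<open>Calling a program in an arbitrary store\<close>

primrec expr_vars :: "expr \<Rightarrow> nat set" where
  "expr_vars (EVar x) = {x}"
| "expr_vars ELeaf = {}"
| "expr_vars (ENode a b) = expr_vars a \<union> expr_vars b"
| "expr_vars (ELeft a) = expr_vars a"
| "expr_vars (ERight a) = expr_vars a"

primrec com_vars :: "com \<Rightarrow> nat set" where
  "com_vars Skip = {}"
| "com_vars (Assign x e) = insert x (expr_vars e)"
| "com_vars (Seq c1 c2) = com_vars c1 \<union> com_vars c2"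
| "com_vars (Cond e c1 c2) = expr_vars e \<union> com_vars c1 \<union> com_vars c2"
| "com_vars (While e c) = expr_vars e \<union> com_vars c"

lemma finite_com_vars: "finite (com_vars c)"
proof -
  have "finite (expr_vars e)" for e by (induction e) auto
  then show ?thesis by (induction c) auto
qed

definition agree :: "nat set \<Rightarrow> store \<Rightarrow> store \<Rightarrow> bool" where
  "agree X s s' \<longleftrightarrow> (\<forall>x\<in>X. s x = s' x)"

lemma eval_expr_agree: "agree X s s' \<Longrightarrow> expr_vars e \<subseteq> X \<Longrightarrow> eval_expr e s = eval_expr e s'"
  by (induction e) (auto simp: agree_def)

lemma exec_agree:
  "exec c s t s' \<Longrightarrow> com_vars c \<subseteq> X \<Longrightarrow> agree X s u \<Longrightarrow> \<exists>u'. exec c u t u' \<and> agree X s' u'"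
proof (induction arbitrary: u rule: exec.induct)
  case (Skip s)
  then show ?case using exec.Skip by blast
next
  case (Assign x e s)
  have "eval_expr e s = eval_expr e u" using eval_expr_agree Assign by auto
  then have "agree X (s(x := eval_expr e s)) (u(x := eval_expr e u))"
    using Assign by (auto simp: agree_def)
  then show ?case using exec.Assign by blast
next
  case (Seq c1 s t1 s1 c2 t2 s2)
  then show ?case using exec.Seq by (metis Un_subset_iff com_vars.simps(3))
next
  case (CondTrue e s c1 t s' c2)
  have "eval_expr e u \<noteq> Leaf" using eval_expr_agree[OF CondTrue.prems(2)] CondTrue by auto
  then show ?case using exec.CondTrue CondTrue by (metis Un_subset_iff com_vars.simps(4))
next
  case (CondFalse e s c2 t s' c1)
  have "eval_expr e u = Leaf" using eval_expr_agree[OF CondFalse.prems(2)] CondFalse by auto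
  then show ?case using exec.CondFalse CondFalse by (metis Un_subset_iff com_vars.simps(4))
next
  case (WhileFalse e s c)
  have "eval_expr e u = Leaf" using eval_expr_agree[OF WhileFalse.prems(2)] WhileFalse by auto
  then show ?case using exec.WhileFalse WhileFalse by blast
next
  case (WhileTrue e s c t1 s1 t2 s2)
  have e: "eval_expr e u \<noteq> Leaf" using eval_expr_agree[OF WhileTrue.prems(2)] WhileTrue by auto
  obtain u1 where 1: "exec c u t1 u1" "agree X s1 u1"
    using WhileTrue.IH(1)[OF _ WhileTrue.prems(2)] WhileTrue.prems(1) by auto
  obtain u2 where 2: "exec (While e c) u1 t2 u2" "agree X s2 u2"
    using WhileTrue.IH(2)[OF WhileTrue.prems(1) 1(2)] by blast
  show ?case using exec.WhileTrue[OF e 1(1) 2(1)] 2(2) by blast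
qed

primrec clear :: "nat list \<Rightarrow> com" where
  "clear [] = Skip"
| "clear (x # xs) = Seq (Assign x ELeaf) (clear xs)"

lemma exec_within_clear:
  "exec_within (clear xs) s (length xs * (size ELeaf + 1) + 1) (\<lambda>z. if z \<in> set xs then Leaf else s z)"
proof (induction xs arbitrary: s)
  case Nil
  show ?case using exec.Skip by (auto simp: exec_within_def)
next
  case (Cons x xs)
  from exec_within_Seq[OF exec_within_Assign Cons.IH, of x ELeaf s]
  have "exec_within (clear (x # xs)) s (size ELeaf + 1 + (length xs * (size ELeaf + 1) + 1))
    (\<lambda>z. if z \<in> set xs then Leaf else (s(x := Leaf)) z)"
    by (simp only: clear.simps eval_expr.simps)
  moreover have "(\<lambda>z. if z \<in> set xs then Leaf else (s(x := Leaf)) z) = (\<lambda>z. if z \<in> set (x # xs) then Leaf else s z)"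
    by auto
  ultimately show ?case by (simp add: add.assoc)
qed

text \<open>
  The program that solves the problem on \<^term>\<open>H\<close>-free graphs is only known to work when all variables other than
  \<open>0\<close> are empty. Emptying the finitely many variables that occur in it has the same effect.
\<close>

lemma exec_in_any_store:
  "\<exists>p' k. \<forall>x t s u. exec p (input_store x) t s \<longrightarrow> u 0 = x \<longrightarrow>
     (\<exists>u'. exec_within p' u (k + t) u' \<and> u' 0 = s 0)"
proof -
  obtain xs where xs: "set xs = com_vars p - {0}" using finite_list[OF finite_Diff[OF finite_com_vars]] by blast
  have "\<exists>u'. exec_within (Seq (clear xs) p) u ((length xs * (size ELeaf + 1) + 1) + t) u' \<and> u' 0 = s 0"
    if "exec p (input_store x) t s" "u 0 = x" for x t s u
  proof -
    let ?u = "\<lambda>z. if z \<in> set xs then Leaf else u z"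
    have "agree (insert 0 (com_vars p)) (input_store x) ?u"
      using that(2) xs by (auto simp: agree_def input_store_def)
    from exec_agree[OF that(1) _ this] obtain u' where "exec p ?u t u'" "agree (insert 0 (com_vars p)) s u'" by blast
    then have "exec_within p ?u t u'" "u' 0 = s 0" by (auto simp: exec_within_def agree_def)
    then show ?thesis using exec_within_Seq[OF exec_within_clear] by blast
  qed
  then show ?thesis by blast
qed

section \<open>The reduction\<close>

theorem theorem23:
  fixes H :: "'h ugraph"
  assumes "simple_graph H"
    and "mmc_poly_time_on_free H"
  shows "mmc_poly_time_on_free (graph_sum H (path_graph 2))"
proof -
  let ?k = "card (verts H)"
  let ?guess = "has_dominating_guess ?k"
  obtain p q where pq: "\<forall>G\<in>{G \<in> mmc_instances. graph_free H G}. \<exists>t s.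
      exec p (input_store (encode_graph G)) t s \<and> t \<le> poly q (size (encode_graph G)) \<and> s 0 \<in> mmc_answers G"
    using assms(2) unfolding mmc_poly_time_on_free_def poly_time_solvable_def by blast
  obtain p' k where p': "\<forall>x t s u. exec p (input_store x) t s \<longrightarrow> u 0 = x \<longrightarrow>
     (\<exists>u'. exec_within p' u (k + t) u' \<and> u' 0 = s 0)" using exec_in_any_store by blast
  obtain c1 T1 where T1: "poly_bounded T1" and c1: "computes c1 T1 (\<lambda>A. (A, ?guess A))"
    using polytimeE[OF polytime_Pair[OF polytime_id polytime_has_dominating_guess]] by metis
  obtain c2 T2 where T2: "poly_bounded T2" and c2: "computes c2 T2 (solve ?k)"
    using polytimeE[OF polytime_solve] by metis
  let ?b = "ERight (EVar 0)" and ?l = "ELeft (EVar 0)"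
  \<comment> \<open>the first part leaves the instance paired with the answer to whether it has a dominating guess\<close>
  let ?prog = "Seq c1 (Cond ?b (Seq (Assign 0 ?l) c2) (Seq (Assign 0 ?l) p'))"
  let ?T = "\<lambda>A. T1 A + (size ?b + 1 + (size ?l + 1 + (T2 A + (k + poly q (size (enc A))))))"
  have "poly_bounded ?T"
    by (intro poly_bounded_add poly_bounded_const T1 T2 poly_bounded_poly poly_bounded_size)
  then obtain Q where Q: "\<And>A. ?T A \<le> poly Q (size (enc A))" unfolding poly_bounded_def by blast
  have "\<exists>t s. exec ?prog (input_store (encode_graph G)) t s \<and> t \<le> poly Q (size (encode_graph G)) \<and> s 0 \<in> mmc_answers G"
    if G: "G \<in> mmc_instances" "graph_free (graph_sum H (path_graph 2)) G" for G
  proof -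
    let ?A = "matrix_of G"
    have A: "enc ?A = encode_graph G" by (rule enc_matrix_of)
    have "input_store (encode_graph G) 0 = enc ?A" by (simp add: A input_store_def)
    from computesD[OF c1, where x = ?A and s = "input_store (encode_graph G)", OF this] obtain s1 where s1: "exec_within c1 (input_store (encode_graph G)) (T1 ?A) s1"
      "s1 0 = enc (?A, ?guess ?A)" by blast
    let ?s2 = "s1(0 := enc ?A)"
    have 2: "exec_within (Assign 0 ?l) s1 (size ?l + 1) ?s2"
      using exec_within_Assign[of 0 ?l s1] s1(2) by simp
    have b: "eval_expr ?b s1 \<noteq> Leaf \<longleftrightarrow> ?guess ?A" using s1(2) by (cases "?guess ?A") simp_all
    have "\<exists>s. exec_within (if ?guess ?A then Seq (Assign 0 ?l) c2 else Seq (Assign 0 ?l) p') s1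
        (size ?l + 1 + (T2 ?A + (k + poly q (size (enc ?A))))) s \<and> s 0 \<in> mmc_answers G"
    proof (cases "?guess ?A")
      case True
      from computesD[OF c2, of ?s2 ?A] obtain s where s: "exec_within c2 ?s2 (T2 ?A) s" "s 0 = enc (solve ?k ?A)"
        by auto
      have "exec_within (Seq (Assign 0 ?l) c2) s1 (size ?l + 1 + (T2 ?A + (k + poly q (size (enc ?A))))) s"
        by (rule exec_within_mono[OF exec_within_Seq[OF 2 s(1)]]) simp
      then show ?thesis using True s(2) solve_correct[OF G(1) True] by auto
    next
      case False
      have "graph_free H G" by (rule graph_free_without_dominating_guess[OF G(1) assms(1) G(2) False])
      then obtain t s where ts: "exec p (input_store (encode_graph G)) t s" "t \<le> poly q (size (encode_graph G))"
        "s 0 \<in> mmc_answers G" using pq G(1) by blast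
      have "?s2 0 = encode_graph G" by (simp add: A)
      with p' ts(1) obtain s' where s': "exec_within p' ?s2 (k + t) s'" "s' 0 = s 0" by blast
      have "exec_within (Seq (Assign 0 ?l) p') s1 (size ?l + 1 + (T2 ?A + (k + poly q (size (enc ?A))))) s'"
        by (rule exec_within_mono[OF exec_within_Seq[OF 2 s'(1)]]) (use ts(2) in \<open>simp add: A\<close>)
      then show ?thesis using False s'(2) ts(3) by auto
    qed
    then obtain s where s: "exec_within (if ?guess ?A then Seq (Assign 0 ?l) c2 else Seq (Assign 0 ?l) p') s1
        (size ?l + 1 + (T2 ?A + (k + poly q (size (enc ?A))))) s" "s 0 \<in> mmc_answers G" by blast
    have "exec_within ?prog (input_store (encode_graph G)) (?T ?A) s"
      by (rule exec_within_Seq[OF s1(1) exec_within_Cond]) (use s(1) b in simp)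
    then show ?thesis using Q[of ?A] s(2) unfolding exec_within_def A by (meson order_trans)
  qed
  then show ?thesis unfolding mmc_poly_time_on_free_def poly_time_solvable_def by blast
qed

end
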